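(* Let $N\ge 1$ and let $u \in C^\beta_c(\mathbb{R}^N)$ for some $\beta>0$. Then for every $x\in\mathbb{R}^N$ the derivative $L_\Delta u(x) := \frac{d}{ds}\big|_{s=0} [(-\Delta)^s u](x)$ is given by $$ L_\Delta u(x)= c_{N} \int_{\mathbb{R}^N} \frac{ u(x)1_{B_1(x)}(y)-u(y)}{|x-y|^{N} }\, dy + \rho_N u(x) = c_{N} \int_{B_1(x)} \frac{ u(x) -u(y)}{|x-y|^{N} }\, dy-c_N\int_{\mathbb{R}^N\setminus B_1(x)}\frac{u(y)}{|x-y|^{N} }\, dy + \rho_N u(x), $$ where $c_N:= \pi^{-N/2}\Gamma(N/2) = \frac{2}{|S^{N-1}|}$ and $\rho_N:=2 \log 2 + \psi(\frac{N}{2}) -\gamma$. Moreover: (i) for $1 < p \le \infty$, we have $L_\Delta u \in L^p(\mathbb{R}^N)$ and $\frac{(-\Delta)^s u- u}{s} \to L_\Delta u$ in $L^p(\mathbb{R}^N)$ as $s \to 0^+$; (ii) $\mathcal{F}(L_\Delta u)(\xi) = (2 \log |\xi|)\, \widehat u (\xi)$ for a.e. $\xi \in \mathbb{R}^N$.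
   Context: $C^\beta_c(\mathbb{R}^N)$ is the space of compactly supported (Hölder) $C^\beta$ functions $\mathbb{R}^N\to\mathbb{R}$. $B_1(x)$ is the open unit ball centered at $x$, $1_A$ is the indicator function of $A$, and $|S^{N-1}|$ is the surface measure of the unit sphere ($|S^0|=2$). $\Gamma$ is the Gamma function, $\psi=\Gamma'/\Gamma$ the Digamma function, $\gamma=-\Gamma'(1)$ the Euler–Mascheroni constant. For $s\in(0,1)$ the fractional Laplacian is $$(-\Delta)^s u(x)=c_{N,s}\lim_{\epsilon\to0^+}\int_{\mathbb{R}^N\setminus B_\epsilon(x)}\frac{u(x)-u(y)}{|x-y|^{N+2s}}\,dy,\qquad c_{N,s}=2^{2s}\pi^{-\frac N2}s\,\frac{\Gamma(\frac{N+2s}{2})}{\Gamma(1-s)}$$ (well defined on $u \in C^\beta_c(\mathbb{R}^N)$ for all sufficiently small $s>0$), and $(-\Delta)^0u:=u$; the derivative at $s=0$ is the right derivative $\lim_{s\to0^+}\frac{(-\Delta)^su(x)-u(x)}{s}$. $\mathcal{F}$ and $\widehat{\cdot}$ both denote the Fourier transform, with the convention (kernel $e^{-ix\cdot\xi}$) for which $\mathcal{F}((-\Delta)^s u)(\xi)=|\xi|^{2s}\widehat u(\xi)$. *)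

theory Defs
  imports "HOL-Analysis.Analysis" "HOL-Probability.Essential_Supremum"
begin

text \<open>Throughout, \<open>\<real>\<^sup>N\<close> is an arbitrary type \<open>'a\<close> of class \<open>euclidean_space\<close> and \<open>N = DIM('a) \<ge> 1\<close>.\<close>

section \<open>Compactly supported Hoelder functions\<close>

text \<open>Class \<open>C\<^sup>k\<^sup>,\<^sup>\<alpha>\<close>: all partial derivatives up to order \<open>k\<close> exist (as directional values of
  the Frechet derivative) and those of order \<open>k\<close> are \<open>\<alpha>\<close>-Hoelder continuous.\<close>

primrec Holder_class :: "nat \<Rightarrow> real \<Rightarrow> ('a::euclidean_space \<Rightarrow> real) \<Rightarrow> bool" where
  "Holder_class 0 \<alpha> u \<longleftrightarrow> (\<exists>C. \<forall>x y. \<bar>u x - u y\<bar> \<le> C * norm (x - y) powr \<alpha>)"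
| "Holder_class (Suc k) \<alpha> u \<longleftrightarrow> u differentiable_on UNIV \<and>
     (\<forall>b\<in>Basis. Holder_class k \<alpha> (\<lambda>x. frechet_derivative u (at x) b))"

text \<open>\<open>\<beta> = k + \<alpha>\<close> with \<open>k = \<lceil>\<beta>\<rceil> - 1\<close> and \<open>\<alpha> \<in> (0,1]\<close>. For integer \<open>\<beta>\<close> this is the class
  \<open>C\<^sup>k\<^sup>,\<^sup>1\<close> with \<open>k = \<beta> - 1\<close>, which contains every compactly supported function that is \<open>\<beta>\<close> times
  continuously differentiable. Because of the compact support there is no difference between
  local and global Hoelder continuity.\<close>

definition Holder_c :: "real \<Rightarrow> ('a::euclidean_space \<Rightarrow> real) set" where
  "Holder_c \<beta> = {u. Holder_class (nat (\<lceil>\<beta>\<rceil> - 1)) (\<beta> - of_int (\<lceil>\<beta>\<rceil> - 1)) u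
                    \<and> compact (closure (support_on UNIV u))}"

section \<open>The fractional Laplacian and its derivative at order zero\<close>

definition frac_const :: "nat \<Rightarrow> real \<Rightarrow> real" where
  "frac_const N s = 2 powr (2 * s) * pi powr (- (real N / 2)) * s *
     (Gamma ((real N + 2 * s) / 2) / Gamma (1 - s))"

definition frac_kernel :: "real \<Rightarrow> ('a::euclidean_space \<Rightarrow> real) \<Rightarrow> 'a \<Rightarrow> 'a \<Rightarrow> real" where
  "frac_kernel s u x y = (u x - u y) / norm (x - y) powr (real DIM('a) + 2 * s)"

definition frac_laplacian :: "real \<Rightarrow> ('a::euclidean_space \<Rightarrow> real) \<Rightarrow> 'a \<Rightarrow> real" where
  "frac_laplacian s u x =
     (if s = 0 then u x
      else frac_const DIM('a) s *
        Lim (at_right 0) (\<lambda>\<epsilon>. LINT y:- ball x \<epsilon>|lborel. frac_kernel s u x y))"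

text \<open>\<open>Lim\<close> and the Lebesgue integral are total functions; the following predicate says that the
  defining expression of \<open>frac_laplacian s u x\<close> for \<open>s \<noteq> 0\<close> is meaningful.\<close>

definition frac_laplacian_exists :: "real \<Rightarrow> ('a::euclidean_space \<Rightarrow> real) \<Rightarrow> 'a \<Rightarrow> bool" where
  "frac_laplacian_exists s u x \<longleftrightarrow>
     (\<forall>\<epsilon>>0. set_integrable lborel (- ball x \<epsilon>) (frac_kernel s u x)) \<and>
     (\<exists>l. ((\<lambda>\<epsilon>. LINT y:- ball x \<epsilon>|lborel. frac_kernel s u x y) \<longlongrightarrow> l) (at_right 0))"

definition log_laplacian :: "('a::euclidean_space \<Rightarrow> real) \<Rightarrow> 'a \<Rightarrow> real" where
  "log_laplacian u x = Lim (at_right 0) (\<lambda>s. (frac_laplacian s u x - u x) / s)"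

definition log_const :: "nat \<Rightarrow> real" where
  "log_const N = pi powr (- (real N / 2)) * Gamma (real N / 2)"

definition rho_const :: "nat \<Rightarrow> real" where
  "rho_const N = 2 * ln 2 + Digamma (real N / 2) - euler_mascheroni"

text \<open>Surface measure on the unit sphere as it occurs in polar coordinates: \<open>N\<close> times the
  Lebesgue measure of the part of the unit ball lying over \<open>E\<close>. For \<open>N = 1\<close> it is counting
  measure on \<open>{-1, 1}\<close>.\<close>

definition sphere_surface_measure :: "'a::euclidean_space set \<Rightarrow> real" where
  "sphere_surface_measure E =
     real DIM('a) * measure lborel {r *\<^sub>R \<omega> | r \<omega>. 0 < r \<and> r < 1 \<and> \<omega> \<in> E}"

section \<open>Lebesgue spaces\<close>

definition Lp_space :: "ennreal \<Rightarrow> ('a::euclidean_space \<Rightarrow> 'b::{banach,second_countable_topology}) set" where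
  "Lp_space p = {f \<in> borel_measurable lborel.
     if p = \<infinity> then \<exists>C. AE x in lborel. norm (f x) \<le> C
     else integrable lborel (\<lambda>x. norm (f x) powr enn2real p)}"

definition Lp_norm :: "ennreal \<Rightarrow> ('a::euclidean_space \<Rightarrow> 'b::{banach,second_countable_topology}) \<Rightarrow> real" where
  "Lp_norm p f =
     (if p = \<infinity> then real_of_ereal (esssup lborel (\<lambda>x. ereal (norm (f x))))
      else (LINT x|lborel. norm (f x) powr enn2real p) powr (1 / enn2real p))"

definition tendsto_Lp ::
  "ennreal \<Rightarrow> ('i \<Rightarrow> 'a::euclidean_space \<Rightarrow> 'b::{banach,second_countable_topology}) \<Rightarrow> ('a \<Rightarrow> 'b) \<Rightarrow> 'i filter \<Rightarrow> bool" where
  "tendsto_Lp p F f net \<longleftrightarrow>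
     f \<in> Lp_space p \<and> (\<forall>\<^sub>F i in net. F i \<in> Lp_space p) \<and>
     ((\<lambda>i. Lp_norm p (\<lambda>x. F i x - f x)) \<longlongrightarrow> 0) net"

section \<open>The Fourier transform\<close>

definition fourier_integral :: "('a::euclidean_space \<Rightarrow> complex) \<Rightarrow> 'a \<Rightarrow> complex" where
  "fourier_integral f \<xi> = (LINT x|lborel. exp (- \<i> * of_real (x \<bullet> \<xi>)) * f x)"

text \<open>\<open>g\<close> is (a representative of) the Fourier-Plancherel transform of \<open>f \<in> L\<^sup>2\<close>: the limit in
  \<open>L\<^sup>2\<close> of the Fourier integrals of the truncations of \<open>f\<close> to balls. It is unique almost
  everywhere.\<close>

definition is_plancherel_transform ::
  "('a::euclidean_space \<Rightarrow> complex) \<Rightarrow> ('a \<Rightarrow> complex) \<Rightarrow> bool" where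
  "is_plancherel_transform f g \<longleftrightarrow>
     f \<in> Lp_space 2 \<and>
     tendsto_Lp 2 (\<lambda>R. fourier_integral (\<lambda>x. indicator (ball 0 R) x * f x)) g at_top"

text \<open>On \<open>L\<^sup>1\<close> the Fourier transform is given by the integral, on \<open>L\<^sup>2\<close> by the Plancherel
  extension; on \<open>L\<^sup>1 \<inter> L\<^sup>2\<close> the two agree almost everywhere.\<close>

definition fourier :: "('a::euclidean_space \<Rightarrow> complex) \<Rightarrow> 'a \<Rightarrow> complex" where
  "fourier f = (if integrable lborel f then fourier_integral f
                else (SOME g. is_plancherel_transform f g))"

end

theory Submission
  imports Defs "HOL-Probability.Probability"
begin

text \<open>Splitting the integral at \<open>|x - y| = 1\<close> gives
  \<open>(-\<Delta>)\<^sup>s u(x) = c (G\<^sub>s(x) + u(x) |S| / (2 s))\<close> with \<open>c = c\<^sub>N\<^sub>,\<^sub>s = O(s)\<close>, where \<open>G\<^sub>s\<close> is the integral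
  in the theorem with \<open>N + 2 s\<close> in place of \<open>N\<close>. As \<open>s\<close> tends to 0, \<open>G\<^sub>s\<close> converges uniformly at rate
  \<open>O(s)\<close>, and all \<open>G\<^sub>s\<close> are bounded by a multiple of \<open>(1 + |x|)\<^sup>-\<^sup>N\<close>; interpolation gives
  convergence in \<open>L\<^sup>p\<close> for \<open>p > 1\<close>. For the Fourier transform, the difference quotients are integrable
  with Fourier integral \<open>((|\<xi>|\<^sup>2\<^sup>s - 1) / s) \<F>u(\<xi>)\<close>. By Fatou's lemma the inequality
  \<open>\<parallel>\<F>f\<parallel>\<^sup>2 \<le> (2\<pi>)\<^sup>N \<parallel>f\<parallel>\<^sup>2\<close> on \<open>L\<^sup>1 \<inter> L\<^sup>2\<close> passes to the limit, so that neither the full Plancherel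
  theorem nor completeness of \<open>L\<^sup>2\<close> is needed.\<close>

section \<open>Radial integrals\<close>

text \<open>The constants have one source. The function \<open>c\<^sub>N\<^sub>,\<^sub>s / s\<close>
  is smooth at 0 with value \<open>c\<^sub>N\<close>, and \<open>c\<^sub>N |S| / 2 = 1\<close>.
  Hence the term \<open>c u(x) |S| / (2 s)\<close> cancels \<open>u(x)\<close> to leading order, and
  what survives in the difference quotient is the logarithmic derivative of
  \<open>c\<^sub>N\<^sub>,\<^sub>s / s\<close> at 0, which is \<open>\<rho>\<^sub>N\<close>. The
  obstacle is that the weight \<open>(1 + |x|)^(-N)\<close> is borderline: its powers with exponent
  above 1 are integrable, the weight itself is not. At infinity the limit behaves like a multiple of
  \<open>|x|^(-N)\<close> times the integral of \<open>u\<close>, so in general it lies outside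
  \<open>L^1\<close>. This excludes \<open>p = 1\<close> and forces the Plancherel transform in
  (ii). For \<open>s > 0\<close> the additional decay \<open>|x|^(-2 s)\<close> restores
  integrability, so Fourier integrals are computed there. Uniform convergence alone gives nothing in
  \<open>L^p\<close> of the whole space, and the weight alone gives no smallness; both bounds enter
  the interpolation.\<close>

lemma lborel_distr_reflect:
  fixes x :: "'a::euclidean_space"
  shows "distr lborel borel (\<lambda>y. x - y) = lborel"
  using lborel_affine[of "-1" x] by (simp add: density_1)

text \<open>The reflection \<open>y \<mapsto> x - y\<close> covers two uses at once: the change of
  variables \<open>z = x - y\<close> in integrals over kernels, and, for \<open>x = 0\<close>, the
  symmetry under \<open>z \<mapsto> - z\<close>.\<close>

lemma nn_integral_reflect:
  fixes x :: "'a::euclidean_space"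
  assumes [measurable]: "f \<in> borel_measurable borel"
  shows "(\<integral>\<^sup>+y. f (x - y) \<partial>lborel) = (\<integral>\<^sup>+y. f y \<partial>lborel)"
proof -
  have "(\<integral>\<^sup>+y. f y \<partial>lborel) = (\<integral>\<^sup>+y. f y \<partial>distr lborel borel (\<lambda>y. x - y))"
    by (simp add: lborel_distr_reflect)
  also have "\<dots> = (\<integral>\<^sup>+y. f (x - y) \<partial>lborel)"
    by (rule nn_integral_distr) auto
  finally show ?thesis by simp
qed

lemma integral_reflect:
  fixes x :: "'a::euclidean_space" and f :: "'a \<Rightarrow> 'b::{banach,second_countable_topology}"
  assumes [measurable]: "f \<in> borel_measurable borel"
  shows "(\<integral>y. f (x - y) \<partial>lborel) = (\<integral>y. f y \<partial>lborel)"
proof -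
  have "(\<integral>y. f y \<partial>lborel) = (\<integral>y. f y \<partial>distr lborel borel (\<lambda>y. x - y))"
    by (simp add: lborel_distr_reflect)
  also have "\<dots> = (\<integral>y. f (x - y) \<partial>lborel)"
    by (rule integral_distr) auto
  finally show ?thesis by simp
qed

lemma integrable_reflect_iff:
  fixes x :: "'a::euclidean_space" and f :: "'a \<Rightarrow> 'b::{banach,second_countable_topology}"
  assumes [measurable]: "f \<in> borel_measurable borel"
  shows "integrable lborel (\<lambda>y. f (x - y)) \<longleftrightarrow> integrable lborel f"
proof -
  have "integrable lborel f \<longleftrightarrow> integrable (distr lborel borel (\<lambda>y. x - y)) f"
    by (simp add: lborel_distr_reflect)
  also have "\<dots> \<longleftrightarrow> integrable lborel (\<lambda>y. f (x - y))"
    by (rule integrable_distr_eq) auto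
  finally show ?thesis by simp
qed

text \<open>The area of the unit sphere, as the derivative at \<open>r = 1\<close> of the volume
  \<open>unit_ball_vol n * r ^ n\<close>.\<close>

definition sphere_area :: "nat \<Rightarrow> real" where
  "sphere_area n = real n * unit_ball_vol (real n)"

lemma sphere_area_pos: "n > 0 \<Longrightarrow> sphere_area n > 0"
  by (simp add: sphere_area_def unit_ball_vol_def Gamma_real_pos)

lemma sphere_area_DIM_pos [simp]: "sphere_area DIM('a::euclidean_space) > 0"
  by (simp add: sphere_area_pos)

text \<open>The ball volume contains \<open>Gamma (n / 2 + 1)\<close>; the functional equation of
  Gamma brings it down to \<open>Gamma (n / 2)\<close>, and \<open>n\<close> cancels.\<close>

lemma log_const_eq_sphere_area:
  assumes "n > 0"
  shows "log_const n = 2 / sphere_area n"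
proof -
  have "Gamma (real n / 2 + 1) = real n / 2 * Gamma (real n / 2)"
    using assms by (intro Gamma_plus1) (auto simp: nonpos_Ints_def)
  moreover have "Gamma (real n / 2) > 0" using assms by (intro Gamma_real_pos) auto
  ultimately show ?thesis using assms
    by (simp add: log_const_def sphere_area_def unit_ball_vol_def powr_minus field_simps)
qed

lemma sphere_surface_measure_sphere:
  "sphere_surface_measure (sphere (0::'a::euclidean_space) 1) = sphere_area DIM('a)"
proof -
  \<comment> \<open>Since \<open>r > 0\<close>, the cone over the sphere misses the origin, which is
    a null set.\<close>
  have eq: "{r *\<^sub>R \<omega> | r \<omega>. 0 < r \<and> r < 1 \<and> \<omega> \<in> sphere (0::'a) 1} = ball 0 1 - {0}"
  proof (intro equalityI subsetI)
    fix x :: 'a assume "x \<in> ball 0 1 - {0}"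
    then show "x \<in> {r *\<^sub>R \<omega> | r \<omega>. 0 < r \<and> r < 1 \<and> \<omega> \<in> sphere (0::'a) 1}"
      by (auto intro!: exI[of _ "norm x"] exI[of _ "x /\<^sub>R norm x"])
  qed auto
  have "measure lborel (ball (0::'a) 1 - {0}) = measure lborel (ball (0::'a) 1)"
    by (subst measure_Diff_null_set) auto
  also have "\<dots> = unit_ball_vol (real DIM('a))"
    using content_ball[of 1 "0::'a"] by simp
  finally show ?thesis unfolding sphere_surface_measure_def eq sphere_area_def by simp
qed

text \<open>The image of Lebesgue measure under \<open>norm\<close> has the ball volume as its
  distribution function, and the density is the derivative of that function. Two measures that are
  finite and equal on the half-lines \<open>{..a}\<close>, a generator closed under intersection,
  coincide.\<close>

lemma nn_integral_radial:
  fixes f :: "real \<Rightarrow> ennreal"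
  assumes f [measurable]: "f \<in> borel_measurable borel"
  shows "(\<integral>\<^sup>+(x::'a::euclidean_space). f (norm x) \<partial>lborel) =
    (\<integral>\<^sup>+r. f r * (ennreal (sphere_area DIM('a) * r ^ (DIM('a) - 1)) * indicator {0<..} r) \<partial>lborel)"
proof -
  let ?N = "DIM('a)"
  define d where "d = (\<lambda>r::real. ennreal (sphere_area ?N * r ^ (?N - 1)) * indicator {0<..} r)"
  have [measurable]: "d \<in> borel_measurable borel" unfolding d_def by measurable
  have N: "?N > 0" by simp
  define M where "M = distr (lborel :: 'a measure) borel norm"
  have M: "emeasure M {..a} = ennreal (unit_ball_vol ?N * max 0 a ^ ?N)" for a
  proof -
    have "emeasure M {..a} = emeasure lborel (cball (0::'a) a)"
      unfolding M_def by (subst emeasure_distr) (auto intro!: arg_cong[where f="emeasure lborel"])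
    also have "\<dots> = ennreal (unit_ball_vol ?N * max 0 a ^ ?N)"
      by (cases "a \<ge> 0") (auto simp: emeasure_cball max_def)
    finally show ?thesis .
  qed
  have D: "emeasure (density lborel d) {..a} = ennreal (unit_ball_vol ?N * max 0 a ^ ?N)" for a
  proof (cases "a > 0")
    case True
    have "emeasure (density lborel d) {..a} = (\<integral>\<^sup>+r. d r * indicator {..a} r \<partial>lborel)"
      by (rule emeasure_density) auto
    also have "\<dots> = (\<integral>\<^sup>+r. ennreal (sphere_area ?N * r ^ (?N - 1)) * indicator {0..a} r \<partial>lborel)"
    \<comment> \<open>In dimension 1 the factor \<open>r ^ (N - 1)\<close> is 1 at
      \<open>r = 0\<close>, so the open and the closed half-line differ there; the point is
      discarded as a null set.\<close>
    proof (rule nn_integral_cong_AE)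
      show "AE r in lborel. d r * indicator {..a} r = ennreal (sphere_area ?N * r ^ (?N - 1)) * indicator {0..a} r"
        using AE_lborel_singleton[of "0::real"]
        by eventually_elim (auto simp: d_def split: split_indicator)
    qed
    also have "\<dots> = ennreal (unit_ball_vol ?N * a ^ ?N - unit_ball_vol ?N * 0 ^ ?N)"
    proof (rule nn_integral_FTC_Icc)
      show "((\<lambda>r. unit_ball_vol ?N * r ^ ?N) has_real_derivative sphere_area ?N * x ^ (?N - 1)) (at x)" for x
        by (auto intro!: derivative_eq_intros simp: sphere_area_def)
    qed (use True in \<open>auto simp: sphere_area_def\<close>)
    finally show ?thesis using True N by (simp add: power_0_left max_def)
  next
    case False
    have "emeasure (density lborel d) {..a} = (\<integral>\<^sup>+r. d r * indicator {..a} r \<partial>lborel)"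
      by (rule emeasure_density) auto
    also have "\<dots> = (\<integral>\<^sup>+(r::real). 0 \<partial>lborel)"
      using False by (intro nn_integral_cong) (auto simp: d_def split: split_indicator)
    finally show ?thesis using False N by (simp add: max_def power_0_left)
  qed
  have "M = density lborel d"
  proof (rule measure_eqI_generator_eq[where E="range atMost" and \<Omega>=UNIV and A="\<lambda>i. {..real i}"])
    show "Int_stable (range (atMost :: real \<Rightarrow> _))"
      by (auto simp: Int_stable_def)
    have "sets borel = sigma_sets UNIV (range (atMost :: real \<Rightarrow> _))"
      unfolding borel_eq_atMost by simp
    then show "sets M = sigma_sets UNIV (range atMost)"
      and "sets (density lborel d) = sigma_sets UNIV (range atMost)" by (auto simp: M_def)
    show "(\<Union>i. {..real i}) = UNIV" using real_arch_simple by blast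
  qed (auto simp: M D)
  then have "(\<integral>\<^sup>+r. f r \<partial>M) = (\<integral>\<^sup>+r. d r * f r \<partial>lborel)"
    by (simp add: nn_integral_density)
  then show ?thesis unfolding M_def by (simp add: nn_integral_distr d_def mult.commute)
qed

lemma nn_integral_powr_0_1:
  fixes a :: real
  assumes "(a::real) > 0"
  shows "(\<integral>\<^sup>+r. ennreal (r powr (a - 1)) * indicator {0<..<c} r \<partial>lborel) = ennreal (max 0 c powr a / a)"
proof -
  have "((\<lambda>r. r powr (a - 1)) has_integral (max 0 c powr (a - 1 + 1) / (a - 1 + 1))) {0..max 0 c}"
    by (rule has_integral_powr_from_0) (use assms in auto)
  then have "((\<lambda>r. indicator {0..max 0 c} r * r powr (a - 1)) has_integral max 0 c powr a / a) UNIV"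
    by (subst (asm) has_integral_restrict_UNIV[symmetric]) (auto simp: indicator_def elim!: has_integral_eq[rotated])
  then have "(\<integral>\<^sup>+r. ennreal (indicator {0..max 0 c} r * r powr (a - 1)) \<partial>lborel) = ennreal (max 0 c powr a / a)"
    by (intro nn_integral_has_integral_lborel) auto
  moreover have "(\<integral>\<^sup>+r. ennreal (indicator {0..max 0 c} r * r powr (a - 1)) \<partial>lborel)
    = (\<integral>\<^sup>+r. ennreal (r powr (a - 1)) * indicator {0<..<c} r \<partial>lborel)"
  proof (rule nn_integral_cong_AE)
    show "AE r in lborel. ennreal (indicator {0..max 0 c} r * r powr (a - 1)) = ennreal (r powr (a - 1)) * indicator {0<..<c} r"
      using AE_lborel_singleton[of "0::real"] AE_lborel_singleton[of "max 0 c"]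
      by eventually_elim (auto split: split_indicator)
  qed
  ultimately show ?thesis by simp
qed

lemma nn_integral_powr_inf:
  fixes a c :: real
  assumes "a > 0" "c > 0"
  shows "(\<integral>\<^sup>+r. ennreal (r powr (- a - 1)) * indicator {c..} r \<partial>lborel) = ennreal (c powr (- a) / a)"
proof -
  have "((\<lambda>r. r powr (- a - 1)) has_integral - (c powr (- a - 1 + 1)) / (- a - 1 + 1)) {c..}"
    by (rule has_integral_powr_to_inf) (use assms in auto)
  then have "((\<lambda>r. indicator {c..} r * r powr (- a - 1)) has_integral c powr (- a) / a) UNIV"
    by (subst (asm) has_integral_restrict_UNIV[symmetric]) (auto simp: indicator_def elim!: has_integral_eq[rotated])
  then have "(\<integral>\<^sup>+r. ennreal (indicator {c..} r * r powr (- a - 1)) \<partial>lborel) = ennreal (c powr (- a) / a)"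
    by (intro nn_integral_has_integral_lborel) auto
  moreover have "(\<integral>\<^sup>+r. ennreal (indicator {c..} r * r powr (- a - 1)) \<partial>lborel)
    = (\<integral>\<^sup>+r. ennreal (r powr (- a - 1)) * indicator {c..} r \<partial>lborel)"
    by (intro nn_integral_cong) (auto split: split_indicator)
  ultimately show ?thesis by simp
qed

text \<open>The radial density contributes \<open>r ^ (N - 1)\<close>, so \<open>a - N\<close>
  becomes the one-dimensional exponent \<open>a - 1\<close>, whatever the dimension.\<close>

lemma nn_integral_norm_powr_ball:
  assumes "(a::real) > 0"
  shows "(\<integral>\<^sup>+(z::'a::euclidean_space). ennreal (norm z powr (a - DIM('a))) * indicator (ball 0 1) z \<partial>lborel)
    = ennreal (sphere_area DIM('a) / a)"
proof -
  have "(\<integral>\<^sup>+(z::'a). ennreal (norm z powr (a - DIM('a))) * indicator (ball 0 1) z \<partial>lborel)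
     = (\<integral>\<^sup>+(z::'a). ennreal (norm z powr (a - DIM('a))) * indicator {..<1} (norm z) \<partial>lborel)"
    by (intro nn_integral_cong) (auto split: split_indicator)
  also have "\<dots> = (\<integral>\<^sup>+r. (ennreal (r powr (a - DIM('a))) * indicator {..<1} r) *
       (ennreal (sphere_area DIM('a) * r ^ (DIM('a) - 1)) * indicator {0<..} r) \<partial>lborel)"
    by (rule nn_integral_radial) auto
  also have "\<dots> = (\<integral>\<^sup>+r. ennreal (sphere_area DIM('a)) * (ennreal (r powr (a - 1)) * indicator {0<..<1} r) \<partial>lborel)"
  proof (rule nn_integral_cong)
    fix r :: real
    have "r powr (a - DIM('a)) * r ^ (DIM('a) - 1) = r powr (a - 1)" if "r > 0"
      using that by (simp add: powr_realpow[symmetric] powr_add[symmetric] of_nat_diff Suc_leI)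
    then show "(ennreal (r powr (a - DIM('a))) * indicator {..<1} r) *
       (ennreal (sphere_area DIM('a) * r ^ (DIM('a) - 1)) * indicator {0<..} r)
       = ennreal (sphere_area DIM('a)) * (ennreal (r powr (a - 1)) * indicator {0<..<1} r)"
      by (auto split: split_indicator simp: ennreal_mult[symmetric] sphere_area_pos less_imp_le mult_ac)
  qed
  also have "\<dots> = ennreal (sphere_area DIM('a) / a)"
    using assms by (subst nn_integral_cmult)
      (auto simp: nn_integral_powr_0_1 ennreal_mult[symmetric] less_imp_le)
  finally show ?thesis .
qed

lemma nn_integral_norm_powr_compl_ball:
  assumes "(a::real) > 0"
  shows "(\<integral>\<^sup>+(z::'a::euclidean_space). ennreal (norm z powr (- a - DIM('a))) * indicator (- ball 0 1) z \<partial>lborel)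
    = ennreal (sphere_area DIM('a) / a)"
proof -
  have "(\<integral>\<^sup>+(z::'a). ennreal (norm z powr (- a - DIM('a))) * indicator (- ball 0 1) z \<partial>lborel)
     = (\<integral>\<^sup>+(z::'a). ennreal (norm z powr (- a - DIM('a))) * indicator {1..} (norm z) \<partial>lborel)"
    by (intro nn_integral_cong) (auto split: split_indicator)
  also have "\<dots> = (\<integral>\<^sup>+r. (ennreal (r powr (- a - DIM('a))) * indicator {1..} r) *
       (ennreal (sphere_area DIM('a) * r ^ (DIM('a) - 1)) * indicator {0<..} r) \<partial>lborel)"
    by (rule nn_integral_radial) auto
  also have "\<dots> = (\<integral>\<^sup>+r. ennreal (sphere_area DIM('a)) * (ennreal (r powr (- a - 1)) * indicator {1..} r) \<partial>lborel)"
  proof (rule nn_integral_cong)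
    fix r :: real
    have "r powr (- a - DIM('a)) * r ^ (DIM('a) - 1) = r powr (- a - 1)" if "r > 0"
      using that by (simp add: powr_realpow[symmetric] powr_add[symmetric] of_nat_diff Suc_leI)
    then show "(ennreal (r powr (- a - DIM('a))) * indicator {1..} r) *
       (ennreal (sphere_area DIM('a) * r ^ (DIM('a) - 1)) * indicator {0<..} r)
       = ennreal (sphere_area DIM('a)) * (ennreal (r powr (- a - 1)) * indicator {1..} r)"
      by (auto split: split_indicator simp: ennreal_mult[symmetric] sphere_area_pos less_imp_le mult_ac)
  qed
  also have "\<dots> = ennreal (sphere_area DIM('a) / a)"
    using assms by (subst nn_integral_cmult)
      (auto simp: nn_integral_powr_inf ennreal_mult[symmetric] less_imp_le)
  finally show ?thesis .
qed

section \<open>Fourier integrals of Gaussians\<close>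

lemma norm_fourier_kernel [simp]: "norm (exp (- \<i> * complex_of_real t)) = 1"
  using norm_exp_i_times[of "- t"] by simp

lemma integrable_fourier_kernel_mult:
  fixes f :: "'a::euclidean_space \<Rightarrow> complex"
  assumes f: "integrable lborel f" and [measurable]: "h \<in> borel_measurable lborel"
  shows "integrable lborel (\<lambda>x. exp (- \<i> * complex_of_real (h x)) * f x)"
  by (rule Bochner_Integration.integrable_bound[OF f]) (use f in \<open>auto simp: norm_mult\<close>)

text \<open>Justifies Fubini for \<open>f x * g y\<close> against the Fourier kernel, which has
  modulus 1.\<close>

lemma integrable_product_bounded:
  fixes f :: "'a::euclidean_space \<Rightarrow> complex" and g :: "'b::euclidean_space \<Rightarrow> complex"
  assumes f: "integrable lborel f" and g: "integrable lborel g"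
    and k [measurable]: "k \<in> borel_measurable (lborel \<Otimes>\<^sub>M lborel)" and b: "\<And>z. norm (k z) \<le> 1"
  shows "integrable (lborel \<Otimes>\<^sub>M lborel) (\<lambda>(x, y). k (x, y) * (f x * g y))"
proof (rule lborel_pair.Fubini_integrable)
  have [measurable]: "f \<in> borel_measurable lborel" "g \<in> borel_measurable lborel"
    using f g by (auto dest: borel_measurable_integrable)
  show "(\<lambda>(x, y). k (x, y) * (f x * g y)) \<in> borel_measurable (lborel \<Otimes>\<^sub>M lborel)"
    by measurable
  have I: "integrable lborel (\<lambda>y. k (x, y) * (f x * g y))" for x
    by (rule Bochner_Integration.integrable_bound[OF integrable_mult_right[OF g, of "f x"]])
       (auto simp: norm_mult intro!: mult_left_le_one_le mult_nonneg_nonneg b)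
  show "AE x in lborel. integrable lborel (\<lambda>y. case (x, y) of (x, y) \<Rightarrow> k (x, y) * (f x * g y))"
    using I by simp
  have "integrable lborel (\<lambda>x. norm (f x) * (\<integral>y. norm (g y) \<partial>lborel))"
    using f by simp
  then show "integrable lborel (\<lambda>x. \<integral>y. norm (case (x, y) of (x, y) \<Rightarrow> k (x, y) * (f x * g y)) \<partial>lborel)"
  proof (rule Bochner_Integration.integrable_bound)
    have "norm (\<integral>y. norm (case (x, y) of (x, y) \<Rightarrow> k (x, y) * (f x * g y)) \<partial>lborel)
      \<le> norm (norm (f x) * (\<integral>y. norm (g y) \<partial>lborel))" for x
    proof -
      have "(\<integral>y. norm (k (x, y) * (f x * g y)) \<partial>lborel) \<le> (\<integral>y. norm (f x) * norm (g y) \<partial>lborel)"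
        using integrable_norm[OF I] f g
        by (intro integral_mono) (auto simp: norm_mult intro!: mult_left_le_one_le mult_nonneg_nonneg b)
      then show ?thesis by (simp add: abs_mult)
    qed
    then show "AE x in lborel. norm (\<integral>y. norm (case (x, y) of (x, y) \<Rightarrow> k (x, y) * (f x * g y)) \<partial>lborel)
      \<le> norm (norm (f x) * (\<integral>y. norm (g y) \<partial>lborel))" by simp
  qed measurable
qed

lemma borel_measurable_fourier_integral [measurable]:
  fixes f :: "'a::euclidean_space \<Rightarrow> complex"
  assumes [measurable]: "f \<in> borel_measurable lborel"
  shows "fourier_integral f \<in> borel_measurable lborel"
  unfolding fourier_integral_def[abs_def] by measurable

lemma norm_fourier_integral_le:
  fixes f :: "'a::euclidean_space \<Rightarrow> complex"
  assumes "integrable lborel f"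
  shows "norm (fourier_integral f \<xi>) \<le> (\<integral>x. norm (f x) \<partial>lborel)"
proof -
  have "norm (fourier_integral f \<xi>) \<le> (\<integral>x. norm (exp (- \<i> * of_real (x \<bullet> \<xi>)) * f x) \<partial>lborel)"
    unfolding fourier_integral_def by (rule integral_norm_bound)
  then show ?thesis by (simp add: norm_mult)
qed

text \<open>The kernel is symmetric in its two variables, so exchanging the integrals moves the
  transform from one factor to the other.\<close>

lemma fourier_integral_multiplication:
  fixes f g :: "'a::euclidean_space \<Rightarrow> complex"
  assumes f: "integrable lborel f" and g: "integrable lborel g"
  shows "(\<integral>x. fourier_integral f x * g x \<partial>lborel) = (\<integral>x. f x * fourier_integral g x \<partial>lborel)"
proof -
  let ?k = "\<lambda>(x, y). exp (- \<i> * complex_of_real (x \<bullet> y))"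
  have "integrable (lborel \<Otimes>\<^sub>M lborel) (\<lambda>(x, y). ?k (x, y) * (f x * g y))"
    by (rule integrable_product_bounded[OF f g]) (auto simp: borel_prod)
  then have "(\<integral>y. (\<integral>x. ?k (x, y) * (f x * g y) \<partial>lborel) \<partial>lborel) = (\<integral>x. (\<integral>y. ?k (x, y) * (f x * g y) \<partial>lborel) \<partial>lborel)"
    by (rule lborel_pair.Fubini_integral)
  moreover have "(\<integral>x. ?k (x, y) * (f x * g y) \<partial>lborel) = fourier_integral f y * g y" for y
    unfolding fourier_integral_def by (subst integral_mult_left_zero[symmetric]) (simp add: mult.assoc)
  moreover have "(\<integral>y. ?k (x, y) * (f x * g y) \<partial>lborel) = f x * fourier_integral g x" for x
    unfolding fourier_integral_def by (subst integral_mult_right_zero[symmetric]) (simp add: mult_ac inner_commute)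
  ultimately show ?thesis by simp
qed

text \<open>This is the characteristic function of the standard normal distribution, rescaled. With
  \<open>c = sqrt (2 * t)\<close> the density at \<open>c * x\<close> is a multiple of
  \<open>exp (- t * x^2)\<close>, and the frequency \<open>y / c\<close> gives the exponent
  \<open>y^2 / (4 * t)\<close>.\<close>

lemma has_bochner_integral_fourier_gaussian_real:
  fixes y t :: real
  assumes t: "t > 0"
  shows "has_bochner_integral lborel (\<lambda>x. exp (- \<i> * of_real (x * y)) * complex_of_real (exp (- t * x\<^sup>2)))
    (complex_of_real (sqrt (pi / t) * exp (- y\<^sup>2 / (4 * t))))"
proof -
  define c where "c = sqrt (2 * t)"
  have c: "c > 0" "c\<^sup>2 = 2 * t" using t by (auto simp: c_def)
  let ?f = "\<lambda>x. std_normal_density x *\<^sub>R iexp (- (y / c) * x)"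
  have "integrable lborel ?f"
    by (rule Bochner_Integration.integrable_bound[OF integrable_normal_density[where \<mu>=0 and \<sigma>=1, OF zero_less_one]]) (auto)
  moreover have "(\<integral>x. ?f x \<partial>lborel) = char std_normal_distribution (- (y / c))"
    unfolding char_def by (subst integral_density) auto
  then have "(\<integral>x. ?f x \<partial>lborel) = complex_of_real (exp (- y\<^sup>2 / (4 * t)))"
    by (simp add: char_std_normal_distribution power_divide c)
  ultimately have "has_bochner_integral lborel ?f (complex_of_real (exp (- y\<^sup>2 / (4 * t))))"
    by (simp add: has_bochner_integral_iff)
  then have "has_bochner_integral lborel (\<lambda>x. ?f (0 + c * x)) (complex_of_real (exp (- y\<^sup>2 / (4 * t))) /\<^sub>R \<bar>c\<bar>)"
    using c by (subst (asm) lborel_has_bochner_integral_real_affine_iff[of c _ _ 0]) auto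
  then have *: "has_bochner_integral lborel (\<lambda>x. complex_of_real (sqrt (2 * pi)) * ?f (0 + c * x))
     (complex_of_real (sqrt (2 * pi)) * (complex_of_real (exp (- y\<^sup>2 / (4 * t))) /\<^sub>R \<bar>c\<bar>))"
    by (rule has_bochner_integral_mult_right)
  have 1: "complex_of_real (sqrt (2 * pi)) * ?f (0 + c * x)
    = exp (- \<i> * of_real (x * y)) * complex_of_real (exp (- t * x\<^sup>2))" for x
    using c by (simp add: std_normal_density_def scaleR_conv_of_real power_mult_distrib mult_ac)
  have 2: "sqrt (2 * pi) / c = sqrt (pi / t)"
    unfolding c_def real_sqrt_divide[symmetric] by simp
  have 3: "complex_of_real (sqrt (2 * pi)) * (complex_of_real (exp (- y\<^sup>2 / (4 * t))) /\<^sub>R \<bar>c\<bar>)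
    = complex_of_real (sqrt (2 * pi) / c * exp (- y\<^sup>2 / (4 * t)))"
    using c(1) by (simp only: scaleR_conv_of_real divide_inverse abs_of_pos of_real_mult of_real_inverse mult_ac)
  show ?thesis using * by (simp only: 1 2 3)
qed

text \<open>Lebesgue measure on the space is the image of the product measure over
  \<open>Basis\<close>, so the integral of a product of coordinate functions factorises.\<close>

lemma has_bochner_integral_lborel_prod:
  fixes f :: "'a::euclidean_space \<Rightarrow> real \<Rightarrow> complex"
  assumes f: "\<And>b. b \<in> Basis \<Longrightarrow> has_bochner_integral lborel (f b) (c b)"
  shows "has_bochner_integral lborel (\<lambda>x. \<Prod>b\<in>Basis. f b (x \<bullet> b)) (\<Prod>b\<in>Basis. c b)"
proof -
  interpret product_sigma_finite "\<lambda>_::'a. lborel :: real measure"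
    by standard
  have int: "\<And>b. b \<in> Basis \<Longrightarrow> integrable lborel (f b)"
    using f by (simp add: has_bochner_integral_iff)
  then have [measurable]: "\<And>b. b \<in> Basis \<Longrightarrow> f b \<in> borel_measurable lborel"
    by (auto dest: borel_measurable_integrable)
  have m: "(\<lambda>x::'a. \<Prod>b\<in>Basis. f b (x \<bullet> b)) \<in> borel_measurable borel" by measurable
  have eq: "(\<Prod>b\<in>Basis. f b ((\<Sum>b'\<in>Basis. g b' *\<^sub>R b') \<bullet> b)) = (\<Prod>b\<in>Basis. f b (g b))" for g :: "'a \<Rightarrow> real"
    by (intro prod.cong) auto
  have "integrable (Pi\<^sub>M Basis (\<lambda>_. lborel)) (\<lambda>g. \<Prod>b\<in>Basis. f b (g b))"
    by (rule product_integrable_prod) (use int in auto)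
  moreover have "(\<integral>g. (\<Prod>b\<in>Basis. f b (g b)) \<partial>Pi\<^sub>M Basis (\<lambda>_. lborel)) = (\<Prod>b\<in>Basis. integral\<^sup>L lborel (f b))"
    by (rule product_integral_prod) (use int in auto)
  moreover have "(\<Prod>b\<in>Basis. integral\<^sup>L lborel (f b)) = (\<Prod>b\<in>Basis. c b)"
    using f by (intro prod.cong) (auto simp: has_bochner_integral_iff)
  ultimately show ?thesis
    using m by (subst lborel_eq) (simp add: has_bochner_integral_iff integrable_distr_eq integral_distr eq)
qed

lemma norm_power2_sum_Basis: "(norm x)\<^sup>2 = (\<Sum>b\<in>Basis. (x \<bullet> b)\<^sup>2)" for x :: "'a::euclidean_space"
  unfolding power2_norm_eq_inner by (subst euclidean_inner) (simp add: power2_eq_square)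

lemma has_bochner_integral_fourier_gaussian:
  fixes \<xi> :: "'a::euclidean_space"
  assumes t: "t > 0"
  shows "has_bochner_integral lborel (\<lambda>x. exp (- \<i> * of_real (x \<bullet> \<xi>)) * complex_of_real (exp (- t * (norm x)\<^sup>2)))
    (complex_of_real ((pi / t) powr (DIM('a) / 2) * exp (- (norm \<xi>)\<^sup>2 / (4 * t))))"
proof -
  have "has_bochner_integral lborel (\<lambda>x. \<Prod>b\<in>Basis. (\<lambda>b u. exp (- \<i> * of_real (u * (\<xi> \<bullet> b))) * complex_of_real (exp (- t * u\<^sup>2))) b (x \<bullet> b))
    (\<Prod>b\<in>Basis. complex_of_real (sqrt (pi / t) * exp (- (\<xi> \<bullet> b)\<^sup>2 / (4 * t))))"
    by (rule has_bochner_integral_lborel_prod, rule has_bochner_integral_fourier_gaussian_real) (rule t)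
  moreover have "(\<Prod>b\<in>Basis. exp (- \<i> * of_real ((x \<bullet> b) * (\<xi> \<bullet> b))) * complex_of_real (exp (- t * (x \<bullet> b)\<^sup>2)))
    = exp (- \<i> * of_real (x \<bullet> \<xi>)) * complex_of_real (exp (- t * (norm x)\<^sup>2))" for x
    by (simp add: prod.distrib exp_sum[symmetric] euclidean_inner[of x \<xi>] norm_power2_sum_Basis sum_distrib_left sum_negf
        flip: of_real_prod)
  moreover have "(\<Prod>b\<in>(Basis::'a set). complex_of_real (sqrt (pi / t) * exp (- (\<xi> \<bullet> b)\<^sup>2 / (4 * t))))
     = complex_of_real (sqrt (pi / t) ^ DIM('a) * exp (- (norm \<xi>)\<^sup>2 / (4 * t)))"
    by (simp add: prod.distrib exp_sum[symmetric] norm_power2_sum_Basis sum_divide_distrib sum_negf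
        flip: of_real_prod of_real_mult)
  moreover have "sqrt (pi / t) ^ DIM('a) = (pi / t) powr (DIM('a) / 2)"
    using t by (simp add: powr_half_sqrt[symmetric] powr_realpow[symmetric] powr_powr)
  ultimately show ?thesis by simp
qed

section \<open>Plancherel's inequality\<close>

lemma fourier_integral_gaussian:
  fixes \<xi> :: "'a::euclidean_space"
  assumes "t > 0"
  shows "fourier_integral (\<lambda>x. complex_of_real (exp (- t * (norm x)\<^sup>2))) \<xi>
    = complex_of_real ((pi / t) powr (DIM('a) / 2) * exp (- (norm \<xi>)\<^sup>2 / (4 * t)))"
  using has_bochner_integral_fourier_gaussian[OF assms, of \<xi>]
  unfolding fourier_integral_def by (simp add: has_bochner_integral_iff)

lemma has_bochner_integral_gaussian:
  assumes "t > 0"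
  shows "has_bochner_integral lborel (\<lambda>x::'a::euclidean_space. exp (- t * (norm x)\<^sup>2)) ((pi / t) powr (DIM('a) / 2))"
  using has_bochner_integral_Re[OF has_bochner_integral_fourier_gaussian[OF assms, of "0::'a"]]
  by simp

lemma nn_integral_gaussian:
  assumes "t > 0"
  shows "(\<integral>\<^sup>+(x::'a::euclidean_space). ennreal (exp (- t * (norm x)\<^sup>2)) \<partial>lborel) = ennreal ((pi / t) powr (DIM('a) / 2))"
  using has_bochner_integral_gaussian[OF assms, where 'a='a]
  by (subst nn_integral_eq_integral) (auto simp: has_bochner_integral_iff)

lemma borel_measurable_cnj [measurable]: "cnj \<in> borel_measurable borel"
  by (intro borel_measurable_continuous_onI continuous_intros)

text \<open>The transform of \<open>h\<close> is the conjugate of that of \<open>f\<close>, so the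
  multiplication formula turns the left side into the double integral of
  \<open>h y * f x * \<gamma> (x + y)\<close>, where \<gamma> is the transform of the Gaussian. The
  rest is Schur's test: \<open>2 a b \<le> a^2 + b^2\<close> separates \<open>h\<close> from
  \<open>f\<close>, and \<gamma> has the same mass along either variable. The damping ensures
  finiteness, since the transform of an integrable function is only known to be bounded.\<close>

lemma nn_integral_fourier_integral_gaussian_le:
  fixes f :: "'a::euclidean_space \<Rightarrow> complex"
  assumes f: "integrable lborel f" and t: "t > 0"
  shows "(\<integral>\<^sup>+\<xi>. ennreal ((norm (fourier_integral f \<xi>))\<^sup>2 * exp (- t * (norm \<xi>)\<^sup>2)) \<partial>lborel)
    \<le> ennreal ((2 * pi) ^ DIM('a)) * (\<integral>\<^sup>+x. ennreal ((norm (f x))\<^sup>2) \<partial>lborel)"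
proof -
  let ?N = "DIM('a)"
  have [measurable]: "f \<in> borel_measurable borel" using f by (auto dest: borel_measurable_integrable)
  define g where "g = (\<lambda>x::'a. complex_of_real (exp (- t * (norm x)\<^sup>2)))"
  define \<gamma> where "\<gamma> = (\<lambda>x::'a. (pi / t) powr (?N / 2) * exp (- (norm x)\<^sup>2 / (4 * t)))"
  define h where "h = (\<lambda>y. cnj (f (0 - y)))"
  have [measurable]: "h \<in> borel_measurable borel" unfolding h_def by measurable
  have [measurable]: "\<gamma> \<in> borel_measurable borel" unfolding \<gamma>_def by simp
  have [measurable]: "g \<in> borel_measurable borel" unfolding g_def by simp
  have \<gamma>0: "\<gamma> x \<ge> 0" for x by (simp add: \<gamma>_def)
  have "integrable lborel (\<lambda>y. f (0 - y))" by (subst integrable_reflect_iff) (auto intro: f)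
  then have h: "integrable lborel h" unfolding h_def by (rule integrable_cnj)
  have hhat: "fourier_integral h \<xi> = cnj (fourier_integral f \<xi>)" for \<xi>
  proof -
    have "fourier_integral h \<xi> = (\<integral>y. (\<lambda>x. exp (- \<i> * of_real (- (x \<bullet> \<xi>))) * cnj (f x)) (0 - y) \<partial>lborel)"
      unfolding fourier_integral_def h_def by simp
    also have "\<dots> = (\<integral>x. exp (- \<i> * of_real (- (x \<bullet> \<xi>))) * cnj (f x) \<partial>lborel)"
      by (rule integral_reflect) measurable
    also have "\<dots> = cnj (fourier_integral f \<xi>)"
      unfolding fourier_integral_def Bochner_Integration.integral_cnj[symmetric] complex_cnj_mult exp_cnj
      by simp
    finally show ?thesis .
  qed
  have g: "integrable lborel g"
    unfolding g_def using has_bochner_integral_gaussian[OF t, where 'a='a]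
    by (auto simp: has_bochner_integral_iff)
  have ghat: "fourier_integral g x = of_real (\<gamma> x)" for x
    unfolding g_def \<gamma>_def by (rule fourier_integral_gaussian[OF t])
  have fg: "integrable lborel (\<lambda>\<xi>. fourier_integral f \<xi> * g \<xi>)"
    by (rule Bochner_Integration.integrable_bound[OF integrable_mult_right[OF g, of "complex_of_real (\<integral>x. norm (f x) \<partial>lborel)"]])
       (auto simp: norm_mult intro!: mult_right_mono norm_fourier_integral_le[OF f])
  have fghat: "fourier_integral (\<lambda>\<xi>. fourier_integral f \<xi> * g \<xi>) y = (\<integral>x. f x * of_real (\<gamma> (x + y)) \<partial>lborel)" for y
  proof -
    \<comment> \<open>Modulating the Gaussian by \<open>y\<close> translates its transform by
      \<open>y\<close>.\<close>
    have E: "fourier_integral (\<lambda>\<xi>. exp (- \<i> * of_real (\<xi> \<bullet> y)) * g \<xi>) x = of_real (\<gamma> (x + y))" for x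
      unfolding ghat[symmetric] fourier_integral_def
      by (intro Bochner_Integration.integral_cong)
         (simp_all add: inner_add_right inner_commute exp_add[symmetric] algebra_simps flip: mult.assoc)
    have "fourier_integral (\<lambda>\<xi>. fourier_integral f \<xi> * g \<xi>) y
       = (\<integral>\<xi>. fourier_integral f \<xi> * (exp (- \<i> * of_real (\<xi> \<bullet> y)) * g \<xi>) \<partial>lborel)"
      unfolding fourier_integral_def[of "\<lambda>\<xi>. fourier_integral f \<xi> * g \<xi>"] by (simp add: mult_ac)
    also have "\<dots> = (\<integral>x. f x * fourier_integral (\<lambda>\<xi>. exp (- \<i> * of_real (\<xi> \<bullet> y)) * g \<xi>) x \<partial>lborel)"
      by (intro fourier_integral_multiplication f integrable_fourier_kernel_mult g) auto
    finally show ?thesis by (simp only: E)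
  qed
  have *: "(\<integral>\<xi>. of_real ((norm (fourier_integral f \<xi>))\<^sup>2 * exp (- t * (norm \<xi>)\<^sup>2)) \<partial>lborel)
    = (\<integral>y. h y * (\<integral>x. f x * of_real (\<gamma> (x + y)) \<partial>lborel) \<partial>lborel)"
    (is "(\<integral>\<xi>. complex_of_real (?F \<xi>) \<partial>lborel) = ?R")
  proof -
    have "(\<integral>\<xi>. complex_of_real (?F \<xi>) \<partial>lborel) = (\<integral>\<xi>. fourier_integral h \<xi> * (fourier_integral f \<xi> * g \<xi>) \<partial>lborel)"
      unfolding hhat by (intro Bochner_Integration.integral_cong)
        (simp_all add: g_def complex_norm_square mult_ac del: of_real_power)
    also have "\<dots> = (\<integral>y. h y * fourier_integral (\<lambda>\<xi>. fourier_integral f \<xi> * g \<xi>) y \<partial>lborel)"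
      by (rule fourier_integral_multiplication[OF h fg])
    finally show ?thesis by (simp only: fghat)
  qed
  have intF: "integrable lborel ?F"
  proof (rule Bochner_Integration.integrable_bound)
    show "integrable lborel (\<lambda>\<xi>. (\<integral>x. norm (f x) \<partial>lborel) * norm (fourier_integral f \<xi> * g \<xi>))"
      using fg by simp
    show "AE \<xi> in lborel. norm (?F \<xi>) \<le> norm ((\<integral>x. norm (f x) \<partial>lborel) * norm (fourier_integral f \<xi> * g \<xi>))"
      using norm_fourier_integral_le[OF f]
      by (auto simp: norm_mult g_def power2_eq_square abs_mult mult.assoc intro!: mult_right_mono)
  qed measurable
  \<comment> \<open>The origin of \<open>(2 pi)^N\<close>: in
    \<open>(pi / t)^(N/2) * (4 pi t)^(N/2)\<close> the parameter \<open>t\<close> cancels, so the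
    final bound is uniform in the damping.\<close>
  have nn\<gamma>: "(\<integral>\<^sup>+x. ennreal (\<gamma> x) \<partial>lborel) = ennreal ((2 * pi) ^ ?N)"
  proof -
    have "(\<integral>\<^sup>+x. ennreal (\<gamma> x) \<partial>lborel) = (\<integral>\<^sup>+(x::'a). ennreal ((pi / t) powr (?N / 2)) * ennreal (exp (- (1 / (4 * t)) * (norm x)\<^sup>2)) \<partial>lborel)"
      unfolding \<gamma>_def by (simp add: ennreal_mult)
    also have "\<dots> = ennreal ((pi / t) powr (?N / 2)) * ennreal ((pi / (1 / (4 * t))) powr (?N / 2))"
      using nn_integral_gaussian[of "1 / (4 * t)", where 'a='a] t by (subst nn_integral_cmult) auto
    also have "\<dots> = ennreal (((2 * pi) powr 2) powr (?N / 2))"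
      using t by (simp add: ennreal_mult[symmetric] powr_mult[symmetric] power2_eq_square mult_ac)
    also have "((2 * pi) powr 2) powr (?N / 2) = (2 * pi) ^ ?N"
      by (subst powr_powr) (simp add: powr_realpow)
    finally show ?thesis .
  qed
  have sh1: "(\<integral>\<^sup>+x. ennreal (\<gamma> (x + y)) \<partial>lborel) = ennreal ((2 * pi) ^ ?N)" for y
  proof -
    have "(\<integral>\<^sup>+x. ennreal (\<gamma> (x + y)) \<partial>lborel) = (\<integral>\<^sup>+x. ennreal (\<gamma> (- y - x)) \<partial>lborel)"
      by (simp add: \<gamma>_def norm_minus_commute[of "- _" _] add.commute)
    also have "\<dots> = (\<integral>\<^sup>+x. ennreal (\<gamma> x) \<partial>lborel)"
      by (rule nn_integral_reflect) measurable
    finally show ?thesis by (simp add: nn\<gamma>)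
  qed
  have sh2: "(\<integral>\<^sup>+y. ennreal (\<gamma> (x + y)) \<partial>lborel) = ennreal ((2 * pi) ^ ?N)" for x
    using sh1[of x] by (simp only: add.commute)
  define A where "A = (\<integral>\<^sup>+x. ennreal ((norm (f x))\<^sup>2) \<partial>lborel)"
  have hA: "(\<integral>\<^sup>+y. ennreal ((norm (h y))\<^sup>2) \<partial>lborel) = A"
    unfolding h_def A_def complex_mod_cnj by (rule nn_integral_reflect) measurable
  have "ennreal (\<integral>\<xi>. ?F \<xi> \<partial>lborel) = ennreal (norm (\<integral>\<xi>. complex_of_real (?F \<xi>) \<partial>lborel))"
    by (simp add: integral_nonneg_AE del: of_real_mult)
  also have "\<dots> = ennreal (norm (\<integral>y. h y * (\<integral>x. f x * of_real (\<gamma> (x + y)) \<partial>lborel) \<partial>lborel))"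
    by (simp only: *)
  also have "\<dots> \<le> (\<integral>\<^sup>+y. ennreal (norm (h y * (\<integral>x. f x * of_real (\<gamma> (x + y)) \<partial>lborel))) \<partial>lborel)"
  proof (rule integral_norm_bound_ennreal)
    show "integrable lborel (\<lambda>y. h y * (\<integral>x. f x * of_real (\<gamma> (x + y)) \<partial>lborel))"
      unfolding fghat[symmetric]
      by (rule Bochner_Integration.integrable_bound[OF integrable_mult_right[OF h, of "complex_of_real (\<integral>x. norm (fourier_integral f x * g x) \<partial>lborel)"]])
         (use fg norm_fourier_integral_le[OF fg] in \<open>auto simp: norm_mult mult.commute intro!: mult_left_mono\<close>)
  qed
  also have "\<dots> \<le> (\<integral>\<^sup>+y. (\<integral>\<^sup>+x. ennreal ((norm (h y))\<^sup>2 / 2) * ennreal (\<gamma> (x + y)) + ennreal ((norm (f x))\<^sup>2 / 2) * ennreal (\<gamma> (x + y)) \<partial>lborel) \<partial>lborel)"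
  proof (rule nn_integral_mono)
    fix y :: 'a
    have fy: "integrable lborel (\<lambda>x. f x * of_real (\<gamma> (x + y)))"
      by (rule Bochner_Integration.integrable_bound[OF integrable_mult_right[OF f, of "complex_of_real ((pi / t) powr (?N / 2))"]])
         (use t in \<open>auto simp: norm_mult \<gamma>_def mult.commute[of "norm (f _)"] intro!: mult_right_mono mult_left_le_one_le\<close>)
    have "ennreal (norm (h y * (\<integral>x. f x * of_real (\<gamma> (x + y)) \<partial>lborel)))
       \<le> ennreal (norm (h y)) * (\<integral>\<^sup>+x. ennreal (norm (f x * of_real (\<gamma> (x + y)))) \<partial>lborel)"
      unfolding norm_mult[of "h y"] by (subst ennreal_mult) (auto intro!: mult_left_mono integral_norm_bound_ennreal fy)
    also have "\<dots> = (\<integral>\<^sup>+x. ennreal (norm (h y)) * ennreal (norm (f x * of_real (\<gamma> (x + y)))) \<partial>lborel)"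
      by (subst nn_integral_cmult) auto
    also have "\<dots> \<le> (\<integral>\<^sup>+x. ennreal ((norm (h y))\<^sup>2 / 2) * ennreal (\<gamma> (x + y)) + ennreal ((norm (f x))\<^sup>2 / 2) * ennreal (\<gamma> (x + y)) \<partial>lborel)"
    proof (rule nn_integral_mono)
      fix x :: 'a
      have "norm (h y) * (norm (f x) * \<gamma> (x + y)) \<le> ((norm (h y))\<^sup>2 / 2 + (norm (f x))\<^sup>2 / 2) * \<gamma> (x + y)"
        using sum_squares_bound[of "norm (h y)" "norm (f x)"] \<gamma>0[of "x + y"]
        by (subst mult.assoc[symmetric]) (intro mult_right_mono, auto)
      then show "ennreal (norm (h y)) * ennreal (norm (f x * of_real (\<gamma> (x + y))))
        \<le> ennreal ((norm (h y))\<^sup>2 / 2) * ennreal (\<gamma> (x + y)) + ennreal ((norm (f x))\<^sup>2 / 2) * ennreal (\<gamma> (x + y))"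
        using \<gamma>0[of "x + y"] by (simp add: norm_mult distrib_right flip: ennreal_mult ennreal_plus)
    qed
    finally show "ennreal (norm (h y * (\<integral>x. f x * of_real (\<gamma> (x + y)) \<partial>lborel))) \<le> \<dots>" .
  qed
  also have "\<dots> = (\<integral>\<^sup>+y. (\<integral>\<^sup>+x. ennreal ((norm (h y))\<^sup>2 / 2) * ennreal (\<gamma> (x + y)) \<partial>lborel) \<partial>lborel)
      + (\<integral>\<^sup>+y. (\<integral>\<^sup>+x. ennreal ((norm (f x))\<^sup>2 / 2) * ennreal (\<gamma> (x + y)) \<partial>lborel) \<partial>lborel)"
    by (simp add: nn_integral_add)
  also have "(\<integral>\<^sup>+y. (\<integral>\<^sup>+x. ennreal ((norm (f x))\<^sup>2 / 2) * ennreal (\<gamma> (x + y)) \<partial>lborel) \<partial>lborel)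
     = (\<integral>\<^sup>+x. (\<integral>\<^sup>+y. ennreal ((norm (f x))\<^sup>2 / 2) * ennreal (\<gamma> (x + y)) \<partial>lborel) \<partial>lborel)"
    by (rule lborel_pair.Fubini') (simp add: borel_prod)
  also have "(\<integral>\<^sup>+y. (\<integral>\<^sup>+x. ennreal ((norm (h y))\<^sup>2 / 2) * ennreal (\<gamma> (x + y)) \<partial>lborel) \<partial>lborel)
    = (\<integral>\<^sup>+y. ennreal ((norm (h y))\<^sup>2) * ennreal ((2 * pi) ^ ?N / 2) \<partial>lborel)"
    by (subst nn_integral_cmult) (auto simp: sh1 simp flip: ennreal_mult)
  also have "(\<integral>\<^sup>+x. (\<integral>\<^sup>+y. ennreal ((norm (f x))\<^sup>2 / 2) * ennreal (\<gamma> (x + y)) \<partial>lborel) \<partial>lborel)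
    = (\<integral>\<^sup>+x. ennreal ((norm (f x))\<^sup>2) * ennreal ((2 * pi) ^ ?N / 2) \<partial>lborel)"
    by (subst nn_integral_cmult) (auto simp: sh2 simp flip: ennreal_mult)
  also have "(\<integral>\<^sup>+y. ennreal ((norm (h y))\<^sup>2) * ennreal ((2 * pi) ^ ?N / 2) \<partial>lborel)
      + (\<integral>\<^sup>+x. ennreal ((norm (f x))\<^sup>2) * ennreal ((2 * pi) ^ ?N / 2) \<partial>lborel)
      = A * (ennreal ((2 * pi) ^ ?N / 2) + ennreal ((2 * pi) ^ ?N / 2))"
    by (subst nn_integral_multc, simp, subst nn_integral_multc, simp) (simp add: hA A_def distrib_left)
  also have "ennreal ((2 * pi) ^ ?N / 2) + ennreal ((2 * pi) ^ ?N / 2) = ennreal ((2 * pi) ^ ?N)"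
    by (subst ennreal_plus[symmetric]) auto
  finally have "ennreal (\<integral>\<xi>. ?F \<xi> \<partial>lborel) \<le> ennreal ((2 * pi) ^ ?N) * A"
    by (simp add: mult.commute)
  moreover have "(\<integral>\<^sup>+\<xi>. ennreal (?F \<xi>) \<partial>lborel) = ennreal (\<integral>\<xi>. ?F \<xi> \<partial>lborel)"
    using intF by (rule nn_integral_eq_integral) simp
  ultimately show ?thesis by (simp add: A_def)
qed

text \<open>The damped bound does not depend on \<open>t\<close>, so Fatou's lemma along
  \<open>t = 1 / (n + 1)\<close> removes the damping. For \<open>f\<close> outside
  \<open>L^2\<close> the right side is infinite.\<close>

lemma nn_integral_fourier_integral_le:
  fixes f :: "'a::euclidean_space \<Rightarrow> complex"
  assumes f: "integrable lborel f"
  shows "(\<integral>\<^sup>+\<xi>. ennreal ((norm (fourier_integral f \<xi>))\<^sup>2) \<partial>lborel)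
    \<le> ennreal ((2 * pi) ^ DIM('a)) * (\<integral>\<^sup>+x. ennreal ((norm (f x))\<^sup>2) \<partial>lborel)" (is "_ \<le> ?R")
proof -
  have [measurable]: "f \<in> borel_measurable lborel" using f by (auto dest: borel_measurable_integrable)
  let ?F = "\<lambda>n \<xi>. ennreal ((norm (fourier_integral f \<xi>))\<^sup>2 * exp (- (1 / Suc n) * (norm \<xi>)\<^sup>2))"
  have lim: "(\<lambda>n. ?F n \<xi>) \<longlonglongrightarrow> ennreal ((norm (fourier_integral f \<xi>))\<^sup>2)" for \<xi>
  proof -
    have "(\<lambda>n. (norm (fourier_integral f \<xi>))\<^sup>2 * exp (- (1 / Suc n) * (norm \<xi>)\<^sup>2))
      \<longlonglongrightarrow> (norm (fourier_integral f \<xi>))\<^sup>2 * exp (- 0 * (norm \<xi>)\<^sup>2)"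
      by (intro tendsto_intros LIMSEQ_Suc[OF lim_1_over_n])
    then show ?thesis by (intro tendsto_ennrealI) simp
  qed
  have "(\<integral>\<^sup>+\<xi>. ennreal ((norm (fourier_integral f \<xi>))\<^sup>2) \<partial>lborel) = (\<integral>\<^sup>+\<xi>. liminf (\<lambda>n. ?F n \<xi>) \<partial>lborel)"
    using lim_imp_Liminf[OF _ lim] by (intro nn_integral_cong) simp
  also have "\<dots> \<le> liminf (\<lambda>n. \<integral>\<^sup>+\<xi>. ?F n \<xi> \<partial>lborel)"
    by (rule nn_integral_liminf) measurable
  also have "\<dots> \<le> liminf (\<lambda>n. ?R)"
    by (intro Liminf_mono always_eventually allI nn_integral_fourier_integral_gaussian_le[OF f]) simp
  also have "\<dots> = ?R" by (simp add: Liminf_const)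
  finally show ?thesis .
qed

section \<open>The symbol of the fractional Laplacian\<close>

lemma nn_integral_gamma_scaled:
  fixes a b :: real
  assumes a: "a > 0" and b: "b > 0"
  shows "(\<integral>\<^sup>+t. ennreal (t powr (a - 1) * exp (- b * t)) * indicator {0<..} t \<partial>lborel)
    = ennreal (Gamma a * b powr (- a))"
proof -
  let ?f = "\<lambda>t::real. ennreal (indicator {0..} t * t powr (a - 1) / exp t)"
  have 1: "ennreal (Gamma a) = ennreal b * (\<integral>\<^sup>+t. ?f (0 + b * t) \<partial>lborel)"
    unfolding Gamma_conv_nn_integral_real[OF a]
    using nn_integral_real_affine[of ?f b 0] b by simp
  have "ennreal (t powr (a - 1) * exp (- b * t)) * indicator {0<..} t = ennreal (b powr (1 - a)) * ?f (0 + b * t)" for t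
  proof (cases "t > 0")
    case True
    have "b powr (1 - a) * (b * t) powr (a - 1) = t powr (a - 1)"
      using True b by (simp add: powr_mult powr_add[symmetric] flip: mult.assoc)
    then show ?thesis using True b
      by (simp add: ennreal_mult[symmetric] exp_minus field_simps)
  next
    case False
    \<comment> \<open>At \<open>t = 0\<close> the closed indicator is 1, but
      \<open>0 powr (a - 1) = 0\<close>, so both sides still agree.\<close>
    then have "t = 0 \<or> b * t < 0" using b by (auto simp: mult_less_0_iff)
    then show ?thesis using False by auto
  qed
  then have "(\<integral>\<^sup>+t. ennreal (t powr (a - 1) * exp (- b * t)) * indicator {0<..} t \<partial>lborel)
    = ennreal (b powr (1 - a)) * (\<integral>\<^sup>+t. ?f (0 + b * t) \<partial>lborel)"
    by (simp add: nn_integral_cmult)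
  also have "b powr (1 - a) = b powr (- a) * b"
    using b by (simp add: powr_diff powr_minus divide_simps)
  also have "ennreal (b powr (- a) * b) = ennreal (b powr (- a)) * ennreal b"
    using b by (simp add: ennreal_mult)
  also have "\<dots> * (\<integral>\<^sup>+t. ?f (0 + b * t) \<partial>lborel) = ennreal (b powr (- a)) * ennreal (Gamma a)"
    by (simp only: 1 mult.assoc)
  also have "\<dots> = ennreal (Gamma a * b powr (- a))"
    using Gamma_real_pos[OF a] by (simp add: ennreal_mult mult.commute)
  finally show ?thesis .
qed

text \<open>Write \<open>1 - exp (- b / t)\<close> as the integral of
  \<open>b * exp (- b * w)\<close> over \<open>0 < w < 1 / t\<close> and exchange the order. The
  inner integral of \<open>t^(s-1)\<close> over \<open>0 < t < 1 / w\<close> is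
  \<open>w^(-s) / s\<close> because \<open>s > 0\<close>; what is left is the Gamma integral for
  \<open>1 - s\<close>, which converges because \<open>s < 1\<close>.\<close>

lemma nn_integral_powr_one_minus_exp:
  fixes b s :: real
  assumes b: "b \<ge> 0" and s: "0 < s" "s < 1"
  shows "(\<integral>\<^sup>+t. ennreal (t powr (s - 1) * (1 - exp (- b / t))) * indicator {0<..} t \<partial>lborel)
    = ennreal (b powr s * Gamma (1 - s) / s)"
proof (cases "b = 0")
  case True
  then show ?thesis by simp
next
  case False
  with b have b: "b > 0" by simp
  let ?D = "\<lambda>t w::real. ennreal (b * exp (- b * w)) * indicator {0<..} w * (ennreal (t powr (s - 1)) * indicator {0<..<1/w} t)"
  have [measurable]: "(\<lambda>w. indicator {0<..<1/w} t :: ennreal) \<in> borel_measurable borel" for t :: real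
  proof -
    have "(\<lambda>w. indicator {0<..<1/w} t :: ennreal) = (\<lambda>w. if 0 < t \<and> t < 1/w then 1 else 0)"
      by (auto simp: fun_eq_iff)
    then show ?thesis by simp
  qed
  have 1: "ennreal (t powr (s - 1) * (1 - exp (- b / t))) * indicator {0<..} t = (\<integral>\<^sup>+w. ?D t w \<partial>lborel)" for t
  proof (cases "t > 0")
    case True
    have "ennreal (1 - exp (- b / t)) = ennreal (- exp (- b * (1 / t)) - (- exp (- b * 0)))" by simp
    also have "\<dots> = (\<integral>\<^sup>+w. ennreal (b * exp (- b * w)) * indicator {0..1/t} w \<partial>lborel)"
      by (rule nn_integral_FTC_Icc[symmetric])
         (use b True in \<open>auto intro!: derivative_eq_intros\<close>)
    also have "\<dots> = (\<integral>\<^sup>+w. ennreal (b * exp (- b * w)) * (indicator {0<..} w * indicator {0<..<1/w} t) \<partial>lborel)"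
    proof (rule nn_integral_cong_AE)
      show "AE w in lborel. ennreal (b * exp (- b * w)) * indicator {0..1/t} w
          = ennreal (b * exp (- b * w)) * (indicator {0<..} w * indicator {0<..<1/w} t)"
        using AE_lborel_singleton[of "0::real"] AE_lborel_singleton[of "1/t"]
        by eventually_elim (use True in \<open>auto split: split_indicator simp: field_simps\<close>)
    qed
    finally have "ennreal (1 - exp (- b / t)) = \<dots>" .
    then have "ennreal (t powr (s - 1) * (1 - exp (- b / t))) =
      ennreal (t powr (s - 1)) * (\<integral>\<^sup>+w. ennreal (b * exp (- b * w)) * (indicator {0<..} w * indicator {0<..<1/w} t) \<partial>lborel)"
      using b True by (simp add: ennreal_mult)
    also have "\<dots> = (\<integral>\<^sup>+w. ?D t w \<partial>lborel)"
      by (subst nn_integral_cmult[symmetric]) (auto simp: mult_ac)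
    finally show ?thesis using True by simp
  qed auto
  have 2: "(\<integral>\<^sup>+t. ?D t w \<partial>lborel) = ennreal (b / s) * (ennreal (w powr ((1 - s) - 1) * exp (- b * w)) * indicator {0<..} w)" for w
  proof (cases "w > 0")
    case True
    have "(\<integral>\<^sup>+t. ?D t w \<partial>lborel) = ennreal (b * exp (- b * w)) * ennreal (max 0 (1/w) powr s / s)"
      using True by (simp add: nn_integral_cmult nn_integral_powr_0_1[OF s(1)])
    also have "max 0 (1/w) powr s = w powr ((1 - s) - 1)"
      using True by (simp add: powr_minus powr_divide divide_simps max_def)
    finally show ?thesis using True b s by (simp add: ennreal_mult[symmetric] mult_ac)
  qed auto
  have "(\<integral>\<^sup>+t. ennreal (t powr (s - 1) * (1 - exp (- b / t))) * indicator {0<..} t \<partial>lborel)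
      = (\<integral>\<^sup>+t. (\<integral>\<^sup>+w. ?D t w \<partial>lborel) \<partial>lborel)"
    by (simp only: 1)
  also have "\<dots> = (\<integral>\<^sup>+w. (\<integral>\<^sup>+t. ?D t w \<partial>lborel) \<partial>lborel)"
  proof (rule lborel_pair.Fubini'[symmetric])
    have "(\<lambda>(t, w). ?D t w) = (\<lambda>(t, w). ennreal (b * exp (- b * w)) * (if 0 < w then 1 else 0) * (ennreal (t powr (s - 1)) * (if 0 < t \<and> t < 1 / w then 1 else 0)))"
      by (auto simp: fun_eq_iff)
    then show "(\<lambda>(t, w). ?D t w) \<in> borel_measurable (lborel \<Otimes>\<^sub>M lborel)"
      by simp
  qed
  also have "\<dots> = ennreal (b / s) * (\<integral>\<^sup>+w. ennreal (w powr ((1 - s) - 1) * exp (- b * w)) * indicator {0<..} w \<partial>lborel)"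
    by (simp only: 2) (simp add: nn_integral_cmult)
  also have "\<dots> = ennreal (b / s) * ennreal (Gamma (1 - s) * b powr (- (1 - s)))"
    using s b by (subst nn_integral_gamma_scaled) auto
  also have "\<dots> = ennreal (b powr s * Gamma (1 - s) / s)"
  proof -
    have "b * b powr (- (1 - s)) = b powr s"
      using b by (simp add: powr_mult_base)
    then have "b / s * (Gamma (1 - s) * b powr (- (1 - s))) = b powr s * Gamma (1 - s) / s"
      by (simp add: field_simps)
    then show ?thesis using b s by (simp only: ennreal_mult'[symmetric] divide_nonneg_pos less_imp_le)
  qed
  finally show ?thesis .
qed

text \<open>The Gaussian Fourier integral at 0 minus the real part of the one at \<xi>.\<close>

lemma nn_integral_one_minus_cos_gaussian:
  fixes \<xi> :: "'a::euclidean_space"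
  assumes t: "t > 0"
  shows "(\<integral>\<^sup>+z. ennreal ((1 - cos (z \<bullet> \<xi>)) * exp (- t * (norm z)\<^sup>2)) \<partial>lborel)
    = ennreal ((pi / t) powr (DIM('a) / 2) * (1 - exp (- (norm \<xi>)\<^sup>2 / (4 * t))))"
proof -
  have "has_bochner_integral lborel (\<lambda>z. cos (z \<bullet> \<xi>) * exp (- t * (norm z)\<^sup>2))
     ((pi / t) powr (DIM('a) / 2) * exp (- (norm \<xi>)\<^sup>2 / (4 * t)))"
    using has_bochner_integral_Re[OF has_bochner_integral_fourier_gaussian[OF t, of \<xi>]]
    by (simp add: Re_exp)
  from has_bochner_integral_diff[OF has_bochner_integral_gaussian[OF t] this]
  have "has_bochner_integral lborel (\<lambda>z. (1 - cos (z \<bullet> \<xi>)) * exp (- t * (norm z)\<^sup>2))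
     ((pi / t) powr (DIM('a) / 2) * (1 - exp (- (norm \<xi>)\<^sup>2 / (4 * t))))"
    by (simp add: algebra_simps)
  then show ?thesis
    by (subst nn_integral_eq_integral) (auto simp: has_bochner_integral_iff)
qed

lemma frac_const_pos: "0 < s \<Longrightarrow> s < 1 \<Longrightarrow> frac_const n s > 0"
  unfolding frac_const_def by (intro mult_pos_pos divide_pos_pos Gamma_real_pos) auto

text \<open>The power \<open>|z|\<^sup>-\<^sup>N\<^sup>-\<^sup>2\<^sup>s\<close> is a superposition of Gaussians, which reduces the symbol of the
  fractional Laplacian to the Gaussian Fourier integral and makes rotation invariance unnecessary.\<close>

lemma nn_integral_frac_symbol:
  fixes \<xi> :: "'a::euclidean_space" and s :: real
  assumes s: "0 < s" "s < 1"
  shows "(\<integral>\<^sup>+z. ennreal ((1 - cos (z \<bullet> \<xi>)) / norm z powr (DIM('a) + 2 * s)) \<partial>lborel)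
    = ennreal (norm \<xi> powr (2 * s) / frac_const DIM('a) s)"
proof -
  let ?N = "DIM('a)"
  \<comment> \<open>Half of the kernel exponent: \<open>|z|^(-N-2s) = (|z|^2)^(-a)\<close>, which is
    the integral of \<open>t^(a-1) * exp (- t * |z|^2)\<close> divided by
    \<open>Gamma a\<close>.\<close>
  define a where "a = ?N / 2 + s"
  have a: "a > 0" using s by (simp add: a_def add_pos_pos)
  let ?D = "\<lambda>(z::'a) t::real. ennreal (1 / Gamma a) * (ennreal ((1 - cos (z \<bullet> \<xi>)) * exp (- t * (norm z)\<^sup>2)) * (ennreal (t powr (a - 1)) * indicator {0<..} t))"
  have 1: "AE z in lborel. ennreal ((1 - cos (z \<bullet> \<xi>)) / norm z powr (?N + 2 * s)) = (\<integral>\<^sup>+t. ?D z t \<partial>lborel)"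
    using AE_lborel_singleton[of "0::'a"]
  proof eventually_elim
    case (elim z)
    have "(\<integral>\<^sup>+t. ?D z t \<partial>lborel) = (\<integral>\<^sup>+t. ennreal ((1 - cos (z \<bullet> \<xi>)) / Gamma a) * (ennreal (t powr (a - 1) * exp (- (norm z)\<^sup>2 * t)) * indicator {0<..} t) \<partial>lborel)"
      using a by (intro nn_integral_cong) (auto simp: ennreal_mult[symmetric] mult_ac split: split_indicator)
    also have "\<dots> = ennreal ((1 - cos (z \<bullet> \<xi>)) / Gamma a) * ennreal (Gamma a * (norm z)\<^sup>2 powr (- a))"
      using elim a by (subst nn_integral_cmult, measurable, subst nn_integral_gamma_scaled) simp_all
    also have "(norm z)\<^sup>2 powr (- a) = norm z powr (2 * (- a))"
      using elim unfolding powr_powr[symmetric] by simp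
    also have "2 * (- a) = - (?N + 2 * s)" by (simp add: a_def)
    also have "ennreal ((1 - cos (z \<bullet> \<xi>)) / Gamma a) * ennreal (Gamma a * norm z powr (- (?N + 2 * s)))
       = ennreal ((1 - cos (z \<bullet> \<xi>)) / norm z powr (?N + 2 * s))"
      using Gamma_real_pos[OF a] unfolding powr_minus by (simp add: ennreal_mult[symmetric] divide_inverse)
    finally show ?case by simp
  qed
  \<comment> \<open>The Gaussian integral over \<open>z\<close> contributes \<open>t^(-N/2)\<close>,
    lowering the power of \<open>t\<close> from \<open>a - 1\<close> to \<open>s - 1\<close>. What
    remains is \<open>nn_integral_powr_one_minus_exp\<close> with \<open>b = |\<xi>|^2 / 4\<close>;
    its factor \<open>b^s\<close> yields both \<open>|\<xi>|^(2s)\<close> and the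
    \<open>2^(2s)\<close> of \<open>frac_const\<close>.\<close>
  have 2: "(\<integral>\<^sup>+z. ?D z t \<partial>lborel) = ennreal (pi powr (?N / 2) / Gamma a) *
     (ennreal (t powr (s - 1) * (1 - exp (- ((norm \<xi>)\<^sup>2 / 4) / t))) * indicator {0<..} t)" for t
  proof (cases "t > 0")
    case True
    have "(\<integral>\<^sup>+z. ?D z t \<partial>lborel) = ennreal (1 / Gamma a) * (ennreal ((pi / t) powr (?N / 2) * (1 - exp (- (norm \<xi>)\<^sup>2 / (4 * t)))) * ennreal (t powr (a - 1)))"
      using True nn_integral_one_minus_cos_gaussian[OF True, of \<xi>]
      by (simp add: nn_integral_cmult nn_integral_multc)
    also have "\<dots> = ennreal (1 / Gamma a * (((pi / t) powr (?N / 2) * t powr (a - 1)) * (1 - exp (- (norm \<xi>)\<^sup>2 / (4 * t)))))"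
      using True Gamma_real_pos[OF a] by (simp add: ennreal_mult[symmetric] mult_ac)
    also have "(pi / t) powr (?N / 2) * t powr (a - 1) = pi powr (?N / 2) * t powr (a - 1 - ?N / 2)"
      using True by (simp add: powr_divide powr_diff)
    also have "a - 1 - ?N / 2 = s - 1" by (simp add: a_def)
    finally show ?thesis using True Gamma_real_pos[OF a] by (simp add: ennreal_mult[symmetric] mult_ac)
  qed simp
  have "(\<integral>\<^sup>+z. ennreal ((1 - cos (z \<bullet> \<xi>)) / norm z powr (?N + 2 * s)) \<partial>lborel) = (\<integral>\<^sup>+z. (\<integral>\<^sup>+t. ?D z t \<partial>lborel) \<partial>lborel)"
    by (rule nn_integral_cong_AE[OF 1])
  also have "\<dots> = (\<integral>\<^sup>+t. (\<integral>\<^sup>+z. ?D z t \<partial>lborel) \<partial>lborel)"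
    by (rule lborel_pair.Fubini'[symmetric]) measurable
  also have "\<dots> = ennreal (pi powr (?N / 2) / Gamma a) *
      (\<integral>\<^sup>+t. ennreal (t powr (s - 1) * (1 - exp (- ((norm \<xi>)\<^sup>2 / 4) / t))) * indicator {0<..} t \<partial>lborel)"
    by (simp only: 2) (rule nn_integral_cmult, measurable)
  also have "\<dots> = ennreal (pi powr (?N / 2) / Gamma a) * ennreal (((norm \<xi>)\<^sup>2 / 4) powr s * Gamma (1 - s) / s)"
    by (subst nn_integral_powr_one_minus_exp[OF _ s]) simp_all
  also have "\<dots> = ennreal (norm \<xi> powr (2 * s) / frac_const ?N s)"
  proof -
    have G: "Gamma a > 0" "Gamma (1 - s) > 0" using a s by (auto intro!: Gamma_real_pos)
    have "((norm \<xi>)\<^sup>2 / 4) powr s = norm \<xi> powr (2 * s) / 2 powr (2 * s)"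
    proof -
      have "(norm \<xi>)\<^sup>2 / 4 = (norm \<xi> / 2) powr 2" by (simp add: power_divide)
      then have "((norm \<xi>)\<^sup>2 / 4) powr s = (norm \<xi> / 2) powr (2 * s)" by (simp only: powr_powr)
      then show ?thesis by (simp add: powr_divide)
    qed
    moreover have "(?N + 2 * s) / 2 = a" by (simp add: a_def add_divide_distrib)
    ultimately have "pi powr (?N / 2) / Gamma a * (((norm \<xi>)\<^sup>2 / 4) powr s * Gamma (1 - s) / s)
       = norm \<xi> powr (2 * s) / frac_const ?N s"
      using G s unfolding frac_const_def powr_minus by (simp add: divide_simps)
    then show ?thesis using G s by (subst ennreal_mult[symmetric]) auto
  qed
  finally show ?thesis .
qed

section \<open>Kernel estimates for compactly supported Hoelder functions\<close>

text \<open>Induction on the order: for \<open>k > 0\<close> the partial derivatives satisfy a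
  Holder bound by hypothesis and vanish far out, hence they are bounded and \<open>u\<close> is
  Lipschitz. All higher regularity is thus reduced to a single Holder estimate.\<close>

lemma Holder_class_compact_support_imp_Holder:
  fixes u :: "'a::euclidean_space \<Rightarrow> real"
  assumes "Holder_class k \<alpha> u" "\<alpha> > 0" "R \<ge> 0" "\<And>x. norm x > R \<Longrightarrow> u x = 0"
  shows "\<exists>C \<alpha>'. C \<ge> 0 \<and> \<alpha>' > 0 \<and> (\<forall>x y. \<bar>u x - u y\<bar> \<le> C * norm (x - y) powr \<alpha>')"
  using assms(1,4)
proof (induction k arbitrary: u)
  case 0
  then obtain C where C: "\<And>x y. \<bar>u x - u y\<bar> \<le> C * norm (x - y) powr \<alpha>" by auto
  have "\<bar>u x - u y\<bar> \<le> max 0 C * norm (x - y) powr \<alpha>" for x y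
    using C[of x y] by (rule order_trans) (auto intro!: mult_right_mono)
  then show ?case using \<open>\<alpha> > 0\<close> by (intro exI[of _ "max 0 C"] exI[of _ \<alpha>]) auto
next
  case (Suc k)
  let ?D = "\<lambda>x. frechet_derivative u (at x)"
  have D: "(u has_derivative ?D x) (at x)" for x
    using Suc.prems(1) by (auto simp: differentiable_on_def frechet_derivative_works[symmetric])
  have D0: "?D x = (\<lambda>_. 0)" if "norm x > R" for x
  proof -
    \<comment> \<open>The strict inequality makes the region open, so \<open>u\<close> vanishes near
      \<open>x\<close> and its derivative is 0. Thus the partial derivatives inherit the support
      condition for the induction.\<close>
    have "open {x::'a. norm x > R}" by (intro open_Collect_less continuous_intros)
    then have "(u has_derivative (\<lambda>_. 0)) (at x)"
      using that Suc.prems(2)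
      by (intro has_derivative_transform_within_open[of "\<lambda>_. 0" "\<lambda>_. 0" x UNIV "{x. norm x > R}" u]) auto
    then show ?thesis using D has_derivative_unique by blast
  qed
  have "\<exists>M. \<forall>x. \<bar>?D x b\<bar> \<le> M" if b: "b \<in> Basis" for b
  proof -
    have "Holder_class k \<alpha> (\<lambda>x. ?D x b)" using Suc.prems(1) b by simp
    then obtain C \<alpha>' where C: "C \<ge> 0" "\<alpha>' > 0" "\<And>x y. \<bar>?D x b - ?D y b\<bar> \<le> C * norm (x - y) powr \<alpha>'"
      using Suc.IH[of "\<lambda>x. ?D x b"] D0 by auto
    have "\<bar>?D x b\<bar> \<le> C * (2 * R + 1) powr \<alpha>'" for x
    proof (cases "norm x > R")
      case False
      \<comment> \<open>A comparison point at which the derivative vanishes, at distance at most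
        \<open>2 * R + 1\<close> from any point of norm at most \<open>R\<close>.\<close>
      define x0 where "x0 = (R + 1) *\<^sub>R b"
      have x0: "norm x0 = R + 1" using b \<open>R \<ge> 0\<close> by (simp add: x0_def)
      have "\<bar>?D x b\<bar> \<le> C * norm (x - x0) powr \<alpha>'"
        using C(3)[of x x0] D0[of x0] x0 by simp
      also have "\<dots> \<le> C * (2 * R + 1) powr \<alpha>'"
        using norm_triangle_ineq4[of x x0] x0 False C by (intro mult_left_mono powr_mono2) auto
      finally show ?thesis .
    qed (use C D0 in auto)
    then show ?thesis by blast
  qed
  then obtain M where M: "\<And>b x. b \<in> Basis \<Longrightarrow> \<bar>?D x b\<bar> \<le> M b" by metis
  define B where "B = (\<Sum>b\<in>(Basis::'a set). M b)"
  have "onorm (?D x) \<le> B" for x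
  proof (rule onorm_le)
    fix h :: 'a
    have "?D x h = ?D x (\<Sum>b\<in>Basis. (h \<bullet> b) *\<^sub>R b)" by (simp add: euclidean_representation)
    also have "\<dots> = (\<Sum>b\<in>Basis. (h \<bullet> b) *\<^sub>R ?D x b)"
      using has_derivative_linear[OF D[of x]] by (simp add: linear_sum linear_scale)
    finally have "norm (?D x h) \<le> (\<Sum>b\<in>Basis. norm ((h \<bullet> b) *\<^sub>R ?D x b))"
      by (simp only:) (rule norm_sum)
    also have "\<dots> \<le> (\<Sum>b\<in>Basis. norm h * M b)"
      by (intro sum_mono) (auto simp: abs_mult intro!: mult_mono Basis_le_norm M)
    finally show "norm (?D x h) \<le> B * norm h" by (simp add: B_def sum_distrib_left mult.commute)
  qed
  then have L: "norm (u x - u y) \<le> B * norm (x - y)" for x y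
    using D by (intro differentiable_bound[of UNIV u ?D B]) (auto intro: has_derivative_at_withinI)
  have "B \<ge> 0" unfolding B_def
    using M by (intro sum_nonneg) (meson abs_ge_zero order_trans)
  then show ?case using L by (intro exI[of _ B] exI[of _ 1]) auto
qed

text \<open>The exponent \<alpha> is just some positive number; for \<open>\<beta> > 1\<close> the
  reduction above yields a Lipschitz bound, so \<open>\<alpha> = 1\<close>. The condition
  \<open>supp\<close> includes the sphere of radius \<open>R\<close>, which supplies zeros of
  \<open>u\<close> at norm exactly \<open>R\<close>.\<close>

locale compact_Holder =
  fixes u :: "'a::euclidean_space \<Rightarrow> real" and C \<alpha> R :: real
  assumes Holder: "\<bar>u x - u y\<bar> \<le> C * norm (x - y) powr \<alpha>"
    and C_nonneg: "C \<ge> 0" and \<alpha>_pos: "\<alpha> > 0" and R_nonneg: "R \<ge> 0"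
    and supp: "norm x \<ge> R \<Longrightarrow> u x = 0"

lemma Holder_c_imp_compact_Holder:
  assumes "\<beta> > 0" "u \<in> Holder_c \<beta>"
  obtains C \<alpha> R where "compact_Holder u C \<alpha> R"
proof -
  have "compact (closure (support_on UNIV u))" using assms(2) by (simp add: Holder_c_def)
  then have "bounded (support_on UNIV u)" by (rule bounded_subset[OF compact_imp_bounded closure_subset])
  then obtain R where R: "\<And>x. u x \<noteq> 0 \<Longrightarrow> norm x \<le> R"
    unfolding bounded_iff support_on_def by auto
  define R' where "R' = max 0 R"
  have R': "R' \<ge> 0" "\<And>x. norm x > R' \<Longrightarrow> u x = 0" using R unfolding R'_def by fastforce+
  have "Holder_class (nat (\<lceil>\<beta>\<rceil> - 1)) (\<beta> - of_int (\<lceil>\<beta>\<rceil> - 1)) u" using assms(2) by (simp add: Holder_c_def)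
  moreover have "\<beta> - of_int (\<lceil>\<beta>\<rceil> - 1) > 0" using assms(1) by linarith
  ultimately obtain C \<alpha> where "C \<ge> 0" "\<alpha> > 0" "\<forall>x y. \<bar>u x - u y\<bar> \<le> C * norm (x - y) powr \<alpha>"
    using Holder_class_compact_support_imp_Holder[of _ _ u R'] R' by blast
  \<comment> \<open>One is added to the radius because \<open>supp\<close> requires vanishing on the
    bounding sphere too.\<close>
  then have "compact_Holder u C \<alpha> (R' + 1)"
    using R' by unfold_locales auto
  then show ?thesis by (rule that)
qed

text \<open>With \<open>v = - 2 s ln r\<close> the difference is
  \<open>exp v - 1 \<le> v * exp v\<close>, where \<open>v\<close> carries the rate
  \<open>s\<close>. The logarithm in \<open>v\<close> is absorbed at the price of an arbitrarily
  small power: \<open>ln (1 / r) \<le> r^(-\<delta>) / \<delta>\<close>.\<close>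

lemma powr_neg_minus_one_bounds:
  fixes r s \<delta> :: real
  assumes "0 < r" "r \<le> 1" "s \<ge> 0" "\<delta> > 0"
  shows "0 \<le> r powr (- 2 * s) - 1" "r powr (- 2 * s) - 1 \<le> 2 * s / \<delta> * r powr (- \<delta> - 2 * s)"
proof -
  define v where "v = - (2 * s * ln r)"
  have v: "v \<ge> 0" using assms by (simp add: v_def mult_nonneg_nonpos)
  have e: "r powr (- 2 * s) = exp v" using assms by (simp add: powr_def v_def)
  show "0 \<le> r powr (- 2 * s) - 1" unfolding e using v by simp
  have "1 - exp (- v) \<le> v" using exp_ge_add_one_self[of "- v"] by linarith
  then have "exp v * (1 - exp (- v)) \<le> exp v * v" by (intro mult_left_mono) auto
  then have "exp v - 1 \<le> v * exp v" by (simp add: algebra_simps flip: exp_add)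
  also have "v \<le> 2 * s * (r powr (- \<delta>) / \<delta>)"
  proof -
    have "ln (1 / r) \<le> (1 / r) powr \<delta> / \<delta>" using assms by (intro ln_powr_bound) auto
    then have "- ln r \<le> r powr (- \<delta>) / \<delta>" using assms by (simp add: ln_div powr_divide powr_minus divide_simps)
    then have "2 * s * (- ln r) \<le> 2 * s * (r powr (- \<delta>) / \<delta>)" using assms by (intro mult_left_mono) auto
    then show ?thesis by (simp add: v_def)
  qed
  then have "v * exp v \<le> 2 * s * (r powr (- \<delta>) / \<delta>) * exp v" by (intro mult_right_mono) auto
  also have "\<dots> = 2 * s / \<delta> * r powr (- \<delta> - 2 * s)"
    unfolding e[symmetric] using assms by (simp add: powr_add[symmetric])
  finally show "r powr (- 2 * s) - 1 \<le> 2 * s / \<delta> * r powr (- \<delta> - 2 * s)" unfolding e .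
qed

text \<open>The crude bound \<open>ln r \<le> r\<close> suffices: the extra factor \<open>r\<close>
  is later absorbed by the denominator \<open>r ^ N\<close>, as \<open>N \<ge> 1\<close>.\<close>

lemma one_minus_powr_neg_bounds:
  fixes r s :: real
  assumes "r \<ge> 1" "s \<ge> 0"
  shows "0 \<le> 1 - r powr (- 2 * s)" "1 - r powr (- 2 * s) \<le> 2 * s * r"
proof -
  have e: "r powr (- 2 * s) = exp (- (2 * s * ln r))" using assms by (simp add: powr_def)
  show "0 \<le> 1 - r powr (- 2 * s)" unfolding e using assms by simp
  have "1 - exp (- (2 * s * ln r)) \<le> 2 * s * ln r" using exp_ge_add_one_self[of "- (2 * s * ln r)"] by linarith
  also have "\<dots> \<le> 2 * s * r" using assms ln_le_minus_one[of r] by (intro mult_left_mono) auto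
  finally show "1 - r powr (- 2 * s) \<le> 2 * s * r" unfolding e .
qed

text \<open>Differs from \<open>frac_kernel\<close> by the tail
  \<open>u x / |x - y|^(N + 2 s)\<close> outside the unit ball. That tail alone has an integral that
  blows up as \<open>s\<close> tends to 0; the remaining kernel has an integrable majorant down to
  and including \<open>s = 0\<close>.\<close>

definition log_kernel :: "real \<Rightarrow> ('a::euclidean_space \<Rightarrow> real) \<Rightarrow> 'a \<Rightarrow> 'a \<Rightarrow> real" where
  "log_kernel s u x y = (u x * indicator (ball x 1) y - u y) / norm (x - y) powr (real DIM('a) + 2 * s)"

lemma log_kernel_0: "log_kernel 0 u x y = (u x * indicator (ball x 1) y - u y) / norm (x - y) ^ DIM('a)"
  for x :: "'a::euclidean_space"
  by (cases "x = y") (auto simp: log_kernel_def powr_realpow)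

definition log_integral :: "real \<Rightarrow> ('a::euclidean_space \<Rightarrow> real) \<Rightarrow> 'a \<Rightarrow> real" where
  "log_integral s u x = (\<integral>y. log_kernel s u x y \<partial>lborel)"

lemma ball_in_sets_borel [measurable]: "ball (x::'a::euclidean_space) r \<in> sets borel"
  by (rule borel_open) simp

lemma has_bochner_integral_norm_powr_ball:
  fixes x :: "'a::euclidean_space"
  assumes "(a::real) > 0"
  shows "has_bochner_integral lborel (\<lambda>y. indicator (ball x 1) y * norm (x - y) powr (a - real DIM('a))) (sphere_area DIM('a) / a)"
proof (rule has_bochner_integral_nn_integral)
  have "(\<integral>\<^sup>+y. ennreal (indicator (ball x 1) y * norm (x - y) powr (a - real DIM('a))) \<partial>lborel)
     = (\<integral>\<^sup>+y. (\<lambda>z. ennreal (norm z powr (a - real DIM('a))) * indicator (ball 0 1) z) (x - y) \<partial>lborel)"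
    by (intro nn_integral_cong) (auto split: split_indicator simp: dist_norm norm_minus_commute)
  also have "\<dots> = ennreal (sphere_area DIM('a) / a)"
    by (subst nn_integral_reflect) (auto simp: nn_integral_norm_powr_ball[OF assms])
  finally show "(\<integral>\<^sup>+y. ennreal (indicator (ball x 1) y * norm (x - y) powr (a - real DIM('a))) \<partial>lborel) = ennreal (sphere_area DIM('a) / a)" .
qed (use assms in \<open>auto simp: less_imp_le\<close>)

lemma has_bochner_integral_norm_powr_compl_ball:
  fixes x :: "'a::euclidean_space"
  assumes "(a::real) > 0"
  shows "has_bochner_integral lborel (\<lambda>y. indicator (- ball x 1) y * norm (x - y) powr (- a - real DIM('a))) (sphere_area DIM('a) / a)"
proof (rule has_bochner_integral_nn_integral)
  have "(\<integral>\<^sup>+y. ennreal (indicator (- ball x 1) y * norm (x - y) powr (- a - real DIM('a))) \<partial>lborel)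
     = (\<integral>\<^sup>+y. (\<lambda>z. ennreal (norm z powr (- a - real DIM('a))) * indicator (- ball 0 1) z) (x - y) \<partial>lborel)"
    by (intro nn_integral_cong) (auto split: split_indicator simp: dist_norm norm_minus_commute)
  also have "\<dots> = ennreal (sphere_area DIM('a) / a)"
    by (subst nn_integral_reflect) (auto simp: nn_integral_norm_powr_compl_ball[OF assms])
  finally show "(\<integral>\<^sup>+y. ennreal (indicator (- ball x 1) y * norm (x - y) powr (- a - real DIM('a))) \<partial>lborel) = ennreal (sphere_area DIM('a) / a)" .
qed (use assms in \<open>auto simp: less_imp_le\<close>)

text \<open>For small \<open>s\<close> the kernel is absolutely integrable, and by this lemma the
  principal value is then an ordinary integral. Dominated convergence applies after substituting
  \<open>1 / t\<close> for the radius; in the limit only the null set \<open>{x}\<close> is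
  lost.\<close>

lemma tendsto_set_integral_compl_ball:
  fixes f :: "'a::euclidean_space \<Rightarrow> real"
  assumes f: "integrable lborel f"
  shows "((\<lambda>\<epsilon>. LINT y:- ball x \<epsilon>|lborel. f y) \<longlongrightarrow> (\<integral>y. f y \<partial>lborel)) (at_right 0)"
proof -
  have "((\<lambda>t. LINT y:- ball x (inverse t)|lborel. f y) \<longlongrightarrow> (\<integral>y. f y \<partial>lborel)) at_top"
    unfolding set_lebesgue_integral_def
  proof (rule integral_dominated_convergence_at_top)
    show "integrable lborel (\<lambda>y. norm (f y))" using f by simp
    show "AE y in lborel. ((\<lambda>t. indicator (- ball x (inverse t)) y *\<^sub>R f y) \<longlongrightarrow> f y) at_top"
      using AE_lborel_singleton[of x]
    proof eventually_elim
      case (elim y)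
      have "((\<lambda>t::real. inverse t) \<longlongrightarrow> 0) at_top" by (rule tendsto_inverse_0_at_top) (rule filterlim_ident)
      then have "\<forall>\<^sub>F t::real in at_top. inverse t < dist x y"
        using elim by (intro order_tendstoD) auto
      then have "\<forall>\<^sub>F t in at_top. f y = indicator (- ball x (inverse t)) y *\<^sub>R f y"
        by eventually_elim auto
      then show ?case by (rule tendsto_eventually[OF eventually_mono]) auto
    qed
  qed (use f in \<open>auto split: split_indicator\<close>)
  then show ?thesis by (simp add: filterlim_at_right_to_top)
qed

section \<open>Estimates for the truncated kernel, uniform in the order and in the point\<close>

context compact_Holder
begin

lemma continuous_u: "continuous_on UNIV u"
proof -
  have "isCont u x" for x
  proof -
    have "((\<lambda>y. C * norm (y - x) powr \<alpha>) \<longlongrightarrow> 0) (at x)"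
      using \<alpha>_pos by (auto intro!: tendsto_eq_intros)
    then have "((\<lambda>y. u y - u x) \<longlongrightarrow> 0) (at x)"
      by (rule Lim_null_comparison[rotated]) (auto simp: Holder)
    then show ?thesis by (simp add: isCont_def LIM_zero_iff)
  qed
  then show ?thesis by (simp add: continuous_at_imp_continuous_on)
qed

lemma measurable_u [measurable]: "u \<in> borel_measurable borel"
  by (rule borel_measurable_continuous_onI[OF continuous_u])

text \<open>The Holder bound over a distance of at most \<open>2 * R\<close>, between a point of the
  ball and a zero of \<open>u\<close> on its bounding sphere.\<close>

definition u_bound where "u_bound = C * (2 * R) powr \<alpha>"

lemma u_bound_nonneg: "u_bound \<ge> 0" using C_nonneg by (simp add: u_bound_def)

lemma abs_u_le: "\<bar>u x\<bar> \<le> u_bound * indicator (ball 0 R) x"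
proof (cases "norm x < R")
  case True
  obtain b :: 'a where b: "b \<in> Basis" using nonempty_Basis by blast
  have "norm (x - R *\<^sub>R b) \<le> 2 * R" using norm_triangle_ineq4[of x "R *\<^sub>R b"] True b R_nonneg by simp
  then have "C * norm (x - R *\<^sub>R b) powr \<alpha> \<le> u_bound"
    unfolding u_bound_def using C_nonneg \<alpha>_pos by (intro mult_left_mono powr_mono2) auto
  moreover have "u (R *\<^sub>R b) = 0" using b R_nonneg by (intro supp) simp
  ultimately show ?thesis using Holder[of x "R *\<^sub>R b"] True by simp
qed (use supp u_bound_nonneg in auto)

lemma integrable_u: "integrable lborel u"
proof (rule Bochner_Integration.integrable_bound)
  show "integrable lborel (\<lambda>x. u_bound * indicator (ball 0 R) x)"
    using emeasure_lborel_ball_finite[of 0 R] by (intro integrable_mult_right integrable_real_indicator) auto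
qed (use abs_u_le u_bound_nonneg in \<open>auto simp: abs_mult\<close>)

definition u_mass where "u_mass = (\<integral>x. \<bar>u x\<bar> \<partial>lborel)"

lemma u_mass_nonneg: "u_mass \<ge> 0" by (simp add: u_mass_def)

text \<open>A common majorant for all small orders. Near \<open>x\<close> the Holder bound gives
  \<open>|x - y|^(\<alpha> - N - 2s)\<close>; for \<open>s \<le> \<alpha> / 4\<close> at most half
  of \<alpha> is spent and the exponent \<open>\<alpha> / 2 - N\<close> is still integrable. At
  distance at least 1 the denominator is at least 1. The total mass does not depend on
  \<open>x\<close>.\<close>

definition kernel_bound where "kernel_bound x y = C * (indicator (ball x 1) y * norm (x - y) powr (\<alpha> / 2 - real DIM('a))) + \<bar>u y\<bar>"

definition kernel_mass where "kernel_mass = C * (sphere_area DIM('a) / (\<alpha> / 2)) + u_mass"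

lemma kernel_mass_ge: "u_mass \<le> kernel_mass" "0 \<le> kernel_mass"
  using C_nonneg \<alpha>_pos u_mass_nonneg by (auto simp: kernel_mass_def less_imp_le)

lemma has_bochner_integral_kernel_bound: "has_bochner_integral lborel (kernel_bound x) kernel_mass"
  unfolding kernel_bound_def[abs_def] kernel_mass_def u_mass_def
  using \<alpha>_pos integrable_u
  by (intro has_bochner_integral_add has_bochner_integral_mult_right has_bochner_integral_norm_powr_ball has_bochner_integral_integrable) auto

lemma measurable_log_kernel [measurable]: "log_kernel s u x \<in> borel_measurable borel"
  unfolding log_kernel_def[abs_def] by measurable

lemma log_kernel_le_kernel_bound:
  assumes s: "0 \<le> s" "s \<le> \<alpha> / 4"
  shows "\<bar>log_kernel s u x y\<bar> \<le> kernel_bound x y"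
proof (cases "y \<in> ball x 1")
  case True
  show ?thesis
  proof (cases "x = y")
    case False
    define r where "r = norm (x - y)"
    have r: "0 < r" "r < 1" using False True by (auto simp: r_def dist_norm)
    have "\<bar>log_kernel s u x y\<bar> = \<bar>u x - u y\<bar> / r powr (real DIM('a) + 2 * s)"
      using True by (simp add: log_kernel_def r_def abs_divide)
    also have "\<dots> \<le> C * r powr \<alpha> / r powr (real DIM('a) + 2 * s)"
      unfolding r_def by (intro divide_right_mono Holder) auto
    also have "\<dots> = C * r powr (\<alpha> - (real DIM('a) + 2 * s))"
      unfolding powr_diff by simp
    also have "\<dots> \<le> C * r powr (\<alpha> / 2 - real DIM('a))"
      using r s C_nonneg by (intro mult_left_mono powr_mono') auto
    finally show ?thesis using True by (simp add: kernel_bound_def r_def)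
  qed (use C_nonneg in \<open>simp add: log_kernel_def kernel_bound_def\<close>)
next
  case False
  then have "norm (x - y) powr (real DIM('a) + 2 * s) \<ge> 1" using s by (intro ge_one_powr_ge_zero) (auto simp: dist_norm)
  then have "\<bar>u y\<bar> / norm (x - y) powr (real DIM('a) + 2 * s) \<le> \<bar>u y\<bar> / 1"
    by (intro divide_left_mono) auto
  then show ?thesis using False by (simp add: log_kernel_def kernel_bound_def abs_divide)
qed

text \<open>Inside the unit ball \<open>powr_neg_minus_one_bounds\<close> is used with
  \<open>\<delta> = \<alpha> / 4\<close>: the exponent left over is
  \<open>\<alpha> - \<alpha>/4 - 2s\<close>, which is at least \<open>\<alpha> / 2\<close> exactly
  when \<open>s \<le> \<alpha> / 8\<close>, and \<open>2 s / \<delta>\<close> is the term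
  \<open>8 s / \<alpha>\<close>. The summand 2 comes from the exterior of the ball.\<close>

lemma log_kernel_diff_le_kernel_bound:
  assumes s: "0 \<le> s" "s \<le> \<alpha> / 8"
  shows "\<bar>log_kernel s u x y - log_kernel 0 u x y\<bar> \<le> s * (8 / \<alpha> + 2) * kernel_bound x y"
proof (cases "x = y")
  case True
  then show ?thesis using C_nonneg s \<alpha>_pos by (simp add: log_kernel_def kernel_bound_def)
next
  case neq: False
  define r where "r = norm (x - y)"
  have r0: "r > 0" using neq by (simp add: r_def)
  have e: "log_kernel s u x y - log_kernel 0 u x y =
     (u x * indicator (ball x 1) y - u y) / r ^ DIM('a) * (r powr (- 2 * s) - 1)"
    using r0 unfolding log_kernel_def r_def[symmetric]
    by (simp add: powr_add powr_minus powr_realpow field_simps)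
  show ?thesis
  proof (cases "y \<in> ball x 1")
    case True
    have r: "0 < r" "r \<le> 1" using neq True by (auto simp: r_def dist_norm)
    note P = powr_neg_minus_one_bounds[OF r s(1), of "\<alpha> / 4"]
    have "\<bar>log_kernel s u x y - log_kernel 0 u x y\<bar> = \<bar>u x - u y\<bar> / r ^ DIM('a) * (r powr (- 2 * s) - 1)"
      unfolding e using True r P \<alpha>_pos by (simp add: abs_mult abs_divide)
    also have "\<dots> \<le> C * r powr \<alpha> / r ^ DIM('a) * (2 * s / (\<alpha> / 4) * r powr (- (\<alpha> / 4) - 2 * s))"
      using r P \<alpha>_pos Holder[of x y] unfolding r_def[symmetric]
      by (intro mult_mono divide_right_mono) (auto simp: C_nonneg)
    also have "\<dots> = s * (8 / \<alpha>) * (C * (r powr \<alpha> / r powr real DIM('a) * r powr (- (\<alpha> / 4) - 2 * s)))"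
      using r \<alpha>_pos by (simp add: powr_realpow mult_ac)
    also have "r powr \<alpha> / r powr real DIM('a) * r powr (- (\<alpha> / 4) - 2 * s) = r powr (\<alpha> - DIM('a) + (- (\<alpha> / 4) - 2 * s))"
      unfolding powr_add powr_diff by simp
    also have "s * (8 / \<alpha>) * (C * \<dots>) \<le> s * (8 / \<alpha>) * (C * r powr (\<alpha> / 2 - real DIM('a)))"
      using r s \<alpha>_pos C_nonneg by (intro mult_left_mono powr_mono') auto
    also have "\<dots> \<le> s * (8 / \<alpha> + 2) * kernel_bound x y"
      using True s \<alpha>_pos C_nonneg by (intro mult_mono) (auto simp: kernel_bound_def r_def)
    finally show ?thesis .
  next
    case False
    then have r: "r \<ge> 1" by (simp add: r_def dist_norm)
    note P = one_minus_powr_neg_bounds[OF r s(1)]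
    have "\<bar>log_kernel s u x y - log_kernel 0 u x y\<bar> = \<bar>u y\<bar> * ((1 - r powr (- 2 * s)) / r ^ DIM('a))"
      unfolding e using False r P by (simp add: abs_mult abs_divide abs_minus_commute)
    also have "(1 - r powr (- 2 * s)) / r ^ DIM('a) \<le> 2 * s * r / r ^ DIM('a)"
      using P r by (intro divide_right_mono) auto
    also have "\<dots> \<le> 2 * s * r / r ^ 1"
      using r s by (intro divide_left_mono power_increasing) (auto simp: Suc_leI)
    also have "\<dots> = 2 * s" using r by simp
    finally have "\<bar>log_kernel s u x y - log_kernel 0 u x y\<bar> \<le> \<bar>u y\<bar> * (2 * s)" by (simp add: mult_left_mono)
    also have "\<dots> = s * 2 * \<bar>u y\<bar>" by simp
    also have "\<dots> \<le> s * (8 / \<alpha> + 2) * kernel_bound x y"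
      using False s \<alpha>_pos C_nonneg by (intro mult_mono) (auto simp: kernel_bound_def r_def)
    finally show ?thesis .
  qed
qed

lemma integrable_log_kernel:
  assumes s: "0 \<le> s" "s \<le> \<alpha> / 4"
  shows "integrable lborel (log_kernel s u x)"
  by (rule Bochner_Integration.integrable_bound[of _ "kernel_bound x"])
     (use has_bochner_integral_kernel_bound[of x] log_kernel_le_kernel_bound[OF s, of x] in
       \<open>auto simp: has_bochner_integral_iff intro: order_trans[OF _ abs_ge_self]\<close>)

lemma abs_log_integral_le:
  assumes s: "0 \<le> s" "s \<le> \<alpha> / 4"
  shows "\<bar>log_integral s u x\<bar> \<le> kernel_mass"
proof -
  have "\<bar>log_integral s u x\<bar> \<le> (\<integral>y. \<bar>log_kernel s u x y\<bar> \<partial>lborel)"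
    unfolding log_integral_def by (rule integral_abs_bound)
  also have "\<dots> \<le> (\<integral>y. kernel_bound x y \<partial>lborel)"
    using has_bochner_integral_kernel_bound[of x] integrable_log_kernel[OF s] log_kernel_le_kernel_bound[OF s]
    by (intro integral_mono) (auto simp: has_bochner_integral_iff)
  also have "\<dots> = kernel_mass" using has_bochner_integral_kernel_bound[of x] by (simp add: has_bochner_integral_iff)
  finally show ?thesis .
qed

lemma abs_log_integral_diff_le:
  assumes s: "0 \<le> s" "s \<le> \<alpha> / 8"
  shows "\<bar>log_integral s u x - log_integral 0 u x\<bar> \<le> s * (8 / \<alpha> + 2) * kernel_mass"
proof -
  have s': "s \<le> \<alpha> / 4" using s \<alpha>_pos by simp
  have i: "integrable lborel (log_kernel s u x)" "integrable lborel (log_kernel 0 u x)"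
    using s s' \<alpha>_pos by (auto intro!: integrable_log_kernel)
  have "\<bar>log_integral s u x - log_integral 0 u x\<bar> = \<bar>\<integral>y. log_kernel s u x y - log_kernel 0 u x y \<partial>lborel\<bar>"
    unfolding log_integral_def using i by simp
  also have "\<dots> \<le> (\<integral>y. \<bar>log_kernel s u x y - log_kernel 0 u x y\<bar> \<partial>lborel)"
    by (rule integral_abs_bound)
  also have "\<dots> \<le> (\<integral>y. s * (8 / \<alpha> + 2) * kernel_bound x y \<partial>lborel)"
    using has_bochner_integral_kernel_bound[of x] i log_kernel_diff_le_kernel_bound[OF s]
    by (intro integral_mono) (auto simp: has_bochner_integral_iff)
  also have "\<dots> = s * (8 / \<alpha> + 2) * kernel_mass" using has_bochner_integral_kernel_bound[of x] by (simp add: has_bochner_integral_iff)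
  finally show ?thesis .
qed

text \<open>Trades the distance to the support for the weight \<open>1 + norm x\<close>. The factor
  \<open>R + 2\<close> is the one for which \<open>1 + norm x \<le> (R + 2) * (norm x - R)\<close>
  is an equality at \<open>norm x = R + 1\<close>.\<close>

lemma shifted_decay:
  assumes "norm x \<ge> R + 1"
  shows "(norm x - R) powr (- real DIM('a)) \<le> (R + 2) powr real DIM('a) * (1 + norm (x::'a)) powr (- real DIM('a))"
proof -
  have "(1 + norm x) \<le> (R + 2) * (norm x - R)"
  proof -
    have "0 \<le> (R + 1) * (norm x - R - 1)" using assms R_nonneg by simp
    then show ?thesis by (simp add: algebra_simps)
  qed
  then have "(1 + norm x) powr real DIM('a) \<le> ((R + 2) * (norm x - R)) powr real DIM('a)"
    by (intro powr_mono2) auto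
  also have "\<dots> = (R + 2) powr real DIM('a) * (norm x - R) powr real DIM('a)"
    using assms R_nonneg by (simp add: powr_mult)
  finally show ?thesis using assms R_nonneg
    unfolding powr_minus by (simp add: field_simps)
qed

text \<open>Away from the support \<open>u x = 0\<close>, and only points \<open>y\<close> of the
  support contribute, at distance at least \<open>norm x - R \<ge> 1\<close>; there the power
  \<open>- N - 2s\<close> is dominated by \<open>- N\<close>, uniformly in \<open>s\<close>.
  Elsewhere the weight is bounded below, and the uniform bound \<open>kernel_mass\<close> is
  enough.\<close>

lemma log_integral_decay:
  assumes s: "0 \<le> s" "s \<le> \<alpha> / 4"
  shows "\<bar>log_integral s u x\<bar> \<le> kernel_mass * (R + 2) powr real DIM('a) * (1 + norm x) powr (- real DIM('a))"
proof (cases "norm x \<ge> R + 1")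
  case True
  have k: "\<bar>log_kernel s u x y\<bar> \<le> (norm x - R) powr (- real DIM('a)) * \<bar>u y\<bar>" for y
  proof (cases "norm y < R")
    case y: True
    have r: "norm (x - y) \<ge> norm x - R" using norm_triangle_ineq2[of x y] y by simp
    then have r1: "norm (x - y) \<ge> 1" using True by simp
    have "\<bar>log_kernel s u x y\<bar> = norm (x - y) powr (- (real DIM('a) + 2 * s)) * \<bar>u y\<bar>"
      using True supp[of x] unfolding powr_minus by (simp add: log_kernel_def abs_divide abs_mult divide_inverse mult.commute)
    also have "norm (x - y) powr (- (real DIM('a) + 2 * s)) \<le> norm (x - y) powr (- real DIM('a))"
      using r1 s by (intro powr_mono) auto
    also have "\<dots> \<le> (norm x - R) powr (- real DIM('a))"
      using r True by (intro powr_mono2') auto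
    finally show ?thesis by (simp add: mult_right_mono)
  next
    case False
    then show ?thesis using supp[of x] supp[of y] True by (simp add: log_kernel_def)
  qed
  have "\<bar>log_integral s u x\<bar> \<le> (\<integral>y. \<bar>log_kernel s u x y\<bar> \<partial>lborel)"
    unfolding log_integral_def by (rule integral_abs_bound)
  also have "\<dots> \<le> (\<integral>y. (norm x - R) powr (- real DIM('a)) * \<bar>u y\<bar> \<partial>lborel)"
    using integrable_u integrable_log_kernel[OF s] k by (intro integral_mono) auto
  also have "\<dots> = (norm x - R) powr (- real DIM('a)) * u_mass" by (simp add: u_mass_def)
  also have "\<dots> \<le> (R + 2) powr real DIM('a) * (1 + norm x) powr (- real DIM('a)) * kernel_mass"
    using shifted_decay[OF True] kernel_mass_ge u_mass_nonneg by (intro mult_mono) auto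
  finally show ?thesis by (simp add: mult_ac)
next
  case False
  have "(1 + norm x) powr real DIM('a) \<le> (R + 2) powr real DIM('a)"
    using False by (intro powr_mono2) auto
  moreover have "1 + norm x > 0" by (simp add: add_pos_nonneg)
  ultimately have "1 \<le> (R + 2) powr real DIM('a) * (1 + norm x) powr (- real DIM('a))"
    unfolding powr_minus_divide by (simp add: le_divide_eq)
  then have "kernel_mass * 1 \<le> kernel_mass * ((R + 2) powr real DIM('a) * (1 + norm x) powr (- real DIM('a)))"
    using kernel_mass_ge by (intro mult_left_mono) auto
  then show ?thesis using abs_log_integral_le[OF s, of x] by (simp add: mult.assoc)
qed

text \<open>As \<open>2 s \<le> \<alpha> / 2\<close>, the singularity at \<open>x\<close> is
  absolutely integrable. So \<open>frac_kernel\<close> is the sum of two integrable functions,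
  \<open>log_kernel\<close> and \<open>u x\<close> times the exterior power, and the three claims
  follow from one integral.\<close>

lemma
  assumes s: "0 < s" "s \<le> \<alpha> / 4"
  shows frac_laplacian_exists: "frac_laplacian_exists s u x" (is ?E)
    and frac_laplacian_eq_integral: "frac_laplacian s u x = frac_const DIM('a) s * (\<integral>y. frac_kernel s u x y \<partial>lborel)" (is ?L)
    and frac_laplacian_eq: "frac_laplacian s u x = frac_const DIM('a) s * (log_integral s u x + u x * (sphere_area DIM('a) / (2 * s)))" (is ?F)
proof -
  have e: "frac_kernel s u x y = log_kernel s u x y + u x * (indicator (- ball x 1) y * norm (x - y) powr (- (2 * s) - real DIM('a)))" for y
  proof -
    have "norm (x - y) powr (- (2 * s) - real DIM('a)) = 1 / norm (x - y) powr (real DIM('a) + 2 * s)"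
      unfolding powr_minus_divide[symmetric] by (rule arg_cong[where f="\<lambda>e. _ powr e"]) simp
    then show ?thesis
      by (auto simp: frac_kernel_def log_kernel_def diff_divide_distrib split: split_indicator)
  qed
  have "has_bochner_integral lborel (log_kernel s u x) (log_integral s u x)"
    unfolding log_integral_def using integrable_log_kernel[of s x] s by (simp add: has_bochner_integral_integrable)
  moreover have "has_bochner_integral lborel (\<lambda>y. indicator (- ball x 1) y * norm (x - y) powr (- (2 * s) - real DIM('a))) (sphere_area DIM('a) / (2 * s))"
    using s by (intro has_bochner_integral_norm_powr_compl_ball) auto
  ultimately have hb: "has_bochner_integral lborel (frac_kernel s u x) (log_integral s u x + u x * (sphere_area DIM('a) / (2 * s)))"
    unfolding e[abs_def] by (intro has_bochner_integral_add has_bochner_integral_mult_right)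
  then have I: "integrable lborel (frac_kernel s u x)" by (simp add: has_bochner_integral_iff)
  note L = tendsto_set_integral_compl_ball[OF I, of x]
  have "set_integrable lborel (- ball x \<epsilon>) (frac_kernel s u x)" for \<epsilon>
    unfolding set_integrable_def by (rule integrable_mult_indicator[OF _ I]) simp
  then show ?E using L by (auto simp: frac_laplacian_exists_def)
  show ?L using tendsto_Lim[OF trivial_limit_at_right_real L] s by (simp add: frac_laplacian_def)
  then show ?F using hb by (simp add: has_bochner_integral_iff)
qed

end

section \<open>The derivative at order zero\<close>

text \<open>The quotient \<open>c\<^sub>N\<^sub>,\<^sub>s / s\<close>, written without a division so
  that it has the right value and a derivative at \<open>s = 0\<close>.\<close>

definition frac_const_slope :: "nat \<Rightarrow> real \<Rightarrow> real" where
  "frac_const_slope n s = 2 powr (2 * s) * pi powr (- (real n / 2)) * (Gamma ((real n + 2 * s) / 2) / Gamma (1 - s))"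

lemma frac_const_eq: "frac_const n s = s * frac_const_slope n s"
  by (simp add: frac_const_def frac_const_slope_def)

lemma frac_const_slope_0: "frac_const_slope n 0 = log_const n"
  by (simp add: frac_const_slope_def log_const_def)

text \<open>The three parts of \<open>rho_const\<close> are logarithmic derivatives at 0:
  \<open>2 ln 2\<close> of \<open>2^(2s)\<close>, the Digamma value of
  \<open>Gamma ((n + 2s) / 2)\<close>, and \<open>- euler_mascheroni\<close> of
  \<open>1 / Gamma (1 - s)\<close>, since the derivative of Gamma at 1 is
  \<open>- euler_mascheroni\<close>.\<close>

lemma frac_const_slope_deriv:
  assumes "n > 0"
  shows "(frac_const_slope n has_real_derivative log_const n * rho_const n) (at 0)"
proof -
  have 1: "((\<lambda>s. Gamma ((real n + 2 * s) / 2)) has_real_derivative Gamma (real n / 2) * Digamma (real n / 2)) (at 0)"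
    using assms by (auto intro!: derivative_eq_intros elim!: nonpos_Ints_cases)
  have 2: "((\<lambda>s. Gamma (1 - s)) has_real_derivative euler_mascheroni) (at (0::real))"
    by (auto intro!: derivative_eq_intros elim!: nonpos_Ints_cases)
  have 3: "((\<lambda>s::real. 2 powr (2 * s)) has_real_derivative 2 * ln 2) (at 0)"
    by (auto intro!: derivative_eq_intros)
  have "((\<lambda>s. 2 powr (2 * s) * pi powr (- (real n / 2)) * (Gamma ((real n + 2 * s) / 2) / Gamma (1 - s)))
     has_real_derivative log_const n * rho_const n) (at 0)"
    using DERIV_mult[OF DERIV_cmult_right[OF 3, of "pi powr (- (real n / 2))"] DERIV_divide[OF 1 2]]
    by (simp add: log_const_def rho_const_def algebra_simps)
  then show ?thesis by (simp add: frac_const_slope_def[abs_def])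
qed

section \<open>Decay at infinity and convergence in \<open>L^p\<close>\<close>

lemma integrable_one_plus_norm_powr:
  assumes a: "(a::real) > DIM('a)"
  shows "integrable lborel (\<lambda>x::'a::euclidean_space. (1 + norm x) powr (- a))"
proof (rule Bochner_Integration.integrable_bound)
  have "integrable lborel (\<lambda>y::'a. indicator (- ball 0 1) y * norm (0 - y) powr (- (a - DIM('a)) - DIM('a)))"
    using has_bochner_integral_norm_powr_compl_ball[of "a - DIM('a)" "0::'a"] a
    by (simp add: has_bochner_integral_iff)
  moreover have "integrable lborel (indicator (ball 0 1) :: 'a \<Rightarrow> real)"
    using emeasure_lborel_ball_finite[of "0::'a" 1] by (intro integrable_real_indicator) auto
  ultimately show "integrable lborel (\<lambda>y::'a. indicator (ball 0 1) y + indicator (- ball 0 1) y * norm y powr (- a))"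
    by simp
  have "(1 + norm x) powr (- a) \<le> indicator (ball 0 1) x + indicator (- ball 0 1) x * norm x powr (- a)" for x :: 'a
  proof (cases "norm x < 1")
    case True
    have "(1 + norm x) powr (- a) \<le> 1 powr (- a)" using a by (intro powr_mono2') auto
    then show ?thesis using True by simp
  next
    case False
    then have "(1 + norm x) powr (- a) \<le> norm x powr (- a)" using a by (intro powr_mono2') auto
    then show ?thesis using False by simp
  qed
  then show "AE x::'a in lborel. norm ((1 + norm x) powr (- a)) \<le> norm (indicator (ball 0 1) x + indicator (- ball 0 1) x * norm x powr (- a))"
    by (auto intro: order_trans[OF _ abs_ge_self])
qed measurable

text \<open>The exponent is critical: every power of \<open>decay\<close> above the first is
  integrable, \<open>decay\<close> itself is not.\<close>

definition decay :: "'a::euclidean_space \<Rightarrow> real" where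
  "decay x = (1 + norm x) powr (- real DIM('a))"

lemma decay_bounds: "0 \<le> decay x" "decay x \<le> 1"
proof -
  have "(1 + norm x) powr (- real DIM('a)) \<le> 1 powr (- real DIM('a))" by (intro powr_mono2') auto
  then show "0 \<le> decay x" "decay x \<le> 1" by (auto simp: decay_def)
qed

lemma measurable_decay [measurable]: "decay \<in> borel_measurable borel"
  unfolding decay_def[abs_def] by measurable

lemma integrable_decay_powr:
  assumes "(q::real) > 1"
  shows "integrable lborel (\<lambda>x::'a::euclidean_space. decay x powr q)"
proof -
  have "decay x powr q = (1 + norm x) powr (- (q * DIM('a)))" for x :: 'a
    by (simp add: decay_def powr_powr mult.commute)
  then show ?thesis using assms
    by (simp only:) (intro integrable_one_plus_norm_powr, simp)
qed

lemma enn2real_gt_1: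
  assumes "1 < p" "p \<noteq> (\<infinity>::ennreal)"
  shows "enn2real p > 1"
  using assms by (cases p) (auto simp: one_less_ennreal)

lemma decay_imp_Lp_space:
  fixes f :: "'a::euclidean_space \<Rightarrow> 'b::{banach,second_countable_topology}"
  assumes p: "1 < p" and [measurable]: "f \<in> borel_measurable lborel" and f: "\<And>x. norm (f x) \<le> K * decay x"
  shows "f \<in> Lp_space p"
proof (cases "p = \<infinity>")
  case True
  have "K \<ge> 0"
  proof (rule ccontr)
    assume "\<not> 0 \<le> K"
    then have "K * decay (0::'a) < 0" by (simp add: decay_def)
    then show False using f[of 0] norm_ge_zero[of "f 0"] by linarith
  qed
  then have "norm (f x) \<le> K" for x
    using f[of x] mult_left_mono[OF decay_bounds(2)[of x], of K] by simp
  then show ?thesis using True by (auto simp: Lp_space_def)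
next
  case False
  note q = enn2real_gt_1[OF p False]
  have "integrable lborel (\<lambda>x. norm (f x) powr enn2real p)"
  proof (rule Bochner_Integration.integrable_bound)
    show "integrable lborel (\<lambda>x::'a. \<bar>K\<bar> powr enn2real p * decay x powr enn2real p)"
      using integrable_decay_powr[where 'a='a, OF q] by simp
    have "norm (f x) powr enn2real p \<le> (\<bar>K\<bar> * decay x) powr enn2real p" for x
    proof (rule powr_mono2)
      have "K * decay x \<le> \<bar>K\<bar> * decay x" using decay_bounds by (intro mult_right_mono) auto
      then show "norm (f x) \<le> \<bar>K\<bar> * decay x" using f[of x] by linarith
    qed (use q in auto)
    then show "AE x in lborel. norm (norm (f x) powr enn2real p) \<le> norm (\<bar>K\<bar> powr enn2real p * decay x powr enn2real p)"
      using decay_bounds by (auto simp: powr_mult)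
  qed measurable
  then show ?thesis using False by (simp add: Lp_space_def)
qed

text \<open>Split \<open>|f|^q\<close> as \<open>|f|^((q-1)/2) * |f|^((q+1)/2)\<close>. The first
  factor is estimated by the uniform bound and carries the smallness; the second by the weight, with
  \<open>(q + 1) / 2\<close>, the midpoint of 1 and \<open>q\<close>, still above 1 and so
  integrable.\<close>

lemma Lp_norm_le_interpolation:
  fixes f :: "'a::euclidean_space \<Rightarrow> 'b::{banach,second_countable_topology}"
  assumes p: "1 < p" "p \<noteq> \<infinity>" and [measurable]: "f \<in> borel_measurable lborel"
    and f: "\<And>x. norm (f x) \<le> K * decay x" "\<And>x. norm (f x) \<le> \<eta>" and K: "K \<ge> 0"
  defines "q \<equiv> enn2real p"
  shows "Lp_norm p f \<le> (\<eta> powr ((q - 1) / 2) * (K powr ((q + 1) / 2) * (\<integral>(x::'a). decay x powr ((q + 1) / 2) \<partial>lborel))) powr (1 / q)"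
proof -
  have q: "q > 1" unfolding q_def by (rule enn2real_gt_1[OF p])
  have \<eta>: "\<eta> \<ge> 0" using f(2)[of 0] norm_ge_zero order_trans by blast
  have "norm (f x) powr q \<le> \<eta> powr ((q - 1) / 2) * (K powr ((q + 1) / 2) * decay x powr ((q + 1) / 2))" for x
  proof -
    have "norm (f x) powr q = norm (f x) powr ((q - 1) / 2) * norm (f x) powr ((q + 1) / 2)"
      by (simp add: powr_add[symmetric] add_divide_distrib[symmetric])
    also have "\<dots> \<le> \<eta> powr ((q - 1) / 2) * (K * decay x) powr ((q + 1) / 2)"
      using q f[of x] by (intro mult_mono powr_mono2) auto
    also have "(K * decay x) powr ((q + 1) / 2) = K powr ((q + 1) / 2) * decay x powr ((q + 1) / 2)"
      using K decay_bounds by (simp add: powr_mult)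
    finally show ?thesis .
  qed
  moreover have "integrable lborel (\<lambda>x. norm (f x) powr q)"
    using decay_imp_Lp_space[OF p(1) _ f(1)] p by (auto simp: Lp_space_def q_def)
  moreover have "integrable lborel (\<lambda>x::'a. decay x powr ((q + 1) / 2))"
    using q by (intro integrable_decay_powr) simp
  ultimately have "(\<integral>x. norm (f x) powr q \<partial>lborel) \<le> (\<integral>(x::'a). \<eta> powr ((q - 1) / 2) * (K powr ((q + 1) / 2) * decay x powr ((q + 1) / 2)) \<partial>lborel)"
    by (intro integral_mono) auto
  then have "(\<integral>x. norm (f x) powr q \<partial>lborel) \<le> \<eta> powr ((q - 1) / 2) * (K powr ((q + 1) / 2) * (\<integral>(x::'a). decay x powr ((q + 1) / 2) \<partial>lborel))"
    by simp
  then show ?thesis using p q unfolding Lp_norm_def q_def[symmetric]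
    by (auto intro!: powr_mono2 integral_nonneg_AE)
qed

text \<open>The extended real essential supremum is caught between 0 and \<eta>, so
  \<open>real_of_ereal\<close> does not hit its default value at infinity. The lower bound relies on
  Lebesgue measure being nonzero.\<close>

lemma Lp_norm_infinity_bounds:
  fixes f :: "'a::euclidean_space \<Rightarrow> 'b::{banach,second_countable_topology}"
  assumes [measurable]: "f \<in> borel_measurable lborel" and f: "\<And>x. norm (f x) \<le> \<eta>"
  shows "0 \<le> Lp_norm \<infinity> f" "Lp_norm \<infinity> f \<le> \<eta>"
proof -
  have nz: "emeasure (lborel :: 'a measure) (space lborel) \<noteq> 0"
    by (simp add: emeasure_lborel_UNIV)
  let ?e = "esssup lborel (\<lambda>x. ereal (norm (f x)))"
  have "?e \<le> ereal \<eta>" using f by (intro esssup_I) auto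
  moreover have "0 \<le> ?e"
  proof -
    have "esssup (lborel :: 'a measure) (\<lambda>x. 0::ereal) \<le> ?e" by (intro esssup_mono) auto
    then show ?thesis using esssup_const[OF nz, of "0::ereal"] by simp
  qed
  ultimately show "0 \<le> Lp_norm \<infinity> f" "Lp_norm \<infinity> f \<le> \<eta>"
    unfolding Lp_norm_def by (cases ?e; simp)+
qed

lemma tendsto_zero_sandwich:
  fixes f g :: "'i \<Rightarrow> real"
  assumes fg: "\<forall>\<^sub>F s in F. 0 \<le> f s \<and> f s \<le> g s" and g: "(g \<longlongrightarrow> 0) F"
  shows "(f \<longlongrightarrow> 0) F"
proof (rule tendsto_sandwich[OF _ _ tendsto_const g])
  show "\<forall>\<^sub>F s in F. 0 \<le> f s" using fg by (rule eventually_mono) simp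
  show "\<forall>\<^sub>F s in F. f s \<le> g s" using fg by (rule eventually_mono) simp
qed

lemma tendsto_Lp_if_uniform_and_decay:
  fixes H :: "'i \<Rightarrow> 'a::euclidean_space \<Rightarrow> real"
  assumes p: "1 < p" and [measurable]: "L \<in> borel_measurable lborel" and L: "\<And>x. \<bar>L x\<bar> \<le> K * decay x"
    and H: "\<forall>\<^sub>F s in F. H s \<in> borel_measurable lborel"
    and u: "\<forall>\<^sub>F s in F. \<forall>x. \<bar>H s x - L x\<bar> \<le> \<eta> s" and \<eta>: "(\<eta> \<longlongrightarrow> 0) F"
    and d: "\<forall>\<^sub>F s in F. \<forall>x. \<bar>H s x - L x\<bar> \<le> K' * decay x" and K': "K' \<ge> 0"
  shows "tendsto_Lp p H L F"
  unfolding tendsto_Lp_def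
proof (intro conjI)
  show "L \<in> Lp_space p" using L by (intro decay_imp_Lp_space[OF p, of _ K]) auto
  show "\<forall>\<^sub>F s in F. H s \<in> Lp_space p"
    using H d
  proof eventually_elim
    case (elim s)
    have "\<bar>H s x\<bar> \<le> (K + K') * decay x" for x
      using spec[OF elim(2), of x] L[of x] unfolding distrib_right by linarith
    then show ?case using elim by (intro decay_imp_Lp_space[OF p, of _ "K + K'"]) auto
  qed
  show "((\<lambda>s. Lp_norm p (\<lambda>x. H s x - L x)) \<longlongrightarrow> 0) F"
  proof (cases "p = \<infinity>")
    case True
    have "\<forall>\<^sub>F s in F. 0 \<le> Lp_norm p (\<lambda>x. H s x - L x) \<and> Lp_norm p (\<lambda>x. H s x - L x) \<le> \<eta> s"
      using H u
    proof eventually_elim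
      case (elim s)
      have "(\<lambda>x. H s x - L x) \<in> borel_measurable lborel" using elim by measurable
      then show ?case using Lp_norm_infinity_bounds[of "\<lambda>x. H s x - L x" "\<eta> s"] elim True by simp
    qed
    then show ?thesis using \<eta> by (rule tendsto_zero_sandwich)
  next
    case False
    define q where "q = enn2real p"
    have q: "q > 1" unfolding q_def by (rule enn2real_gt_1[OF p False])
    let ?B = "\<lambda>s. (\<eta> s powr ((q - 1) / 2) * (K' powr ((q + 1) / 2) * (\<integral>(x::'a). decay x powr ((q + 1) / 2) \<partial>lborel))) powr (1 / q)"
    have "\<forall>\<^sub>F s in F. 0 \<le> Lp_norm p (\<lambda>x. H s x - L x) \<and> Lp_norm p (\<lambda>x. H s x - L x) \<le> ?B s"
      using H u d
    proof eventually_elim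
      case (elim s)
      have "(\<lambda>x. H s x - L x) \<in> borel_measurable lborel" using elim by measurable
      then have "Lp_norm p (\<lambda>x. H s x - L x) \<le> ?B s"
        unfolding q_def using elim K' by (intro Lp_norm_le_interpolation[OF p False]) auto
      then show ?case using False by (simp add: Lp_norm_def)
    qed
    moreover have "(?B \<longlongrightarrow> 0) F"
    proof -
      \<comment> \<open>As \<eta> bounds an absolute value it is eventually nonnegative, which is
        what continuity of \<open>powr\<close> at base 0 requires.\<close>
      have \<eta>0: "\<forall>\<^sub>F s in F. 0 \<le> \<eta> s" using u
        by eventually_elim (meson abs_ge_zero order_trans)
      have "((\<lambda>s. \<eta> s powr ((q - 1) / 2)) \<longlongrightarrow> 0 powr ((q - 1) / 2)) F"
        using q \<eta>0 by (intro tendsto_powr'[OF \<eta> tendsto_const]) auto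
      then have "((\<lambda>s. \<eta> s powr ((q - 1) / 2) * (K' powr ((q + 1) / 2) * (\<integral>(x::'a). decay x powr ((q + 1) / 2) \<partial>lborel))) \<longlongrightarrow> 0) F"
        by (intro tendsto_mult_left_zero) simp
      then have "(?B \<longlongrightarrow> 0 powr (1 / q)) F"
        using q by (intro tendsto_powr'[OF _ tendsto_const]) (auto intro!: always_eventually mult_nonneg_nonneg integral_nonneg_AE)
      then show ?thesis by simp
    qed
    ultimately show ?thesis by (rule tendsto_zero_sandwich)
  qed
qed

lemma borel_measurable_log_integral [measurable]:
  fixes u :: "'a::euclidean_space \<Rightarrow> real"
  assumes [measurable]: "u \<in> borel_measurable borel"
  shows "log_integral s u \<in> borel_measurable borel"
proof -
  \<comment> \<open>The centre of the ball varies, so its indicator is rewritten as a condition on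
    the pair, which exhibits joint measurability.\<close>
  have e: "(\<lambda>(x, y). log_kernel s u x y) = (\<lambda>(x, y). (u x * (if dist x y < 1 then 1 else 0) - u y) / norm (x - y) powr (real DIM('a) + 2 * s))"
    by (auto simp: log_kernel_def fun_eq_iff)
  have "(\<lambda>(x, y). log_kernel s u x y) \<in> borel_measurable (borel \<Otimes>\<^sub>M lborel)"
    unfolding e by measurable
  then show ?thesis unfolding log_integral_def[abs_def]
    by (rule lborel.borel_measurable_lebesgue_integral)
qed

section \<open>The limit of the difference quotients\<close>

context compact_Holder
begin

text \<open>The explicit candidate for the limit; it is identified with
  \<open>log_laplacian\<close>, defined by \<open>Lim\<close>, once convergence is known.\<close>

definition \<Lambda> where "\<Lambda> x = log_const DIM('a) * log_integral 0 u x + rho_const DIM('a) * u x"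

lemma measurable_\<Lambda> [measurable]: "\<Lambda> \<in> borel_measurable borel"
  unfolding \<Lambda>_def[abs_def] by measurable

text \<open>The coefficient of \<open>u x\<close> in the quotient of order \<open>s\<close>. Because
  \<open>frac_const_slope * |S| / 2\<close> equals 1 at \<open>s = 0\<close>, this is its difference
  quotient there, and the limit is \<open>rho_const\<close>.\<close>

definition \<kappa> where "\<kappa> s = (frac_const_slope DIM('a) s * (sphere_area DIM('a) / 2) - 1) / s"

lemma quotient_eq:
  assumes s: "0 < s" "s \<le> \<alpha> / 4"
  shows "(frac_laplacian s u x - u x) / s = frac_const_slope DIM('a) s * log_integral s u x + u x * \<kappa> s"
  using s unfolding frac_laplacian_eq[OF s] frac_const_eq \<kappa>_def by (simp add: field_simps)

lemma tendsto_frac_const_slope: "(frac_const_slope DIM('a) \<longlongrightarrow> log_const DIM('a)) (at_right 0)"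
  using DERIV_isCont[OF frac_const_slope_deriv[of "DIM('a)"]]
  by (auto simp: isCont_def frac_const_slope_0 intro: filterlim_mono[OF _ order_refl at_le])

lemma tendsto_\<kappa>: "(\<kappa> \<longlongrightarrow> rho_const DIM('a)) (at_right 0)"
proof -
  let ?\<sigma> = "sphere_area DIM('a)"
  have 1: "log_const DIM('a) * (?\<sigma> / 2) = 1"
    using sphere_area_DIM_pos[where 'a='a] by (simp add: log_const_eq_sphere_area del: sphere_area_DIM_pos)
  have "((\<lambda>s. (frac_const_slope DIM('a) s - frac_const_slope DIM('a) 0) / (s - 0)) \<longlongrightarrow> log_const DIM('a) * rho_const DIM('a)) (at 0)"
    using frac_const_slope_deriv[of "DIM('a)"] by (simp add: has_field_derivative_iff)
  then have "((\<lambda>s. (frac_const_slope DIM('a) s - frac_const_slope DIM('a) 0) / (s - 0) * (?\<sigma> / 2)) \<longlongrightarrow> log_const DIM('a) * rho_const DIM('a) * (?\<sigma> / 2)) (at 0)"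
    by (intro tendsto_mult_right)
  moreover have "log_const DIM('a) * rho_const DIM('a) * (?\<sigma> / 2) = rho_const DIM('a)"
    using 1 by (simp add: mult.assoc mult.left_commute)
  moreover have "(frac_const_slope DIM('a) s - frac_const_slope DIM('a) 0) / (s - 0) * (?\<sigma> / 2) = \<kappa> s" for s
  proof -
    have "(frac_const_slope DIM('a) s - frac_const_slope DIM('a) 0) / (s - 0) * (?\<sigma> / 2)
       = (frac_const_slope DIM('a) s * (?\<sigma> / 2) - log_const DIM('a) * (?\<sigma> / 2)) / s"
      unfolding frac_const_slope_0 by (simp add: diff_divide_distrib left_diff_distrib)
    then show ?thesis by (simp only: 1 \<kappa>_def)
  qed
  ultimately have "(\<kappa> \<longlongrightarrow> rho_const DIM('a)) (at 0)" by (simp only:)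
  then show ?thesis by (rule filterlim_mono) (auto intro: at_le)
qed

definition decay_mass where "decay_mass = kernel_mass * (R + 2) powr real DIM('a)"

lemma decay_mass_nonneg: "decay_mass \<ge> 0" using kernel_mass_ge by (simp add: decay_mass_def)

lemma abs_u_le_decay: "\<bar>u x\<bar> \<le> u_bound * (R + 1) powr real DIM('a) * decay x"
proof (cases "norm x < R")
  case True
  have "(1 + norm x) powr real DIM('a) \<le> (R + 1) powr real DIM('a)" using True by (intro powr_mono2) auto
  moreover have "1 + norm x > 0" by (simp add: add_pos_nonneg)
  ultimately have "1 \<le> (R + 1) powr real DIM('a) * decay x"
    unfolding decay_def powr_minus_divide by (simp add: le_divide_eq)
  then have "u_bound * 1 \<le> u_bound * ((R + 1) powr real DIM('a) * decay x)" using u_bound_nonneg by (intro mult_left_mono)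
  then show ?thesis using abs_u_le[of x] True by simp
qed (use supp u_bound_nonneg decay_bounds in \<open>auto intro!: mult_nonneg_nonneg\<close>)

lemma abs_log_integral_le_decay: "0 \<le> s \<Longrightarrow> s \<le> \<alpha> / 4 \<Longrightarrow> \<bar>log_integral s u x\<bar> \<le> decay_mass * decay x"
  using log_integral_decay[of s x] by (simp add: decay_mass_def decay_def)

lemma abs_\<Lambda>_le: "\<bar>\<Lambda> x\<bar> \<le> (\<bar>log_const DIM('a)\<bar> * decay_mass + \<bar>rho_const DIM('a)\<bar> * (u_bound * (R + 1) powr real DIM('a))) * decay x"
proof -
  have "\<bar>\<Lambda> x\<bar> \<le> \<bar>log_const DIM('a)\<bar> * \<bar>log_integral 0 u x\<bar> + \<bar>rho_const DIM('a)\<bar> * \<bar>u x\<bar>"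
    unfolding \<Lambda>_def abs_mult[symmetric] by (rule abs_triangle_ineq)
  also have "\<dots> \<le> \<bar>log_const DIM('a)\<bar> * (decay_mass * decay x) + \<bar>rho_const DIM('a)\<bar> * (u_bound * (R + 1) powr real DIM('a) * decay x)"
    using abs_log_integral_le_decay[of 0 x] abs_u_le_decay[of x] \<alpha>_pos
    by (intro add_mono mult_left_mono) auto
  finally show ?thesis by (simp add: algebra_simps)
qed

text \<open>A telescoping sum with one error per replaced ingredient: the integral, its prefactor,
  and the coefficient of \<open>u x\<close>. The uniform and the weighted estimates both start from
  it.\<close>

lemma quotient_diff_le:
  assumes s: "0 < s" "s \<le> \<alpha> / 4"
  shows "\<bar>(frac_laplacian s u x - u x) / s - \<Lambda> x\<bar> \<le>
    \<bar>frac_const_slope DIM('a) s\<bar> * \<bar>log_integral s u x - log_integral 0 u x\<bar>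
    + \<bar>frac_const_slope DIM('a) s - log_const DIM('a)\<bar> * \<bar>log_integral 0 u x\<bar>
    + \<bar>\<kappa> s - rho_const DIM('a)\<bar> * \<bar>u x\<bar>"
proof -
  have "(frac_laplacian s u x - u x) / s - \<Lambda> x =
     frac_const_slope DIM('a) s * (log_integral s u x - log_integral 0 u x)
    + (frac_const_slope DIM('a) s - log_const DIM('a)) * log_integral 0 u x
    + (\<kappa> s - rho_const DIM('a)) * u x"
    unfolding quotient_eq[OF s] \<Lambda>_def by (simp add: algebra_simps)
  then show ?thesis unfolding abs_mult[symmetric] by linarith
qed

definition \<eta> where "\<eta> s = \<bar>frac_const_slope DIM('a) s\<bar> * (s * (8 / \<alpha> + 2) * kernel_mass)
    + \<bar>frac_const_slope DIM('a) s - log_const DIM('a)\<bar> * kernel_mass + \<bar>\<kappa> s - rho_const DIM('a)\<bar> * u_bound"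

lemma tendsto_\<eta>: "(\<eta> \<longlongrightarrow> 0) (at_right 0)"
  unfolding \<eta>_def[abs_def]
  by (rule tendsto_eq_intros tendsto_frac_const_slope tendsto_\<kappa> refl)+ simp

lemma eventually_small: "c > 0 \<Longrightarrow> \<forall>\<^sub>F s::real in at_right 0. 0 < s \<and> s \<le> c"
  by (auto simp: eventually_at_right_field intro!: exI[of _ c])

lemma quotient_uniform: "\<forall>\<^sub>F s in at_right 0. \<forall>x. \<bar>(frac_laplacian s u x - u x) / s - \<Lambda> x\<bar> \<le> \<eta> s"
proof -
  have "\<forall>\<^sub>F s in at_right 0. 0 < s \<and> s \<le> \<alpha> / 8" using \<alpha>_pos by (intro eventually_small) auto
  then show ?thesis
  proof eventually_elim
    case (elim s)
    show ?case
    proof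
      fix x
      have "\<bar>u x\<bar> \<le> u_bound" using abs_u_le[of x] u_bound_nonneg by (auto split: split_indicator_asm)
      then show "\<bar>(frac_laplacian s u x - u x) / s - \<Lambda> x\<bar> \<le> \<eta> s"
        unfolding \<eta>_def using elim abs_log_integral_le[of 0 x] abs_log_integral_diff_le[of s x] \<alpha>_pos
        by (intro order_trans[OF quotient_diff_le] add_mono mult_left_mono) auto
    qed
  qed
qed

text \<open>No smallness is sought here: the two integrals are estimated separately, which gives
  \<open>2 * decay_mass\<close>. The total coefficient of \<open>decay x\<close> converges to
  \<open>|c\<^sub>N| * (2 * decay_mass)\<close>, so adding 1 makes it an eventual upper
  bound.\<close>

lemma quotient_decay:
  "\<forall>\<^sub>F s in at_right 0. \<forall>x. \<bar>(frac_laplacian s u x - u x) / s - \<Lambda> x\<bar> \<le> (\<bar>log_const DIM('a)\<bar> * (2 * decay_mass) + 1) * decay x"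
proof -
  let ?Z = "\<lambda>s. \<bar>frac_const_slope DIM('a) s\<bar> * (2 * decay_mass) + \<bar>frac_const_slope DIM('a) s - log_const DIM('a)\<bar> * decay_mass
       + \<bar>\<kappa> s - rho_const DIM('a)\<bar> * (u_bound * (R + 1) powr real DIM('a))"
  have Z: "(?Z \<longlongrightarrow> \<bar>log_const DIM('a)\<bar> * (2 * decay_mass)) (at_right 0)"
    by (rule tendsto_eq_intros tendsto_frac_const_slope tendsto_\<kappa> refl)+ simp
  have "\<forall>\<^sub>F s in at_right 0. ?Z s < \<bar>log_const DIM('a)\<bar> * (2 * decay_mass) + 1"
    by (rule order_tendstoD(2)[OF Z]) simp
  moreover have "\<forall>\<^sub>F s in at_right 0. 0 < s \<and> s \<le> \<alpha> / 4" using \<alpha>_pos by (intro eventually_small) auto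
  ultimately show ?thesis
  proof eventually_elim
    case (elim s)
    show ?case
    proof
      fix x
      have "\<bar>log_integral s u x - log_integral 0 u x\<bar> \<le> 2 * decay_mass * decay x"
        using abs_log_integral_le_decay[of s x] abs_log_integral_le_decay[of 0 x] elim \<alpha>_pos by simp
      then have "\<bar>(frac_laplacian s u x - u x) / s - \<Lambda> x\<bar> \<le>
         \<bar>frac_const_slope DIM('a) s\<bar> * (2 * decay_mass * decay x)
        + \<bar>frac_const_slope DIM('a) s - log_const DIM('a)\<bar> * (decay_mass * decay x)
        + \<bar>\<kappa> s - rho_const DIM('a)\<bar> * (u_bound * (R + 1) powr real DIM('a) * decay x)"
        using elim abs_log_integral_le_decay[of 0 x] abs_u_le_decay[of x] \<alpha>_pos
        by (intro order_trans[OF quotient_diff_le] add_mono mult_left_mono) auto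
      also have "\<dots> = ?Z s * decay x" by (simp add: algebra_simps)
      also have "\<dots> \<le> (\<bar>log_const DIM('a)\<bar> * (2 * decay_mass) + 1) * decay x"
        using elim decay_bounds by (intro mult_right_mono) auto
      finally show "\<bar>(frac_laplacian s u x - u x) / s - \<Lambda> x\<bar> \<le> \<dots>" .
    qed
  qed
qed

lemma tendsto_quotient: "((\<lambda>s. (frac_laplacian s u x - u x) / s) \<longlongrightarrow> \<Lambda> x) (at_right 0)"
proof -
  have "((\<lambda>s. (frac_laplacian s u x - u x) / s - \<Lambda> x) \<longlongrightarrow> 0) (at_right 0)"
    by (rule Lim_null_comparison[OF _ tendsto_\<eta>]) (use quotient_uniform in \<open>auto elim: eventually_mono\<close>)
  then show ?thesis by (simp add: LIM_zero_iff)
qed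

lemma log_laplacian_eq: "log_laplacian u x = \<Lambda> x"
  unfolding log_laplacian_def by (rule tendsto_Lim[OF trivial_limit_at_right_real tendsto_quotient])

lemma has_real_derivative_frac_laplacian: "((\<lambda>s. frac_laplacian s u x) has_real_derivative log_laplacian u x) (at_right 0)"
  using tendsto_quotient[of x] unfolding has_field_derivative_iff log_laplacian_eq by (simp add: frac_laplacian_def)

lemma measurable_frac_laplacian:
  assumes s: "0 < s" "s \<le> \<alpha> / 4"
  shows "frac_laplacian s u \<in> borel_measurable borel"
  unfolding frac_laplacian_eq[OF s, abs_def] by measurable

lemma tendsto_Lp_quotient:
  assumes p: "1 < p"
  shows "tendsto_Lp p (\<lambda>s x. (frac_laplacian s u x - u x) / s) \<Lambda> (at_right 0)"
proof (rule tendsto_Lp_if_uniform_and_decay[OF p _ abs_\<Lambda>_le _ quotient_uniform tendsto_\<eta> quotient_decay])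
  have "\<forall>\<^sub>F s in at_right 0. 0 < s \<and> s \<le> \<alpha> / 4" using \<alpha>_pos by (intro eventually_small) auto
  then show "\<forall>\<^sub>F s in at_right 0. (\<lambda>x. (frac_laplacian s u x - u x) / s) \<in> borel_measurable lborel"
  proof eventually_elim
    case (elim s)
    then have [measurable]: "frac_laplacian s u \<in> borel_measurable borel" by (intro measurable_frac_laplacian) auto
    show ?case by measurable
  qed
qed (use decay_mass_nonneg in auto)

lemma log_laplacian_formulas:
  shows "integrable lborel (\<lambda>y. (u x * indicator (ball x 1) y - u y) / norm (x - y) ^ DIM('a))" (is ?A)
    and "log_laplacian u x =
            log_const DIM('a) *
              (LINT y|lborel. (u x * indicator (ball x 1) y - u y) / norm (x - y) ^ DIM('a))
            + rho_const DIM('a) * u x" (is ?B)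
    and "set_integrable lborel (ball x 1) (\<lambda>y. (u x - u y) / norm (x - y) ^ DIM('a))" (is ?C)
    and "set_integrable lborel (- ball x 1) (\<lambda>y. u y / norm (x - y) ^ DIM('a))" (is ?D)
    and "log_laplacian u x =
            log_const DIM('a) * (LINT y:ball x 1|lborel. (u x - u y) / norm (x - y) ^ DIM('a))
            - log_const DIM('a) * (LINT y:- ball x 1|lborel. u y / norm (x - y) ^ DIM('a))
            + rho_const DIM('a) * u x" (is ?E)
proof -
  let ?k = "\<lambda>y. (u x * indicator (ball x 1) y - u y) / norm (x - y) ^ DIM('a)"
  show A: ?A using integrable_log_kernel[of 0 x] \<alpha>_pos by (simp add: log_kernel_0[abs_def])
  show B: ?B unfolding log_laplacian_eq \<Lambda>_def log_integral_def log_kernel_0 ..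
  have i: "(\<lambda>y. indicator (ball x 1) y *\<^sub>R ((u x - u y) / norm (x - y) ^ DIM('a))) = (\<lambda>y. indicator (ball x 1) y *\<^sub>R ?k y)"
     "(\<lambda>y. indicator (- ball x 1) y *\<^sub>R (u y / norm (x - y) ^ DIM('a))) = (\<lambda>y. - (indicator (- ball x 1) y *\<^sub>R ?k y))"
    by (auto simp: fun_eq_iff split: split_indicator)
  have j: "integrable lborel (\<lambda>y. indicator (ball x 1) y *\<^sub>R ?k y)" "integrable lborel (\<lambda>y. indicator (- ball x 1) y *\<^sub>R ?k y)"
    by (rule integrable_mult_indicator[OF _ A]; simp)+
  show ?C using j unfolding set_integrable_def i by simp
  show ?D using j unfolding set_integrable_def i by simp
  have "(\<integral>y. ?k y \<partial>lborel) = (\<integral>y. indicator (ball x 1) y *\<^sub>R ?k y + indicator (- ball x 1) y *\<^sub>R ?k y \<partial>lborel)"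
    by (intro Bochner_Integration.integral_cong) (auto split: split_indicator)
  also have "\<dots> = (\<integral>y. indicator (ball x 1) y *\<^sub>R ?k y \<partial>lborel) + (\<integral>y. indicator (- ball x 1) y *\<^sub>R ?k y \<partial>lborel)"
    by (rule Bochner_Integration.integral_add[OF j])
  finally show ?E unfolding B set_lebesgue_integral_def i by (simp add: algebra_simps)
qed

end

section \<open>The Fourier transform of the fractional Laplacian\<close>

text \<open>A translation is the composition of two reflections.\<close>

lemma
  fixes z :: "'a::euclidean_space" and f :: "'a \<Rightarrow> 'b::{banach,second_countable_topology}"
  assumes [measurable]: "f \<in> borel_measurable borel"
  shows integral_translate: "(\<integral>x. f (x - z) \<partial>lborel) = (\<integral>x. f x \<partial>lborel)"
    and integrable_translate_iff: "integrable lborel (\<lambda>x. f (x - z)) \<longleftrightarrow> integrable lborel f"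
proof -
  have m: "(\<lambda>y. f (0 - y)) \<in> borel_measurable borel" by measurable
  show "(\<integral>x. f (x - z) \<partial>lborel) = (\<integral>x. f x \<partial>lborel)"
    using integral_reflect[OF m, of z] integral_reflect[of f 0] by simp
  show "integrable lborel (\<lambda>x. f (x - z)) \<longleftrightarrow> integrable lborel f"
    using integrable_reflect_iff[OF m, of z] integrable_reflect_iff[of f 0] by simp
qed

text \<open>The real part is the nonnegative integral computed before; the imaginary part vanishes
  because its integrand is odd. Integrability is a hypothesis since it is later read off from
  Fubini's theorem.\<close>

lemma integral_frac_symbol:
  fixes \<xi> :: "'a::euclidean_space" and s :: real
  assumes s: "0 < s" "s < 1"
    and int: "integrable lborel (\<lambda>z. (1 - exp (- \<i> * of_real (z \<bullet> \<xi>))) / complex_of_real (norm z powr (real DIM('a) + 2 * s)))"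
  shows "(\<integral>z. (1 - exp (- \<i> * of_real (z \<bullet> \<xi>))) / complex_of_real (norm z powr (real DIM('a) + 2 * s)) \<partial>lborel) = of_real (norm \<xi> powr (2 * s) / frac_const DIM('a) s)"
proof (rule complex_eqI)
  let ?Q = "\<lambda>z::'a. (1 - exp (- \<i> * of_real (z \<bullet> \<xi>))) / complex_of_real (norm z powr (real DIM('a) + 2 * s))"
  have Re: "Re (?Q z) = (1 - cos (z \<bullet> \<xi>)) / norm z powr (real DIM('a) + 2 * s)" for z
    by (simp add: Re_divide_of_real Re_exp)
  have Im: "Im (?Q z) = sin (z \<bullet> \<xi>) / norm z powr (real DIM('a) + 2 * s)" for z
    by (simp add: Im_divide_of_real Im_exp)
  have "Re (\<integral>z. ?Q z \<partial>lborel) = (\<integral>z. Re (?Q z) \<partial>lborel)"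
    by (rule integral_Re[OF int, symmetric])
  also have "\<dots> = norm \<xi> powr (2 * s) / frac_const DIM('a) s"
    unfolding Re using nn_integral_frac_symbol[OF s, of \<xi>] frac_const_pos[OF s, of "DIM('a)"]
    by (intro integral_eq_nn_integral[THEN trans]) auto
  finally show "Re (\<integral>z. ?Q z \<partial>lborel) = Re (of_real (norm \<xi> powr (2 * s) / frac_const DIM('a) s))" by simp
  have "Im (\<integral>z. ?Q z \<partial>lborel) = (\<integral>z. Im (?Q z) \<partial>lborel)"
    by (rule integral_Im[OF int, symmetric])
  also have "\<dots> = 0"
  proof -
    define S where "S = (\<lambda>z. Im (?Q z))"
    have "(\<integral>z. S (0 - z) \<partial>lborel) = (\<integral>z. S z \<partial>lborel)"
      unfolding S_def by (rule integral_reflect) measurable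
    moreover have "S (0 - z) = - S z" for z unfolding S_def Im by simp
    ultimately have "(\<integral>z. S z \<partial>lborel) = 0" by simp
    then show ?thesis by (simp only: S_def)
  qed
  finally show "Im (\<integral>z. ?Q z \<partial>lborel) = Im (of_real (norm \<xi> powr (2 * s) / frac_const DIM('a) s))" by simp
qed

context compact_Holder
begin

text \<open>Two bounds for the \<open>L^1\<close> modulus of continuity: a constant for large
  shifts, and \<open>norm z powr \<alpha>\<close> for short ones, where the difference lives in the
  ball of radius \<open>R + 1\<close>.\<close>

lemma integral_abs_difference_le:
  shows "integrable lborel (\<lambda>x. \<bar>u x - u (x - z)\<bar>)"
    and "(\<integral>x. \<bar>u x - u (x - z)\<bar> \<partial>lborel) \<le> 2 * u_mass"
    and "norm z < 1 \<Longrightarrow> (\<integral>x. \<bar>u x - u (x - z)\<bar> \<partial>lborel) \<le> C * norm z powr \<alpha> * measure lborel (ball (0::'a) (R + 1))"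
proof -
  have t: "integrable lborel (\<lambda>x. u (x - z))" using integrable_u by (simp add: integrable_translate_iff)
  show i: "integrable lborel (\<lambda>x. \<bar>u x - u (x - z)\<bar>)" using integrable_u t by simp
  have "(\<integral>x. \<bar>u x - u (x - z)\<bar> \<partial>lborel) \<le> (\<integral>x. \<bar>u x\<bar> + \<bar>u (x - z)\<bar> \<partial>lborel)"
    using i integrable_u t by (intro integral_mono) (auto intro: abs_triangle_ineq4)
  also have "\<dots> = u_mass + (\<integral>x. \<bar>u (x - z)\<bar> \<partial>lborel)"
    using integrable_u t by (simp add: u_mass_def)
  also have "(\<integral>x. \<bar>u (x - z)\<bar> \<partial>lborel) = u_mass"
    unfolding u_mass_def by (rule integral_translate[of "\<lambda>x. \<bar>u x\<bar>"]) measurable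
  finally show "(\<integral>x. \<bar>u x - u (x - z)\<bar> \<partial>lborel) \<le> 2 * u_mass" by simp
  assume z: "norm z < 1"
  have "\<bar>u x - u (x - z)\<bar> \<le> C * norm z powr \<alpha> * indicator (ball 0 (R + 1)) x" for x
  proof (cases "norm x < R + 1")
    case True
    then show ?thesis using Holder[of x "x - z"] by simp
  next
    case False
    then have "norm (x - z) \<ge> R" using norm_triangle_ineq2[of x z] z by linarith
    then show ?thesis using False supp[of x] supp[of "x - z"] by simp
  qed
  moreover have ib: "integrable lborel (\<lambda>x::'a. indicator (ball 0 (R + 1)) x :: real)"
    using emeasure_lborel_ball_finite[of "0::'a" "R + 1"] by (intro integrable_real_indicator) auto
  ultimately have "(\<integral>x. \<bar>u x - u (x - z)\<bar> \<partial>lborel) \<le> (\<integral>(x::'a). C * norm z powr \<alpha> * indicator (ball 0 (R + 1)) x \<partial>lborel)"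
    using i by (intro integral_mono) auto
  then show "(\<integral>x. \<bar>u x - u (x - z)\<bar> \<partial>lborel) \<le> C * norm z powr \<alpha> * measure lborel (ball (0::'a) (R + 1))"
    by simp
qed

text \<open>Integrating over \<open>x\<close> first leaves the \<open>L^1\<close> modulus of
  continuity over \<open>|z|^(N + 2s)\<close>. This is of order
  \<open>|z|^(\<alpha> - 2s - N)\<close> near 0, integrable as \<open>2 s < \<alpha>\<close>, and
  \<open>|z|^(-2s - N)\<close> far out, integrable as \<open>s > 0\<close>.\<close>

lemma integrable_difference_quotient:
  assumes s: "0 < s" "s \<le> \<alpha> / 4"
  shows "integrable (lborel \<Otimes>\<^sub>M lborel) (\<lambda>(z, x). exp (- \<i> * of_real (x \<bullet> \<xi>)) * of_real ((u x - u (x - z)) / norm z powr (real DIM('a) + 2 * s)))"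
    (is "integrable _ (\<lambda>(z, x). ?f z x)")
proof (rule lborel_pair.Fubini_integrable)
  let ?p = "\<lambda>z::'a. norm z powr (real DIM('a) + 2 * s)"
  show m: "(\<lambda>(z, x). ?f z x) \<in> borel_measurable (lborel \<Otimes>\<^sub>M lborel)"
    by measurable
  have n: "norm (?f z x) = \<bar>u x - u (x - z)\<bar> / ?p z" for z x
    by (simp only: norm_mult norm_fourier_kernel norm_of_real abs_divide) simp
  have I: "integrable lborel (?f z)" for z
    by (rule Bochner_Integration.integrable_bound[of _ "\<lambda>x. \<bar>u x - u (x - z)\<bar> / ?p z"])
       (use integral_abs_difference_le(1)[of z] n in auto)
  then show "AE z in lborel. integrable lborel (\<lambda>x. case (z, x) of (z, x) \<Rightarrow> ?f z x)" by simp
  let ?V = "measure lborel (ball (0::'a) (R + 1))"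
  let ?g = "\<lambda>z::'a. C * ?V * (indicator (ball 0 1) z * norm (0 - z) powr ((\<alpha> - 2 * s) - real DIM('a)))
      + 2 * u_mass * (indicator (- ball 0 1) z * norm (0 - z) powr (- (2 * s) - real DIM('a)))"
  show "integrable lborel (\<lambda>z. \<integral>x. norm (case (z, x) of (z, x) \<Rightarrow> ?f z x) \<partial>lborel)"
  proof (rule Bochner_Integration.integrable_bound)
    show "integrable lborel ?g"
      using has_bochner_integral_norm_powr_ball[of "\<alpha> - 2 * s" "0::'a"]
        has_bochner_integral_norm_powr_compl_ball[of "2 * s" "0::'a"] s \<alpha>_pos
      by (intro Bochner_Integration.integrable_add integrable_mult_right) (auto simp: has_bochner_integral_iff)
    have "(\<integral>x. norm (?f z x) \<partial>lborel) \<le> ?g z" for z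
    proof (cases "norm z < 1")
      case True
      have "(\<integral>x. norm (?f z x) \<partial>lborel) = (\<integral>x. \<bar>u x - u (x - z)\<bar> \<partial>lborel) / ?p z"
        unfolding n by simp
      also have "\<dots> \<le> C * norm z powr \<alpha> * ?V / ?p z"
        using integral_abs_difference_le(3)[OF True] by (intro divide_right_mono) auto
      also have "\<dots> = C * ?V * (norm z powr \<alpha> / ?p z)" by simp
      also have "norm z powr \<alpha> / ?p z = norm z powr ((\<alpha> - 2 * s) - real DIM('a))"
        unfolding powr_diff[symmetric] by (rule arg_cong[where f="\<lambda>e. _ powr e"]) simp
      finally show ?thesis using True by simp
    next
      case False
      have "(\<integral>x. norm (?f z x) \<partial>lborel) = (\<integral>x. \<bar>u x - u (x - z)\<bar> \<partial>lborel) / ?p z"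
        unfolding n by simp
      also have "\<dots> \<le> 2 * u_mass / ?p z"
        using integral_abs_difference_le(2)[of z] by (intro divide_right_mono) auto
      also have "\<dots> = 2 * u_mass * (1 / ?p z)" by simp
      also have "1 / ?p z = norm z powr (- (2 * s) - real DIM('a))"
        unfolding powr_minus_divide[symmetric] by (rule arg_cong[where f="\<lambda>e. _ powr e"]) simp
      finally show ?thesis using False by simp
    qed
    then show "AE z in lborel. norm (\<integral>x. norm (case (z, x) of (z, x) \<Rightarrow> ?f z x) \<partial>lborel) \<le> norm (?g z)"
      by (auto intro!: order_trans[OF _ abs_ge_self])
  qed measurable
qed

lemma frac_laplacian_eq_difference_quotient:
  assumes s: "0 < s" "s \<le> \<alpha> / 4"
  shows "frac_laplacian s u x = frac_const DIM('a) s * (\<integral>z. (u x - u (x - z)) / norm z powr (real DIM('a) + 2 * s) \<partial>lborel)"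
proof -
  have [measurable]: "frac_kernel s u x \<in> borel_measurable borel"
    unfolding frac_kernel_def[abs_def] by measurable
  have I: "(\<integral>y. frac_kernel s u x y \<partial>lborel) = (\<integral>z. frac_kernel s u x (x - z) \<partial>lborel)"
    by (rule integral_reflect[symmetric]) measurable
  have "frac_kernel s u x (x - z) = (u x - u (x - z)) / norm z powr (real DIM('a) + 2 * s)" for z
    by (simp add: frac_kernel_def)
  then show ?thesis unfolding frac_laplacian_eq_integral[OF s] I by (simp only:)
qed

text \<open>A shift by \<open>z\<close> multiplies the Fourier integral by
  \<open>exp (- \<i> z \<bullet> \<xi>)\<close>. Exchanging the integrals therefore leaves the
  Fourier integral of \<open>u\<close> times the integral of the symbol, in which
  \<open>frac_const\<close> cancels.\<close>

lemma
  assumes s: "0 < s" "s \<le> \<alpha> / 4" "s < 1"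
  shows integrable_frac_laplacian: "integrable lborel (\<lambda>x. complex_of_real (frac_laplacian s u x))"
    and fourier_integral_frac_laplacian:
      "fourier_integral (\<lambda>x. complex_of_real (frac_laplacian s u x)) \<xi>
        = of_real (norm \<xi> powr (2 * s)) * fourier_integral (\<lambda>x. complex_of_real (u x)) \<xi>"
proof -
  let ?c = "frac_const DIM('a) s"
  let ?p = "\<lambda>z::'a. norm z powr (real DIM('a) + 2 * s)"
  let ?f = "\<lambda>\<xi> z x. exp (- \<i> * of_real (x \<bullet> \<xi>)) * complex_of_real ((u x - u (x - z)) / ?p z)"
  let ?U = "fourier_integral (\<lambda>x. complex_of_real (u x)) \<xi>"
  note int = integrable_difference_quotient[OF s(1,2)]
  have inner: "(\<integral>z. ?f \<xi> z x \<partial>lborel) * of_real ?c = exp (- \<i> * of_real (x \<bullet> \<xi>)) * complex_of_real (frac_laplacian s u x)" for \<xi> x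
  proof -
    have "(\<integral>z. ?f \<xi> z x \<partial>lborel) = exp (- \<i> * of_real (x \<bullet> \<xi>)) * (\<integral>z. complex_of_real ((u x - u (x - z)) / ?p z) \<partial>lborel)"
      by (rule integral_mult_right_zero)
    also have "(\<integral>z. complex_of_real ((u x - u (x - z)) / ?p z) \<partial>lborel) = complex_of_real (\<integral>z. (u x - u (x - z)) / ?p z \<partial>lborel)"
      by (rule integral_complex_of_real)
    finally show ?thesis unfolding frac_laplacian_eq_difference_quotient[OF s(1,2)] by simp
  qed
  \<comment> \<open>At frequency 0 the Fourier kernel is 1, so Fubini gives integrability of the
    fractional Laplacian itself.\<close>
  have "integrable lborel (\<lambda>x. (\<integral>z. ?f 0 z x \<partial>lborel) * of_real ?c)"
    using lborel_pair.integrable_fst'[OF lborel_pair.integrable_product_swap[OF int[of 0]]]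
    by (intro integrable_mult_left) simp
  then show "integrable lborel (\<lambda>x. complex_of_real (frac_laplacian s u x))"
    unfolding inner by simp
  have uint: "integrable lborel (\<lambda>x. complex_of_real (u x))" using integrable_u by simp
  have outer: "(\<integral>x. ?f \<xi> z x \<partial>lborel) = ?U * ((1 - exp (- \<i> * of_real (z \<bullet> \<xi>))) / of_real (?p z))" for z
  proof -
    let ?e = "\<lambda>x. exp (- \<i> * complex_of_real (x \<bullet> \<xi>))"
    have tr: "integrable lborel (\<lambda>x. complex_of_real (u (x - z)))"
      by (subst integrable_translate_iff[of "\<lambda>x. complex_of_real (u x)"]) (use uint in auto)
    have "(\<integral>x. ?f \<xi> z x \<partial>lborel) = (\<integral>x. (?e x * of_real (u x) - ?e x * of_real (u (x - z))) / of_real (?p z) \<partial>lborel)"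
      by (simp add: right_diff_distrib)
    also have "\<dots> = (\<integral>x. (?e x * of_real (u x) - ?e x * of_real (u (x - z))) \<partial>lborel) / of_real (?p z)"
      by (rule integral_divide_zero)
    also have "(\<integral>x. (?e x * of_real (u x) - ?e x * of_real (u (x - z))) \<partial>lborel)
       = ?U - (\<integral>x. ?e x * of_real (u (x - z)) \<partial>lborel)"
      unfolding fourier_integral_def
      by (intro Bochner_Integration.integral_diff integrable_fourier_kernel_mult uint tr) auto
    also have "(\<integral>x. ?e x * of_real (u (x - z)) \<partial>lborel) = (\<integral>x. (\<lambda>w. ?e z * (?e w * of_real (u w))) (x - z) \<partial>lborel)"
      by (intro Bochner_Integration.integral_cong) (simp_all add: inner_diff_left exp_add[symmetric] algebra_simps flip: mult.assoc)
    also have "\<dots> = (\<integral>w. ?e z * (?e w * of_real (u w)) \<partial>lborel)"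
      by (rule integral_translate) measurable
    also have "\<dots> = ?e z * ?U" unfolding fourier_integral_def by (rule integral_mult_right_zero)
    finally show ?thesis by (simp add: algebra_simps)
  qed
  have "fourier_integral (\<lambda>x. complex_of_real (frac_laplacian s u x)) \<xi> = (\<integral>x. (\<integral>z. ?f \<xi> z x \<partial>lborel) \<partial>lborel) * of_real ?c"
    unfolding fourier_integral_def inner[symmetric] by (rule integral_mult_left_zero)
  also have "(\<integral>x. (\<integral>z. ?f \<xi> z x \<partial>lborel) \<partial>lborel) = (\<integral>z. (\<integral>x. ?f \<xi> z x \<partial>lborel) \<partial>lborel)"
    by (rule lborel_pair.Fubini_integral[OF int])
  also have "\<dots> = ?U * (\<integral>z. (1 - exp (- \<i> * of_real (z \<bullet> \<xi>))) / of_real (?p z) \<partial>lborel)"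
    unfolding outer by (rule integral_mult_right_zero)
  also have "\<dots> = ?U * of_real (norm \<xi> powr (2 * s) / ?c)"
  \<comment> \<open>Fubini yields integrability of the symbol integrand only multiplied by the
    Fourier integral of \<open>u\<close>. Where that factor is nonzero it can be divided out; where
    it is zero both sides vanish.\<close>
  proof (cases "?U = 0")
    case False
    have "integrable lborel (\<lambda>z. \<integral>x. ?f \<xi> z x \<partial>lborel)"
      using lborel_pair.integrable_fst'[OF int[of \<xi>]] by simp
    then have "integrable lborel (\<lambda>z. inverse ?U * (?U * ((1 - exp (- \<i> * of_real (z \<bullet> \<xi>))) / of_real (?p z))))"
      unfolding outer by (rule integrable_mult_right)
    then have "integrable lborel (\<lambda>z. (1 - exp (- \<i> * of_real (z \<bullet> \<xi>))) / of_real (?p z))"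
      by (simp only: mult.assoc[symmetric] left_inverse[OF False] mult_1_left)
    from integral_frac_symbol[OF s(1,3) this] show ?thesis by simp
  qed simp
  finally show "fourier_integral (\<lambda>x. complex_of_real (frac_laplacian s u x)) \<xi> = of_real (norm \<xi> powr (2 * s)) * ?U"
    using frac_const_pos[OF s(1,3), of "DIM('a)"] by simp
qed

end

section \<open>The Fourier-Plancherel transform of the logarithmic Laplacian\<close>

text \<open>Kept in \<open>ennreal\<close>, so that an infinite norm stays infinite;
  \<open>Lp_norm 2\<close> would return 0 for a function outside \<open>L^2\<close>.\<close>

definition L2sq :: "('a::euclidean_space \<Rightarrow> 'b::{banach,second_countable_topology}) \<Rightarrow> ennreal" where
  "L2sq f = (\<integral>\<^sup>+x. ennreal ((norm (f x))\<^sup>2) \<partial>lborel)"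

lemma Lp_space_2_iff:
  "f \<in> Lp_space 2 \<longleftrightarrow> f \<in> borel_measurable lborel \<and> L2sq f < \<infinity>"
  unfolding Lp_space_def L2sq_def by (auto simp: integrable_iff_bounded)

lemma Lp_norm_2_eq:
  assumes [measurable]: "f \<in> borel_measurable lborel"
  shows "Lp_norm 2 f = sqrt (enn2real (L2sq f))"
  unfolding Lp_norm_def L2sq_def
  by (simp add: integral_eq_nn_integral powr_half_sqrt)

text \<open>From \<open>(a + b)^2 \<le> 2 a^2 + 2 b^2\<close>. The factor 2 is harmless, as the
  estimate only serves to show finiteness and convergence to 0.\<close>

lemma L2sq_triangle:
  fixes f g h :: "'a::euclidean_space \<Rightarrow> 'b::{banach,second_countable_topology}"
  assumes [measurable]: "f \<in> borel_measurable lborel" "g \<in> borel_measurable lborel" "h \<in> borel_measurable lborel"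
  shows "L2sq (\<lambda>x. f x - g x) \<le> 2 * L2sq (\<lambda>x. f x - h x) + 2 * L2sq (\<lambda>x. h x - g x)"
proof -
  have "L2sq (\<lambda>x. f x - g x) \<le> (\<integral>\<^sup>+x. 2 * ennreal ((norm (f x - h x))\<^sup>2) + 2 * ennreal ((norm (h x - g x))\<^sup>2) \<partial>lborel)"
    unfolding L2sq_def
  proof (rule nn_integral_mono)
    fix x
    have "(norm (f x - g x))\<^sup>2 \<le> (norm (f x - h x) + norm (h x - g x))\<^sup>2"
      using norm_triangle_ineq[of "f x - h x" "h x - g x"] by (intro power_mono) auto
    also have "\<dots> \<le> 2 * (norm (f x - h x))\<^sup>2 + 2 * (norm (h x - g x))\<^sup>2"
      using sum_squares_bound[of "norm (f x - h x)" "norm (h x - g x)"] by (simp add: power2_sum)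
    finally have "ennreal ((norm (f x - g x))\<^sup>2) \<le> ennreal (2 * (norm (f x - h x))\<^sup>2 + 2 * (norm (h x - g x))\<^sup>2)"
      by (rule ennreal_leI)
    then show "ennreal ((norm (f x - g x))\<^sup>2) \<le> 2 * ennreal ((norm (f x - h x))\<^sup>2) + 2 * ennreal ((norm (h x - g x))\<^sup>2)"
      by (simp add: ennreal_mult)
  qed
  also have "\<dots> = 2 * L2sq (\<lambda>x. f x - h x) + 2 * L2sq (\<lambda>x. h x - g x)"
    unfolding L2sq_def by (simp add: nn_integral_add nn_integral_cmult)
  finally show ?thesis .
qed

lemma L2sq_minus_commute: "L2sq (\<lambda>x. f x - g x) = L2sq (\<lambda>x. g x - f x)"
  by (simp add: L2sq_def norm_minus_commute)

lemma L2sq_cong_AE: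
  assumes "AE x in lborel. f x = g x"
  shows "L2sq f = L2sq g"
  unfolding L2sq_def by (intro nn_integral_cong_AE eventually_mono[OF assms]) simp

lemma L2sq_eq_0_iff:
  assumes [measurable]: "f \<in> borel_measurable lborel"
  shows "L2sq f = 0 \<longleftrightarrow> (AE x in lborel. f x = 0)"
  unfolding L2sq_def by (subst nn_integral_0_iff_AE) auto

text \<open>Fatou's lemma in the form needed for limits of inequalities: the bounds may vary with
  \<open>n\<close> as long as they converge.\<close>

lemma L2sq_Fatou:
  fixes F :: "nat \<Rightarrow> 'a::euclidean_space \<Rightarrow> 'b::{banach,second_countable_topology}"
  assumes [measurable]: "\<And>n. F n \<in> borel_measurable lborel"
    and lim: "AE x in lborel. (\<lambda>n. F n x) \<longlonglongrightarrow> f x"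
    and B: "\<And>n. L2sq (F n) \<le> B n" "B \<longlonglongrightarrow> b"
  shows "L2sq f \<le> b"
proof -
  have "L2sq f = (\<integral>\<^sup>+x. liminf (\<lambda>n. ennreal ((norm (F n x))\<^sup>2)) \<partial>lborel)"
    unfolding L2sq_def
  proof (rule nn_integral_cong_AE)
    show "AE x in lborel. ennreal ((norm (f x))\<^sup>2) = liminf (\<lambda>n. ennreal ((norm (F n x))\<^sup>2))"
      using lim
    proof eventually_elim
      case (elim x)
      have "(\<lambda>n. ennreal ((norm (F n x))\<^sup>2)) \<longlonglongrightarrow> ennreal ((norm (f x))\<^sup>2)"
        using elim by (intro tendsto_ennrealI tendsto_intros)
      then show ?case by (intro lim_imp_Liminf[symmetric]) simp_all
    qed
  qed
  also have "\<dots> \<le> liminf (\<lambda>n. L2sq (F n))"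
    unfolding L2sq_def by (rule nn_integral_liminf) measurable
  also have "\<dots> \<le> liminf B"
    using B(1) by (intro Liminf_mono always_eventually) auto
  also have "\<dots> = b" using B(2) by (intro lim_imp_Liminf) simp_all
  finally show ?thesis .
qed

text \<open>Membership in \<open>L^2\<close> makes the squared norm of the difference finite, so
  passing between \<open>ennreal\<close> and \<open>real\<close> loses nothing.\<close>

lemma tendsto_Lp_2_iff:
  fixes f :: "'a::euclidean_space \<Rightarrow> 'b::{banach,second_countable_topology}"
  shows "tendsto_Lp 2 F f net \<longleftrightarrow>
    f \<in> Lp_space 2 \<and> (\<forall>\<^sub>F i in net. F i \<in> Lp_space 2) \<and> ((\<lambda>i. L2sq (\<lambda>x. F i x - f x)) \<longlongrightarrow> 0) net"
    (is "?A \<longleftrightarrow> ?f \<and> ?F \<and> ?L")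
proof -
  have "((\<lambda>i. Lp_norm 2 (\<lambda>x. F i x - f x)) \<longlongrightarrow> 0) net \<longleftrightarrow> ?L" if f: ?f and F: ?F
  proof -
    have ev: "\<forall>\<^sub>F i in net. Lp_norm 2 (\<lambda>x. F i x - f x) = sqrt (enn2real (L2sq (\<lambda>x. F i x - f x)))
        \<and> L2sq (\<lambda>x. F i x - f x) = ennreal ((Lp_norm 2 (\<lambda>x. F i x - f x))\<^sup>2)"
      using F
    proof eventually_elim
      case (elim i)
      have [measurable]: "F i \<in> borel_measurable lborel" "f \<in> borel_measurable lborel"
        using elim f by (auto simp: Lp_space_2_iff)
      have "L2sq (\<lambda>x. F i x - f x) \<le> 2 * L2sq (\<lambda>x. F i x - 0) + 2 * L2sq (\<lambda>x. 0 - f x)"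
        by (rule L2sq_triangle[of "F i" f "\<lambda>_. 0"]) measurable
      also have "\<dots> = 2 * L2sq (F i) + 2 * L2sq f" by (simp add: L2sq_def)
      also have "\<dots> < \<infinity>"
        using elim f by (simp add: Lp_space_2_iff ennreal_mult_less_top)
      finally have "ennreal (enn2real (L2sq (\<lambda>x. F i x - f x))) = L2sq (\<lambda>x. F i x - f x)" by simp
      then show ?case using Lp_norm_2_eq[of "\<lambda>x. F i x - f x"] by simp
    qed
    have ev1: "\<forall>\<^sub>F i in net. Lp_norm 2 (\<lambda>x. F i x - f x) = sqrt (enn2real (L2sq (\<lambda>x. F i x - f x)))"
      and ev2: "\<forall>\<^sub>F i in net. L2sq (\<lambda>x. F i x - f x) = ennreal ((Lp_norm 2 (\<lambda>x. F i x - f x))\<^sup>2)"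
      using ev by (auto elim: eventually_mono)
    show ?thesis
    proof
      assume "((\<lambda>i. Lp_norm 2 (\<lambda>x. F i x - f x)) \<longlongrightarrow> 0) net"
      then have "((\<lambda>i. ennreal ((Lp_norm 2 (\<lambda>x. F i x - f x))\<^sup>2)) \<longlongrightarrow> ennreal (0\<^sup>2)) net"
        by (intro tendsto_ennrealI tendsto_intros)
      then show ?L unfolding tendsto_cong[OF ev2] by simp
    next
      assume ?L
      then have "((\<lambda>i. sqrt (enn2real (L2sq (\<lambda>x. F i x - f x)))) \<longlongrightarrow> sqrt (enn2real 0)) net"
        by (intro tendsto_real_sqrt tendsto_enn2real) simp_all
      then show "((\<lambda>i. Lp_norm 2 (\<lambda>x. F i x - f x)) \<longlongrightarrow> 0) net"
        unfolding tendsto_cong[OF ev1] by simp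
    qed
  qed
  then show ?thesis by (auto simp: tendsto_Lp_def)
qed

lemma tendsto_Lp_2_unique:
  assumes "tendsto_Lp 2 F f net" "tendsto_Lp 2 F g net" "net \<noteq> bot"
  shows "AE x in lborel. f x = g x"
proof -
  note f = assms(1)[unfolded tendsto_Lp_2_iff] and g = assms(2)[unfolded tendsto_Lp_2_iff]
  have [measurable]: "f \<in> borel_measurable lborel" "g \<in> borel_measurable lborel"
    using f g by (auto simp: Lp_space_2_iff)
  have ev: "\<forall>\<^sub>F i in net. L2sq (\<lambda>x. f x - g x) \<le> 2 * L2sq (\<lambda>x. F i x - f x) + 2 * L2sq (\<lambda>x. F i x - g x)"
    using f[THEN conjunct2, THEN conjunct1]
  proof eventually_elim
    case (elim i)
    then show ?case using L2sq_triangle[of f g "F i"]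
      by (simp add: Lp_space_2_iff L2sq_minus_commute[of f "F i"])
  qed
  have "((\<lambda>i. 2 * L2sq (\<lambda>x. F i x - f x) + 2 * L2sq (\<lambda>x. F i x - g x)) \<longlongrightarrow> 2 * 0 + 2 * 0) net"
    using f g by (intro tendsto_add ennreal_tendsto_cmult) auto
  then have "((\<lambda>i. 2 * L2sq (\<lambda>x. F i x - f x) + 2 * L2sq (\<lambda>x. F i x - g x)) \<longlongrightarrow> 0) net" by simp
  then have "L2sq (\<lambda>x. f x - g x) \<le> 0" using ev assms(3) by (rule tendsto_lowerbound)
  then show ?thesis by (simp add: L2sq_eq_0_iff)
qed

lemma tendsto_Lp_2_cong_AE:
  assumes "tendsto_Lp 2 F f net" "AE x in lborel. f x = g x" and [measurable]: "g \<in> borel_measurable lborel"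
  shows "tendsto_Lp 2 F g net"
proof -
  have "L2sq f = L2sq g" by (rule L2sq_cong_AE[OF assms(2)])
  moreover have "L2sq (\<lambda>x. F i x - f x) = L2sq (\<lambda>x. F i x - g x)" for i
    by (rule L2sq_cong_AE) (use assms(2) in eventually_elim, simp)
  ultimately show ?thesis using assms(1) by (simp add: tendsto_Lp_2_iff Lp_space_2_iff)
qed

section \<open>Existence and identification of Plancherel transforms\<close>

lemma integrable_truncation:
  fixes f :: "'a::euclidean_space \<Rightarrow> complex"
  assumes "f \<in> Lp_space 2"
  shows "integrable lborel (\<lambda>x. indicator (ball 0 r) x * f x)"
proof (rule Bochner_Integration.integrable_bound)
  have [measurable]: "f \<in> borel_measurable lborel" using assms by (simp add: Lp_space_2_iff)
  show "(\<lambda>x. indicator (ball 0 r) x * f x) \<in> borel_measurable lborel" by measurable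
  have "integrable lborel (\<lambda>x. (norm (f x))\<^sup>2)"
    using assms by (simp add: Lp_space_def)
  moreover have "integrable lborel (\<lambda>x::'a. indicator (ball 0 r) x :: real)"
    using emeasure_lborel_ball_finite[of "0::'a" r] by (intro integrable_real_indicator) auto
  ultimately show "integrable lborel (\<lambda>x. indicator (ball 0 r) x + (norm (f x))\<^sup>2)" by simp
  \<comment> \<open>On the ball \<open>|f| \<le> 1 + |f|^2\<close>, and there the constant 1 is
    integrable.\<close>
  have "norm (indicator (ball 0 r) x * f x) \<le> indicator (ball 0 r) x + (norm (f x))\<^sup>2" for x
  proof -
    have "2 * norm (f x) \<le> 1 + (norm (f x))\<^sup>2" using sum_squares_bound[of 1 "norm (f x)"] by simp
    then have "norm (f x) \<le> 1 + (norm (f x))\<^sup>2" using norm_ge_zero[of "f x"] by linarith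
    then show ?thesis by (simp split: split_indicator)
  qed
  then show "AE x in lborel. norm (indicator (ball 0 r) x * f x) \<le> norm (indicator (ball 0 r) x + (norm (f x))\<^sup>2)"
    by (auto intro!: order_trans[OF _ abs_ge_self])
qed

lemma tendsto_truncation_L2sq:
  fixes f :: "'a::euclidean_space \<Rightarrow> complex"
  assumes "f \<in> Lp_space 2"
  shows "((\<lambda>r. L2sq (\<lambda>x. f x - indicator (ball 0 r) x * f x)) \<longlongrightarrow> 0) at_top"
proof -
  have [measurable]: "f \<in> borel_measurable lborel" using assms by (simp add: Lp_space_2_iff)
  have int: "integrable lborel (\<lambda>x. (norm (f x))\<^sup>2)" using assms by (simp add: Lp_space_def)
  let ?g = "\<lambda>r x. (norm (f x - indicator (ball 0 r) x * f x))\<^sup>2"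
  have le: "?g r x \<le> (norm (f x))\<^sup>2" for r x by (simp split: split_indicator)
  have "((\<lambda>r. \<integral>x. ?g r x \<partial>lborel) \<longlongrightarrow> (\<integral>(x::'a). 0 \<partial>lborel)) at_top"
  proof (rule integral_dominated_convergence_at_top[OF _ _ int])
    show "AE x in lborel. ((\<lambda>r. ?g r x) \<longlongrightarrow> 0) at_top"
    proof (rule AE_I2)
      fix x :: 'a
      have "\<forall>\<^sub>F r in at_top. ?g r x = 0"
        using eventually_gt_at_top[of "norm x"] by eventually_elim simp
      then show "((\<lambda>r. ?g r x) \<longlongrightarrow> 0) at_top" by (rule tendsto_eventually)
    qed
  qed (use le in auto)
  then have "((\<lambda>r. ennreal (\<integral>x. ?g r x \<partial>lborel)) \<longlongrightarrow> ennreal 0) at_top"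
    by (intro tendsto_ennrealI) simp
  moreover have "L2sq (\<lambda>x. f x - indicator (ball 0 r) x * f x) = ennreal (\<integral>x. ?g r x \<partial>lborel)" for r
    unfolding L2sq_def
    by (intro nn_integral_eq_integral Bochner_Integration.integrable_bound[OF int]) (use le in auto)
  ultimately show ?thesis by simp
qed

lemma L2sq_fourier_integral_le:
  fixes f :: "'a::euclidean_space \<Rightarrow> complex"
  assumes "integrable lborel f"
  shows "L2sq (fourier_integral f) \<le> ennreal ((2 * pi) ^ DIM('a)) * L2sq f"
  unfolding L2sq_def by (rule nn_integral_fourier_integral_le[OF assms])

lemma fourier_integral_diff:
  assumes "integrable lborel f" "integrable lborel g"
  shows "fourier_integral (\<lambda>x. f x - g x) \<xi> = fourier_integral f \<xi> - fourier_integral g \<xi>"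
  unfolding fourier_integral_def right_diff_distrib
  by (intro Bochner_Integration.integral_diff integrable_fourier_kernel_mult assms) auto

text \<open>Plancherel's inequality for \<open>h n - T r\<close>, with \<open>T r\<close> the
  truncation of \<open>f\<close>, passes to the limit in \<open>n\<close> by Fatou and bounds
  \<open>g\<close> minus the transform of \<open>T r\<close> by a multiple of \<open>f - T r\<close>
  in \<open>L^2\<close>. Letting \<open>r\<close> grow gives the defining convergence, with
  \<open>g\<close> known in advance from the pointwise limit.\<close>

lemma is_plancherel_transform_limit:
  fixes f :: "'a::euclidean_space \<Rightarrow> complex" and h :: "nat \<Rightarrow> 'a \<Rightarrow> complex"
  assumes f: "f \<in> Lp_space 2" and h: "\<And>n. integrable lborel (h n)"
    and hf: "(\<lambda>n. L2sq (\<lambda>x. h n x - f x)) \<longlonglongrightarrow> 0"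
    and lim: "AE \<xi> in lborel. (\<lambda>n. fourier_integral (h n) \<xi>) \<longlonglongrightarrow> g \<xi>"
    and g [measurable]: "g \<in> borel_measurable lborel"
  shows "is_plancherel_transform f g"
proof -
  define T where "T r x = indicator (ball 0 r) x * f x" for r x
  let ?c = "ennreal ((2 * pi) ^ DIM('a))"
  have [measurable]: "f \<in> borel_measurable lborel" using f by (simp add: Lp_space_2_iff)
  have hm [measurable]: "h n \<in> borel_measurable lborel" for n using h[of n] by (rule borel_measurable_integrable)
  have T: "integrable lborel (T r)" for r unfolding T_def[abs_def] by (rule integrable_truncation[OF f])
  have Tm [measurable]: "T r \<in> borel_measurable lborel" for r using T[of r] by (rule borel_measurable_integrable)
  have le: "L2sq (\<lambda>\<xi>. g \<xi> - fourier_integral (T r) \<xi>) \<le> ?c * (2 * L2sq (\<lambda>x. f x - T r x))" for r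
  proof -
    have "L2sq (\<lambda>\<xi>. g \<xi> - fourier_integral (T r) \<xi>) \<le> ?c * (2 * 0 + 2 * L2sq (\<lambda>x. f x - T r x))"
    proof (rule L2sq_Fatou)
      show "AE \<xi> in lborel. (\<lambda>n. fourier_integral (\<lambda>x. h n x - T r x) \<xi>) \<longlonglongrightarrow> g \<xi> - fourier_integral (T r) \<xi>"
        using lim
      proof eventually_elim
        case (elim \<xi>)
        then show ?case unfolding fourier_integral_diff[OF h T] by (intro tendsto_intros)
      qed
      have "L2sq (fourier_integral (\<lambda>x. h n x - T r x)) \<le> ?c * L2sq (\<lambda>x. h n x - T r x)" for n
        by (rule L2sq_fourier_integral_le) (intro Bochner_Integration.integrable_diff h T)
      also have "\<dots> n \<le> ?c * (2 * L2sq (\<lambda>x. h n x - f x) + 2 * L2sq (\<lambda>x. f x - T r x))" for n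
        by (intro mult_left_mono L2sq_triangle) (auto simp: hm)
      finally show "L2sq (fourier_integral (\<lambda>x. h n x - T r x)) \<le> ?c * (2 * L2sq (\<lambda>x. h n x - f x) + 2 * L2sq (\<lambda>x. f x - T r x))" for n .
      show "(\<lambda>n. ?c * (2 * L2sq (\<lambda>x. h n x - f x) + 2 * L2sq (\<lambda>x. f x - T r x))) \<longlonglongrightarrow> ?c * (2 * 0 + 2 * L2sq (\<lambda>x. f x - T r x))"
        by (intro ennreal_tendsto_cmult tendsto_add tendsto_const hf) auto
    qed measurable
    then show ?thesis by simp
  qed
  have FT: "fourier_integral (T r) \<in> Lp_space 2" for r
  proof -
    have "L2sq (T r) \<le> L2sq f"
      unfolding L2sq_def T_def by (intro nn_integral_mono) (auto split: split_indicator)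
    also have "\<dots> < \<infinity>" using f by (simp add: Lp_space_2_iff)
    finally have "?c * L2sq (T r) < \<infinity>" by (simp add: ennreal_mult_less_top)
    then show ?thesis using L2sq_fourier_integral_le[OF T[of r]]
      by (auto simp: Lp_space_2_iff intro: order_le_less_trans)
  qed
  have "g \<in> Lp_space 2"
  proof -
    \<comment> \<open>The ball of radius 0 is empty, so the case \<open>r = 0\<close> of the
      estimate bounds \<open>g\<close> itself.\<close>
    have "T 0 = (\<lambda>x. 0)" by (auto simp: T_def)
    then have "L2sq g \<le> ?c * (2 * L2sq f)" using le[of 0] by (simp add: fourier_integral_def)
    also have "\<dots> < \<infinity>" using f by (simp add: Lp_space_2_iff ennreal_mult_less_top)
    finally show ?thesis by (simp add: Lp_space_2_iff)
  qed
  moreover have "((\<lambda>r. L2sq (\<lambda>\<xi>. fourier_integral (T r) \<xi> - g \<xi>)) \<longlongrightarrow> 0) at_top"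
  proof (rule tendsto_sandwich[OF _ _ tendsto_const])
    have "((\<lambda>r. ?c * (2 * L2sq (\<lambda>x. f x - T r x))) \<longlongrightarrow> ?c * (2 * 0)) at_top"
      unfolding T_def by (intro ennreal_tendsto_cmult tendsto_truncation_L2sq f) auto
    then show "((\<lambda>r. ?c * (2 * L2sq (\<lambda>x. f x - T r x))) \<longlongrightarrow> 0) at_top" by simp
  qed (use le L2sq_minus_commute[of g] in auto)
  ultimately show ?thesis
    using f FT unfolding is_plancherel_transform_def tendsto_Lp_2_iff T_def by simp
qed

text \<open>Connects both branches of \<open>fourier\<close> with a known transform
  \<open>g\<close>. If \<open>f\<close> is not integrable, the choice operator picks some transform,
  equal to \<open>g\<close> almost everywhere by uniqueness of \<open>L^2\<close> limits. If
  \<open>f\<close> is integrable, the transforms of the truncations converge pointwise to the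
  Fourier integral and in \<open>L^2\<close> to \<open>g\<close>, and Fatou identifies the two
  limits.\<close>

lemma is_plancherel_transform_fourier:
  fixes f :: "'a::euclidean_space \<Rightarrow> complex"
  assumes g: "is_plancherel_transform f g"
  shows "is_plancherel_transform f (fourier f)" and "AE \<xi> in lborel. fourier f \<xi> = g \<xi>"
proof -
  let ?T = "\<lambda>r. fourier_integral (\<lambda>x. indicator (ball 0 r) x * f x)"
  have f: "f \<in> Lp_space 2" and tg: "tendsto_Lp 2 ?T g at_top"
    using g by (auto simp: is_plancherel_transform_def)
  have [measurable]: "f \<in> borel_measurable lborel" "g \<in> borel_measurable lborel"
    using f tg by (auto simp: Lp_space_2_iff tendsto_Lp_2_iff)
  have "is_plancherel_transform f (fourier f) \<and> (AE \<xi> in lborel. fourier f \<xi> = g \<xi>)"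
  proof (cases "integrable lborel f")
    case False
    then have "is_plancherel_transform f (fourier f)"
      using someI[of "is_plancherel_transform f", OF g] by (simp add: fourier_def)
    then show ?thesis using tendsto_Lp_2_unique[OF _ tg trivial_limit_at_top_linorder]
      by (auto simp: is_plancherel_transform_def)
  next
    case True
    then have F: "fourier f = fourier_integral f" by (simp add: fourier_def)
    have "L2sq (\<lambda>\<xi>. fourier_integral f \<xi> - g \<xi>) \<le> 0"
    proof (rule L2sq_Fatou)
      show "(\<lambda>n. L2sq (\<lambda>\<xi>. ?T (real n) \<xi> - g \<xi>)) \<longlonglongrightarrow> 0"
        using tg[unfolded tendsto_Lp_2_iff] by (intro filterlim_compose[OF _ filterlim_real_sequentially]) auto
      have "(\<lambda>n. ?T (real n) \<xi>) \<longlonglongrightarrow> fourier_integral f \<xi>" for \<xi>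
        unfolding fourier_integral_def
      proof (rule integral_dominated_convergence)
        show "integrable lborel (\<lambda>x. norm (f x))" using True by simp
        show "AE x in lborel. (\<lambda>n. exp (- \<i> * of_real (x \<bullet> \<xi>)) * (indicator (ball 0 (real n)) x * f x)) \<longlonglongrightarrow> exp (- \<i> * of_real (x \<bullet> \<xi>)) * f x"
        proof (rule AE_I2, rule tendsto_eventually)
          fix x :: 'a
          have "\<forall>\<^sub>F n in sequentially. norm x < real n"
            using filterlim_real_sequentially unfolding filterlim_at_top_dense by blast
          then show "\<forall>\<^sub>F n in sequentially. exp (- \<i> * of_real (x \<bullet> \<xi>)) * (indicator (ball 0 (real n)) x * f x) = exp (- \<i> * of_real (x \<bullet> \<xi>)) * f x"
            by eventually_elim simp
        qed
      qed (auto simp: norm_mult split: split_indicator)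
      then show "AE \<xi> in lborel. (\<lambda>n. ?T (real n) \<xi> - g \<xi>) \<longlonglongrightarrow> fourier_integral f \<xi> - g \<xi>"
        by (auto intro!: tendsto_intros)
    qed auto
    then have "AE \<xi> in lborel. fourier_integral f \<xi> = g \<xi>" by (simp add: L2sq_eq_0_iff)
    moreover from this have "tendsto_Lp 2 ?T (fourier_integral f) at_top"
      by (intro tendsto_Lp_2_cong_AE[OF tg]) (auto elim: eventually_mono)
    ultimately show ?thesis using f F by (simp add: is_plancherel_transform_def)
  qed
  then show "is_plancherel_transform f (fourier f)" "AE \<xi> in lborel. fourier f \<xi> = g \<xi>" by auto
qed

context compact_Holder
begin

text \<open>The limit lemma applied to the difference quotients. The symbol
  \<open>(|\<xi>|^(2s) - 1) / s\<close> is the difference quotient of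
  \<open>s \<mapsto> |\<xi>|^(2s)\<close> at 0, whose derivative there is the logarithmic
  symbol.\<close>

lemma is_plancherel_transform_log_laplacian:
  "is_plancherel_transform (\<lambda>x. complex_of_real (\<Lambda> x))
     (\<lambda>\<xi>. of_real (2 * ln (norm \<xi>)) * fourier_integral (\<lambda>x. complex_of_real (u x)) \<xi>)"
proof -
  \<comment> \<open>Fatou needs a sequence of orders. The bound \<open>\<alpha> / 4\<close> meets
    the kernel estimates, and \<open>1 / 2\<close> keeps every order below 1, as the symbol formula
    requires.\<close>
  define c where "c = min (\<alpha> / 4) (1 / 2)"
  define s where "s n = c / real (Suc n)" for n
  have c: "0 < c" "c \<le> \<alpha> / 4" "c < 1" using \<alpha>_pos by (auto simp: c_def)
  have s: "0 < s n" "s n \<le> \<alpha> / 4" "s n < 1" for n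
  proof -
    have "s n \<le> c" using c by (simp add: s_def divide_le_eq mult_le_cancel_left1)
    then show "s n \<le> \<alpha> / 4" "s n < 1" using c by linarith+
    show "0 < s n" using c by (simp add: s_def)
  qed
  have s0: "s \<longlonglongrightarrow> 0"
    unfolding s_def[abs_def] by (rule LIMSEQ_Suc[OF lim_const_over_n])
  have sr: "filterlim s (at_right 0) sequentially"
  proof -
    have "s n \<noteq> 0" for n using s(1)[of n] by simp
    then show ?thesis using s0 s(1) by (simp add: filterlim_at)
  qed
  define h where "h n x = complex_of_real ((frac_laplacian (s n) u x - u x) / s n)" for n x
  have uint: "integrable lborel (\<lambda>x. complex_of_real (u x))" using integrable_u by simp
  have he: "h n = (\<lambda>x. complex_of_real (1 / s n) * (complex_of_real (frac_laplacian (s n) u x) - complex_of_real (u x)))" for n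
    by (simp add: h_def fun_eq_iff)
  have dint: "integrable lborel (\<lambda>x. complex_of_real (frac_laplacian (s n) u x) - complex_of_real (u x))" for n
    by (intro Bochner_Integration.integrable_diff integrable_frac_laplacian s uint)
  have Fh: "fourier_integral (h n) \<xi> = of_real ((norm \<xi> powr (2 * s n) - 1) / s n) * fourier_integral (\<lambda>x. complex_of_real (u x)) \<xi>" for n \<xi>
  proof -
    have "fourier_integral (h n) \<xi> = of_real (1 / s n) * fourier_integral (\<lambda>x. complex_of_real (frac_laplacian (s n) u x) - complex_of_real (u x)) \<xi>"
      unfolding he fourier_integral_def by (subst integral_mult_right_zero[symmetric]) (simp add: mult_ac)
    also have "\<dots> = of_real (1 / s n) * (of_real (norm \<xi> powr (2 * s n)) * fourier_integral (\<lambda>x. complex_of_real (u x)) \<xi> - fourier_integral (\<lambda>x. complex_of_real (u x)) \<xi>)"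
      by (subst fourier_integral_diff[OF integrable_frac_laplacian[OF s] uint]) (simp only: fourier_integral_frac_laplacian[OF s])
    finally show ?thesis by (simp add: algebra_simps diff_divide_distrib)
  qed
  have L: "tendsto_Lp 2 (\<lambda>s x. (frac_laplacian s u x - u x) / s) \<Lambda> (at_right 0)"
    by (rule tendsto_Lp_quotient) simp
  show ?thesis
  proof (rule is_plancherel_transform_limit)
    show "(\<lambda>x. complex_of_real (\<Lambda> x)) \<in> Lp_space 2"
      using L by (simp add: tendsto_Lp_def Lp_space_def)
    show "integrable lborel (h n)" for n
      unfolding he by (rule integrable_mult_right[OF dint])
    have "((\<lambda>s. L2sq (\<lambda>x. (frac_laplacian s u x - u x) / s - \<Lambda> x)) \<longlongrightarrow> 0) (at_right 0)"
      using L by (simp add: tendsto_Lp_2_iff)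
    from filterlim_compose[OF this sr]
    have "(\<lambda>n. L2sq (\<lambda>x. (frac_laplacian (s n) u x - u x) / s n - \<Lambda> x)) \<longlonglongrightarrow> 0" .
    moreover have "L2sq (\<lambda>x. h n x - complex_of_real (\<Lambda> x)) = L2sq (\<lambda>x. (frac_laplacian (s n) u x - u x) / s n - \<Lambda> x)" for n
      unfolding L2sq_def h_def of_real_diff[symmetric] norm_of_real real_norm_def ..
    ultimately show "(\<lambda>n. L2sq (\<lambda>x. h n x - complex_of_real (\<Lambda> x))) \<longlonglongrightarrow> 0" by simp
    show "AE \<xi> in lborel. (\<lambda>n. fourier_integral (h n) \<xi>) \<longlonglongrightarrow> of_real (2 * ln (norm \<xi>)) * fourier_integral (\<lambda>x. complex_of_real (u x)) \<xi>"
      \<comment> \<open>At \<open>\<xi> = 0\<close> the factor equals \<open>- 1 / s\<close> and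
        diverges, so the origin is left out as a null set.\<close>
      using AE_lborel_singleton[of "0::'a"]
    proof eventually_elim
      case (elim \<xi>)
      have "((\<lambda>t. norm \<xi> powr (2 * t)) has_real_derivative 2 * ln (norm \<xi>)) (at 0)"
        using elim by (auto intro!: derivative_eq_intros)
      then have "((\<lambda>t. (norm \<xi> powr (2 * t) - 1) / t) \<longlongrightarrow> 2 * ln (norm \<xi>)) (at 0)"
        using elim by (simp add: has_field_derivative_iff)
      moreover have "filterlim s (at 0) sequentially"
        using sr by (rule filterlim_mono) (auto intro: at_le)
      ultimately have "(\<lambda>n. (norm \<xi> powr (2 * s n) - 1) / s n) \<longlonglongrightarrow> 2 * ln (norm \<xi>)"
        by (rule filterlim_compose)
      then show ?case unfolding Fh by (intro tendsto_intros)
    qed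
    have [measurable]: "(\<lambda>x. complex_of_real (u x)) \<in> borel_measurable lborel" by simp
    show "(\<lambda>\<xi>. of_real (2 * ln (norm \<xi>)) * fourier_integral (\<lambda>x. complex_of_real (u x)) \<xi>) \<in> borel_measurable lborel"
      by measurable
  qed
qed

end

theorem theorem1p1:
  fixes u :: "'a::euclidean_space \<Rightarrow> real" and \<beta> :: real
  assumes "\<beta> > 0" and "u \<in> Holder_c \<beta>"
  shows "(\<forall>\<^sub>F s in at_right 0. \<forall>x. frac_laplacian_exists s u x)
    \<and> (\<forall>x. ((\<lambda>s. frac_laplacian s u x) has_real_derivative log_laplacian u x) (at_right 0)
        \<and> integrable lborel (\<lambda>y. (u x * indicator (ball x 1) y - u y) / norm (x - y) ^ DIM('a))
        \<and> log_laplacian u x =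
            log_const DIM('a) *
              (LINT y|lborel. (u x * indicator (ball x 1) y - u y) / norm (x - y) ^ DIM('a))
            + rho_const DIM('a) * u x
        \<and> set_integrable lborel (ball x 1) (\<lambda>y. (u x - u y) / norm (x - y) ^ DIM('a))
        \<and> set_integrable lborel (- ball x 1) (\<lambda>y. u y / norm (x - y) ^ DIM('a))
        \<and> log_laplacian u x =
            log_const DIM('a) * (LINT y:ball x 1|lborel. (u x - u y) / norm (x - y) ^ DIM('a))
            - log_const DIM('a) * (LINT y:- ball x 1|lborel. u y / norm (x - y) ^ DIM('a))
            + rho_const DIM('a) * u x)
    \<and> log_const DIM('a) = 2 / sphere_surface_measure (sphere (0::'a) 1)
    \<and> (\<forall>p::ennreal. 1 < p \<longrightarrow>
          log_laplacian u \<in> Lp_space p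
        \<and> tendsto_Lp p (\<lambda>s x. (frac_laplacian s u x - u x) / s) (log_laplacian u) (at_right 0))
    \<and> is_plancherel_transform (\<lambda>x. complex_of_real (log_laplacian u x))
          (fourier (\<lambda>x. complex_of_real (log_laplacian u x)))
    \<and> (AE \<xi> in lborel. fourier (\<lambda>x. complex_of_real (log_laplacian u x)) \<xi> =
          of_real (2 * ln (norm \<xi>)) * fourier (\<lambda>x. complex_of_real (u x)) \<xi>)"
proof -
  obtain C \<alpha> R where "compact_Holder u C \<alpha> R"
    using Holder_c_imp_compact_Holder[OF assms] .
  then interpret compact_Holder u C \<alpha> R .
  have \<Lambda>: "log_laplacian u = \<Lambda>" by (rule ext) (rule log_laplacian_eq)
  \<comment> \<open>As \<open>u\<close> is integrable, its transform is the integral; for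
    \<open>log_laplacian u\<close> either branch of \<open>fourier\<close> may apply.\<close>
  have "fourier (\<lambda>x. complex_of_real (u x)) = fourier_integral (\<lambda>x. complex_of_real (u x))"
    using integrable_u by (simp add: fourier_def)
  then have P: "is_plancherel_transform (\<lambda>x. complex_of_real (log_laplacian u x))
     (\<lambda>\<xi>. of_real (2 * ln (norm \<xi>)) * fourier (\<lambda>x. complex_of_real (u x)) \<xi>)"
    using is_plancherel_transform_log_laplacian by (simp only: \<Lambda>)
  have T: "tendsto_Lp p (\<lambda>s x. (frac_laplacian s u x - u x) / s) (log_laplacian u) (at_right 0)" if "1 < p" for p
    using tendsto_Lp_quotient[OF that] by (simp only: \<Lambda>)
  have "\<forall>\<^sub>F s in at_right 0. 0 < s \<and> s \<le> \<alpha> / 4" using \<alpha>_pos by (intro eventually_small) auto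
  then have E: "\<forall>\<^sub>F s in at_right 0. \<forall>x. frac_laplacian_exists s u x"
    by eventually_elim (auto intro: frac_laplacian_exists)
  have c: "log_const DIM('a) = 2 / sphere_surface_measure (sphere (0::'a) 1)"
    by (simp add: sphere_surface_measure_sphere log_const_eq_sphere_area)
  show ?thesis
  proof (intro conjI allI impI)
    show "log_laplacian u \<in> Lp_space p" if "1 < p" for p
      using T[OF that] by (simp add: tendsto_Lp_def)
  qed (fact E has_real_derivative_frac_laplacian log_laplacian_formulas c T is_plancherel_transform_fourier[OF P])+
qed

end
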